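(* Let $k$ be one of the following fields: (1) the field $\mathbb{R}$ of real numbers; (2) the field $\mathbb{Q}_p$ of $p$-adic numbers (for a prime $p$); (3) a number field; (4) a finitely generated extension field of $\mathbb{Q}$; (5) the field of rational functions of a positive-dimensional (irreducible) variety defined over some field $k_0$ of characteristic zero; (6) the field of meromorphic functions of a (connected) complex manifold which admits a non-constant meromorphic function; (7) $\mathbb{Q}^{ab}$, i.e. the maximal abelian field extension of $\mathbb{Q}$. Then there is a one-dimensional commutative connected reductive $k$-group $G$ with a non-linearizable action on $\mathbb{A}^4$.
   Context: A $k$-group is an algebraic group defined over $k$; $\mathbb{A}^n$ is affine $n$-space over $k$. An action of a $k$-group $G$ on $\mathbb{A}^n$ (defined over $k$) is a group action given by a morphism of $k$-varieties $\mu: G\times\mathbb{A}^n\to\mathbb{A}^n$. Such an action is called linearizable (over $k$) if and only if there exists an automorphism $\phi$ of $\mathbb{A}^n$ as a $k$-variety such that $v\mapsto \phi(\mu(g,\phi^{-1}(v)))$ is a linear map for every $g\in G$ (here points of $G$ and $\mathbb{A}^n$ may be taken over an algebraic closure $\bar k$). "Non-linearizable" means not linearizable over $k$. *)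

theory Defs
  imports
    "HOL-Analysis.Analysis"
    "HOL-Algebra.Algebraic_Closure_Type"
    "HOL-Algebra.Generated_Fields"
    "HOL-Algebra.Group_Action"
    "HOL-Library.Extended_Nat"
    "Jordan_Normal_Form.Matrix"
begin

no_notation vec_nth (infixl "$" 90)

section \<open>Classical algebraic geometry over a field of characteristic zero\<close>

text \<open>
  The whole type \<^typ>\<open>'a\<close> is an algebraically closed field of characteristic zero and \<open>k\<close> is a
  subfield of it.  Points have coordinates in \<^typ>\<open>'a\<close>; being defined over \<open>k\<close> means being given by
  polynomials with coefficients in \<open>k\<close>.  As \<open>k\<close> is perfect, a closed set is defined over \<open>k\<close> iff it
  is the zero locus of such polynomials.  Passing \<^term>\<open>UNIV\<close> instead of \<open>k\<close> yields the
  geometric notion, over the algebraic closure.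
\<close>

subsection \<open>Affine space, its Zariski topology, and morphisms\<close>

inductive_set poly_fun :: "'a::field set \<Rightarrow> nat \<Rightarrow> ('a Matrix.vec \<Rightarrow> 'a) set"
  for k :: "'a set" and n :: nat where
  const: "c \<in> k \<Longrightarrow> (\<lambda>_. c) \<in> poly_fun k n"
| coord: "i < n \<Longrightarrow> (\<lambda>x. x $ i) \<in> poly_fun k n"
| add: "f \<in> poly_fun k n \<Longrightarrow> g \<in> poly_fun k n \<Longrightarrow> (\<lambda>x. f x + g x) \<in> poly_fun k n"
| mult: "f \<in> poly_fun k n \<Longrightarrow> g \<in> poly_fun k n \<Longrightarrow> (\<lambda>x. f x * g x) \<in> poly_fun k n"

definition zero_locus :: "nat \<Rightarrow> ('a::field Matrix.vec \<Rightarrow> 'a) set \<Rightarrow> 'a Matrix.vec set" where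
  "zero_locus n P = {x \<in> carrier_vec n. \<forall>f\<in>P. f x = 0}"

definition zariski :: "'a::field set \<Rightarrow> nat \<Rightarrow> 'a Matrix.vec topology" where
  "zariski k n = topology (\<lambda>U. \<exists>P \<subseteq> poly_fun k n. U = carrier_vec n - zero_locus n P)"

definition regular_map ::
  "'a::field set \<Rightarrow> nat \<Rightarrow> 'a Matrix.vec set \<Rightarrow> nat \<Rightarrow> 'a Matrix.vec set \<Rightarrow>
    ('a Matrix.vec \<Rightarrow> 'a Matrix.vec) \<Rightarrow> bool" where
  "regular_map k n E m F f \<longleftrightarrow>
     f ` E \<subseteq> F \<and>
     (\<exists>p. (\<forall>i<m. p i \<in> poly_fun k n) \<and> (\<forall>x\<in>E. f x = Matrix.vec m (\<lambda>i. p i x)))"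

text \<open>The product of subsets of affine \<open>n\<close>- and \<open>m\<close>-space, as a subset of affine \<open>(n + m)\<close>-space.\<close>

definition aff_prod :: "'a Matrix.vec set \<Rightarrow> 'a Matrix.vec set \<Rightarrow> 'a Matrix.vec set" where
  "aff_prod E F = {x @\<^sub>v y | x y. x \<in> E \<and> y \<in> F}"

definition irreducible_in :: "'b topology \<Rightarrow> 'b set \<Rightarrow> bool" where
  "irreducible_in T Z \<longleftrightarrow>
     Z \<noteq> {} \<and> Z \<subseteq> topspace T \<and>
     (\<forall>A B. closedin T A \<and> closedin T B \<and> Z \<subseteq> A \<union> B \<longrightarrow> Z \<subseteq> A \<or> Z \<subseteq> B)"

definition krull_dim :: "'b topology \<Rightarrow> enat" where
  "krull_dim T = Sup {enat d | d. \<exists>Z :: nat \<Rightarrow> 'b set.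
     (\<forall>i\<le>d. closedin T (Z i) \<and> irreducible_in T (Z i)) \<and> (\<forall>i<d. Z i \<subset> Z (Suc i))}"

lemma istopology_zariski:
  fixes k :: "'a::field set"
  assumes "0 \<in> k" "1 \<in> k"
  shows "istopology (\<lambda>U. \<exists>P \<subseteq> poly_fun k n. U = carrier_vec n - zero_locus n P)"
  unfolding istopology_def
proof (intro conjI allI impI)
  fix S T :: "'a Matrix.vec set"
  assume "\<exists>P \<subseteq> poly_fun k n. S = carrier_vec n - zero_locus n P"
    and "\<exists>P \<subseteq> poly_fun k n. T = carrier_vec n - zero_locus n P"
  then obtain P Q where P: "P \<subseteq> poly_fun k n" "S = carrier_vec n - zero_locus n P"
    and Q: "Q \<subseteq> poly_fun k n" "T = carrier_vec n - zero_locus n Q" by blast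
  let ?R = "{\<lambda>x. f x * g x | f g. f \<in> P \<and> g \<in> Q}"
  have "?R \<subseteq> poly_fun k n" using P(1) Q(1) by (auto intro: poly_fun.mult)
  moreover have "S \<inter> T = carrier_vec n - zero_locus n ?R"
    unfolding P(2) Q(2) zero_locus_def by fastforce
  ultimately show "\<exists>P \<subseteq> poly_fun k n. S \<inter> T = carrier_vec n - zero_locus n P" by blast
next
  fix \<K> :: "'a Matrix.vec set set"
  assume K: "\<forall>S\<in>\<K>. \<exists>P \<subseteq> poly_fun k n. S = carrier_vec n - zero_locus n P"
  then obtain P where P: "\<And>S. S \<in> \<K> \<Longrightarrow> P S \<subseteq> poly_fun k n \<and> S = carrier_vec n - zero_locus n (P S)"
    by metis
  have "\<Union>\<K> = carrier_vec n - zero_locus n (\<Union>(P ` \<K>))"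
  proof (intro subset_antisym subsetI)
    fix x assume "x \<in> \<Union>\<K>"
    then obtain S where S: "S \<in> \<K>" "x \<in> S" by blast
    then show "x \<in> carrier_vec n - zero_locus n (\<Union>(P ` \<K>))"
      using P[OF S(1)] unfolding zero_locus_def by fastforce
  next
    fix x assume x: "x \<in> carrier_vec n - zero_locus n (\<Union>(P ` \<K>))"
    then obtain S f where S: "S \<in> \<K>" "f \<in> P S" "f x \<noteq> 0"
      unfolding zero_locus_def by blast
    then have "x \<in> S" using P[OF S(1)] x unfolding zero_locus_def by blast
    then show "x \<in> \<Union>\<K>" using S(1) by blast
  qed
  moreover have "\<Union>(P ` \<K>) \<subseteq> poly_fun k n" using P by blast
  ultimately show "\<exists>P \<subseteq> poly_fun k n. \<Union>\<K> = carrier_vec n - zero_locus n P" by blast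
qed

lemma closedin_zariski:
  fixes k :: "'a::field set"
  assumes "0 \<in> k" "1 \<in> k"
  shows "topspace (zariski k n) = carrier_vec n"
    and "closedin (zariski k n) E \<longleftrightarrow> (\<exists>P \<subseteq> poly_fun k n. E = zero_locus n P)"
proof -
  have op: "openin (zariski k n) U \<longleftrightarrow> (\<exists>P \<subseteq> poly_fun k n. U = carrier_vec n - zero_locus n P)" for U
    using istopology_zariski[OF assms] by (simp add: zariski_def)
  have "zero_locus n {\<lambda>_. 1 :: 'a} = {}" by (auto simp: zero_locus_def)
  then have "openin (zariski k n) (carrier_vec n)"
    unfolding op by (intro exI[of _ "{\<lambda>_. 1}"]) (auto intro: poly_fun.const assms)
  moreover have "U \<subseteq> carrier_vec n" if "openin (zariski k n) U" for U
    using that unfolding op by blast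
  ultimately show top: "topspace (zariski k n) = carrier_vec n"
    by (metis openin_subset openin_topspace subset_antisym)
  have sub: "zero_locus n P \<subseteq> carrier_vec n" for P :: "('a Matrix.vec \<Rightarrow> 'a) set"
    by (auto simp: zero_locus_def)
  show "closedin (zariski k n) E \<longleftrightarrow> (\<exists>P \<subseteq> poly_fun k n. E = zero_locus n P)"
    unfolding closedin_def top op using sub by (metis Diff_subset double_diff order_refl)
qed

subsection \<open>Algebraic groups and their actions\<close>

text \<open>
  An affine \<open>k\<close>-group, embedded as a closed subset of affine \<open>n\<close>-space.  The record is the group
  of geometric points.
\<close>

definition k_group :: "'a::field set \<Rightarrow> nat \<Rightarrow> 'a Matrix.vec monoid \<Rightarrow> bool" where
  "k_group k n G \<longleftrightarrow>
     group G \<and>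
     closedin (zariski k n) (carrier G) \<and>
     (\<forall>i<n. \<one>\<^bsub>G\<^esub> $ i \<in> k) \<and>
     regular_map k (n + n) (aff_prod (carrier G) (carrier G)) n (carrier G)
       (\<lambda>z. vec_first z n \<otimes>\<^bsub>G\<^esub> vec_last z n) \<and>
     regular_map k n (carrier G) n (carrier G) (\<lambda>x. inv\<^bsub>G\<^esub> x)"

text \<open>
  An element is unipotent iff right translation by it is a locally unipotent operator on the
  algebra of regular functions.
\<close>

definition unipotent_element :: "nat \<Rightarrow> 'a::field Matrix.vec monoid \<Rightarrow> 'a Matrix.vec \<Rightarrow> bool" where
  "unipotent_element n G g \<longleftrightarrow>
     (\<forall>f \<in> poly_fun UNIV n. \<exists>N. \<forall>x \<in> carrier G.
        ((\<lambda>h x. h (x \<otimes>\<^bsub>G\<^esub> g) - h x) ^^ N) f x = 0)"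

definition connected_group :: "nat \<Rightarrow> 'a::field Matrix.vec monoid \<Rightarrow> bool" where
  "connected_group n G \<longleftrightarrow> connected_space (subtopology (zariski UNIV n) (carrier G))"

definition group_dim :: "nat \<Rightarrow> 'a::field Matrix.vec monoid \<Rightarrow> enat" where
  "group_dim n G = krull_dim (subtopology (zariski UNIV n) (carrier G))"

text \<open>Triviality of the (geometric) unipotent radical.\<close>

definition reductive_group :: "nat \<Rightarrow> 'a::field Matrix.vec monoid \<Rightarrow> bool" where
  "reductive_group n G \<longleftrightarrow>
     (\<forall>U. normal U G \<and> closedin (zariski UNIV n) U \<and>
          connected_group n (G\<lparr>carrier := U\<rparr>) \<and> (\<forall>u\<in>U. unipotent_element n G u)
          \<longrightarrow> U = {\<one>\<^bsub>G\<^esub>})"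

definition algebraic_action ::
  "'a::field set \<Rightarrow> nat \<Rightarrow> 'a Matrix.vec monoid \<Rightarrow> nat \<Rightarrow>
    ('a Matrix.vec \<Rightarrow> 'a Matrix.vec \<Rightarrow> 'a Matrix.vec) \<Rightarrow> bool" where
  "algebraic_action k n G m \<mu> \<longleftrightarrow>
     group_action G (carrier_vec m) \<mu> \<and>
     regular_map k (n + m) (aff_prod (carrier G) (carrier_vec m)) m (carrier_vec m)
       (\<lambda>z. \<mu> (vec_first z n) (vec_last z m))"

definition affine_space_automorphism ::
  "'a::field set \<Rightarrow> nat \<Rightarrow> ('a Matrix.vec \<Rightarrow> 'a Matrix.vec) \<Rightarrow> bool" where
  "affine_space_automorphism k m \<phi> \<longleftrightarrow>
     bij_betw \<phi> (carrier_vec m) (carrier_vec m) \<and>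
     regular_map k m (carrier_vec m) m (carrier_vec m) \<phi> \<and>
     regular_map k m (carrier_vec m) m (carrier_vec m) (inv_into (carrier_vec m) \<phi>)"

definition linear_endo :: "nat \<Rightarrow> ('a::field Matrix.vec \<Rightarrow> 'a Matrix.vec) \<Rightarrow> bool" where
  "linear_endo m f \<longleftrightarrow> (\<exists>A \<in> carrier_mat m m. \<forall>v \<in> carrier_vec m. f v = A *\<^sub>v v)"

definition linearizable ::
  "'a::field set \<Rightarrow> 'a Matrix.vec monoid \<Rightarrow> nat \<Rightarrow>
    ('a Matrix.vec \<Rightarrow> 'a Matrix.vec \<Rightarrow> 'a Matrix.vec) \<Rightarrow> bool" where
  "linearizable k G m \<mu> \<longleftrightarrow>
     (\<exists>\<phi>. affine_space_automorphism k m \<phi> \<and>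
          (\<forall>g \<in> carrier G. linear_endo m (\<lambda>v. \<phi> (\<mu> g (inv_into (carrier_vec m) \<phi> v)))))"


section \<open>The fields\<close>

abbreviation field_of :: "'a::field set \<Rightarrow> 'a ring" where
  "field_of k \<equiv> ring_of_type_algebra\<lparr>carrier := k\<rparr>"

definition fun_ring :: "('x \<Rightarrow> 'b::comm_ring_1) set \<Rightarrow> ('x \<Rightarrow> 'b) ring" where
  "fun_ring S = \<lparr>carrier = S, monoid.mult = (\<lambda>f g x. f x * g x), one = (\<lambda>_. 1),
                 ring.zero = (\<lambda>_. 0), add = (\<lambda>f g x. f x + g x)\<rparr>"

subsection \<open>p-adic numbers\<close>

definition padic_abs :: "nat \<Rightarrow> rat \<Rightarrow> real" where
  "padic_abs p x = (if x = 0 then 0 else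
     real p powi (int (multiplicity (int p) (snd (quotient_of x))) -
                  int (multiplicity (int p) (fst (quotient_of x)))))"

definition padic_cauchy :: "nat \<Rightarrow> (nat \<Rightarrow> rat) set" where
  "padic_cauchy p = {x. \<forall>e>0. \<exists>N. \<forall>i\<ge>N. \<forall>j\<ge>N. padic_abs p (x i - x j) < e}"

definition padic_null :: "nat \<Rightarrow> (nat \<Rightarrow> rat) set" where
  "padic_null p = {x. (\<lambda>i. padic_abs p (x i)) \<longlonglongrightarrow> 0}"

definition padic_field :: "nat \<Rightarrow> (nat \<Rightarrow> rat) set ring" where
  "padic_field p = fun_ring (padic_cauchy p) Quot padic_null p"

subsection \<open>Number fields, finitely generated fields, and the maximal abelian extension of the rationals\<close>

definition number_field :: "'a::field_char_0 set \<Rightarrow> bool" where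
  "number_field k \<longleftrightarrow>
     subfield k ring_of_type_algebra \<and> ring.finite_dimension ring_of_type_algebra \<rat> k"

text \<open>\<^const>\<open>generate_field\<close> always contains the prime field, here \<^term>\<open>\<rat>\<close>.\<close>

definition finitely_generated_field :: "'a::field_char_0 set \<Rightarrow> bool" where
  "finitely_generated_field k \<longleftrightarrow>
     (\<exists>S. finite S \<and> k = generate_field ring_of_type_algebra S)"

text \<open>
  Algebraic Galois extensions of \<^term>\<open>\<rat>\<close> with commutative Galois group.  Ring automorphisms fix
  \<^term>\<open>\<rat>\<close> automatically.
\<close>

definition abelian_extension_of_Q :: "'a::field_char_0 set \<Rightarrow> bool" where
  "abelian_extension_of_Q L \<longleftrightarrow>
     subfield L ring_of_type_algebra \<and>
     (\<forall>x\<in>L. Polynomial.algebraic x) \<and>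
     {x \<in> L. \<forall>\<sigma> \<in> ring_iso (field_of L) (field_of L). \<sigma> x = x} = \<rat> \<and>
     (\<forall>\<sigma> \<in> ring_iso (field_of L) (field_of L). \<forall>\<tau> \<in> ring_iso (field_of L) (field_of L).
        \<forall>x\<in>L. \<sigma> (\<tau> x) = \<tau> (\<sigma> x))"

definition maximal_abelian_extension_of_Q :: "'a::field_char_0 set \<Rightarrow> bool" where
  "maximal_abelian_extension_of_Q k \<longleftrightarrow>
     abelian_extension_of_Q k \<and> (\<forall>L. abelian_extension_of_Q L \<and> k \<subseteq> L \<longrightarrow> L = k)"

subsection \<open>Function fields of varieties\<close>

definition coordinate_ring ::
  "'a::field set \<Rightarrow> nat \<Rightarrow> 'a Matrix.vec set \<Rightarrow> ('a Matrix.vec \<Rightarrow> 'a) set ring" where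
  "coordinate_ring k n V =
     fun_ring (poly_fun k n) Quot {f \<in> poly_fun k n. \<forall>x\<in>V. f x = 0}"

definition is_fraction_field :: "('b, 'c) ring_scheme \<Rightarrow> ('d, 'e) ring_scheme \<Rightarrow> bool" where
  "is_fraction_field A F \<longleftrightarrow>
     field F \<and>
     (\<exists>\<iota> \<in> Ring.ring_hom A F. inj_on \<iota> (carrier A) \<and>
        (\<forall>x \<in> carrier F. \<exists>a \<in> carrier A. \<exists>b \<in> carrier A. b \<noteq> \<zero>\<^bsub>A\<^esub> \<and>
            x = \<iota> a \<otimes>\<^bsub>F\<^esub> inv\<^bsub>F\<^esub> (\<iota> b)))"

text \<open>
  \<open>k\<close> is the field of rational functions of a positive-dimensional irreducible variety over some
  subfield \<open>k\<^sub>0\<close>.  The function field depends only on a dense affine open part, so affine varieties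
  suffice; and constants embed into the function field, so \<open>k\<^sub>0\<close> may be taken inside \<^typ>\<open>'a\<close>.  Points
  are taken over \<^typ>\<open>'a\<close>, which may be larger than the algebraic closure of \<open>k\<^sub>0\<close>; irreducibility and
  dimension refer to the topology of \<open>k\<^sub>0\<close>-closed sets and do not depend on this choice.
  Irreducibility over \<open>k\<^sub>0\<close> is all that is required, not geometric irreducibility.
\<close>

definition variety_function_field :: "'a::field_char_0 set \<Rightarrow> bool" where
  "variety_function_field k \<longleftrightarrow>
     (\<exists>(k\<^sub>0 :: 'a set) n V. subfield k\<^sub>0 ring_of_type_algebra \<and>
        closedin (zariski k\<^sub>0 n) V \<and> irreducible_in (zariski k\<^sub>0 n) V \<and>
        krull_dim (subtopology (zariski k\<^sub>0 n) V) > 0 \<and>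
        is_fraction_field (coordinate_ring k\<^sub>0 n V) (field_of k))"

subsection \<open>Meromorphic functions on complex manifolds\<close>

definition holomorphic_sev :: "(complex ^ 'n \<Rightarrow> complex) \<Rightarrow> (complex ^ 'n) set \<Rightarrow> bool" where
  "holomorphic_sev f S \<longleftrightarrow>
     (\<forall>z\<in>S. \<exists>D. (f has_derivative D) (at z) \<and> (\<forall>c v. D (c *s v) = c * D v))"

text \<open>A manifold is a Hausdorff space with a holomorphic atlas; no countability axiom is imposed.\<close>

definition complex_manifold ::
  "'m topology \<Rightarrow> ('m set \<times> ('m \<Rightarrow> complex ^ 'n)) set \<Rightarrow> bool" where
  "complex_manifold M \<A> \<longleftrightarrow>
     Hausdorff_space M \<and>
     (\<Union>(U, \<phi>)\<in>\<A>. U) = topspace M \<and>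
     (\<forall>(U, \<phi>)\<in>\<A>. openin M U \<and> open (\<phi> ` U) \<and>
        homeomorphic_map (subtopology M U) (top_of_set (\<phi> ` U)) \<phi>) \<and>
     (\<forall>(U, \<phi>)\<in>\<A>. \<forall>(V, \<psi>)\<in>\<A>. \<forall>i.
        holomorphic_sev (\<lambda>z. vec_nth (\<psi> (inv_into U \<phi> z)) i) (\<phi> ` (U \<inter> V)))"

definition holomorphic_mfd ::
  "('m set \<times> ('m \<Rightarrow> complex ^ 'n)) set \<Rightarrow> ('m \<Rightarrow> complex) \<Rightarrow> 'm set \<Rightarrow> bool" where
  "holomorphic_mfd \<A> f W \<longleftrightarrow>
     (\<forall>(U, \<phi>)\<in>\<A>. holomorphic_sev (\<lambda>z. f (inv_into U \<phi> z)) (\<phi> ` (U \<inter> W)))"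

text \<open>
  Functions that are locally \<open>g / h\<close> wherever the holomorphic denominator \<open>h\<close>, which vanishes
  identically on no nonempty open set, is nonzero.  Values elsewhere are arbitrary, so
  meromorphic functions proper are classes of such functions modulo equality on an open dense set.
\<close>

definition meromorphic_reps ::
  "'m topology \<Rightarrow> ('m set \<times> ('m \<Rightarrow> complex ^ 'n)) set \<Rightarrow> ('m \<Rightarrow> complex) set" where
  "meromorphic_reps M \<A> = {f. \<forall>x \<in> topspace M. \<exists>W g h.
     openin M W \<and> x \<in> W \<and> holomorphic_mfd \<A> g W \<and> holomorphic_mfd \<A> h W \<and>
     (\<forall>W'. openin M W' \<and> W' \<subseteq> W \<and> W' \<noteq> {} \<longrightarrow> (\<exists>y\<in>W'. h y \<noteq> 0)) \<and>
     (\<forall>y\<in>W. h y \<noteq> 0 \<longrightarrow> f y = g y / h y)}"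

definition meromorphic_null ::
  "'m topology \<Rightarrow> ('m set \<times> ('m \<Rightarrow> complex ^ 'n)) set \<Rightarrow> ('m \<Rightarrow> complex) set" where
  "meromorphic_null M \<A> = {f \<in> meromorphic_reps M \<A>.
     \<exists>D. openin M D \<and> M closure_of D = topspace M \<and> (\<forall>x\<in>D. f x = 0)}"

definition meromorphic_field ::
  "'m topology \<Rightarrow> ('m set \<times> ('m \<Rightarrow> complex ^ 'n)) set \<Rightarrow> ('m \<Rightarrow> complex) set ring" where
  "meromorphic_field M \<A> = fun_ring (meromorphic_reps M \<A>) Quot meromorphic_null M \<A>"

definition admits_nonconstant_meromorphic ::
  "'m topology \<Rightarrow> ('m set \<times> ('m \<Rightarrow> complex ^ 'n)) set \<Rightarrow> bool" where
  "admits_nonconstant_meromorphic M \<A> \<longleftrightarrow>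
     (\<exists>f \<in> meromorphic_reps M \<A>. \<forall>c. (\<lambda>x. f x - c) \<notin> meromorphic_null M \<A>)"

end

theory Submission
  imports Defs "HOL-Complex_Analysis.Complex_Analysis"
begin

text \<open>
  Each field in the list has an element \<open>d\<close> that is not a square; the construction starts from it.
  Let \<open>s\<^sup>2 = d\<close> in the algebraic closure.  The group is the norm-one torus
  \<open>a\<^sup>2 - d b\<^sup>2 = 1\<close>, on which \<open>a + s b\<close> is a character \<open>g\<close> with inverse \<open>a - s b\<close>.

  The action.  Read a pair \<open>(z\<^sub>1, z\<^sub>2)\<close> over \<open>k\<close> as \<open>x = z\<^sub>1 + s z\<^sub>2\<close> together with its conjugate
  \<open>y = z\<^sub>1 - s z\<^sub>2\<close>.  The torus acts on three such pairs \<open>(x, y)\<close>, \<open>(u, u')\<close>, \<open>(w, w')\<close> by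
  \<open>g\<^sup>2, g\<^sup>3, g\<close> on the first members and by the inverse powers on the second ones.  The equations
  \<open>y u = w - x w'\<close> and \<open>x u' = w' - y w\<close> cut out an invariant surface bundle over the \<open>(x, y)\<close>-plane:
  where \<open>x y \<noteq> 1\<close> they determine \<open>w, w'\<close>, and where \<open>x y \<noteq> 0\<close> they determine \<open>u, u'\<close>.  The bundle is
  isomorphic to affine four-space over \<open>k\<close>, by the explicit formulas in \<open>emb\<close> and \<open>ret\<close>.

  Why it is not linearizable.  The origin is the only fixed point, so a linearization must be
  equivalent to the tangent representation there, with weights \<open>2, -2, 3, -3\<close>.  It yields an
  equivariant polynomial map \<open>\<Psi>\<close> over \<open>k\<close> from that representation to the bundle, with a polynomial
  left inverse.  On the fixed plane of the element \<open>-1\<close> of the torus, \<open>\<Psi>\<close> multiplies \<open>x\<close> and \<open>y\<close> by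
  nonzero constants \<open>c, c'\<close>.  The derivative of the \<open>w\<close>-coordinate of \<open>\<Psi>\<close> normal to this plane is
  \<open>y e(t) U + x\<^sup>2 h(t) U'\<close> with \<open>t = x y\<close>, and that of \<open>w'\<close> has the conjugate polynomials \<open>e', h'\<close> as
  coefficients.  Injectivity makes \<open>e e' - t h h'\<close> nowhere zero, hence constant.  Conjugate
  polynomials have equal degree, so the two terms have even and odd degree and cannot cancel;
  therefore \<open>h = 0\<close>.  But the equations of the bundle give \<open>h(0) = c e'(0) \<noteq> 0\<close>.  Over \<open>k(s)\<close>
  the argument breaks down, because there \<open>e\<close> and \<open>e'\<close> are unrelated.

  Finding a non-square.  In the real and \<open>p\<close>-adic numbers take \<open>-1\<close> and \<open>p\<close>.  For finitely generated
  fields one shows that having infinitely many square classes passes from a field \<open>F\<close> to \<open>F(y)\<close>;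
  the induction starts with the rationals or, for function fields, with \<open>k\<^sub>0(y)\<close>, \<open>y\<close> transcendental.
  If every element of an abelian extension of the rationals were a square, it would contain
  the fourth roots of two, whose Galois group over the rationals is not commutative.  For a
  nonconstant meromorphic function \<open>f\<close>, subtracting its value at a noncritical point gives a
  function with a simple zero, which has no square root.
\<close>

no_notation fps_nth (infixl \<open>$\<close> 75)
no_notation vec_nth (infixl \<open>$\<close> 90)

section \<open>Square classes of subfields\<close>

text \<open>
  The closure laws behind \<open>subfield F ring_of_type_algebra\<close>, stated with the operations of the type
  so that they can be used directly as introduction rules.
\<close>

locale sub_field =
  fixes F :: "'a::field set"
  assumes zero: "0 \<in> F" and one: "1 \<in> F"
    and add: "x \<in> F \<Longrightarrow> y \<in> F \<Longrightarrow> x + y \<in> F"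
    and mult: "x \<in> F \<Longrightarrow> y \<in> F \<Longrightarrow> x * y \<in> F"
    and uminus: "x \<in> F \<Longrightarrow> - x \<in> F"
    and inverse: "x \<in> F \<Longrightarrow> inverse x \<in> F"
begin

lemma diff: "x \<in> F \<Longrightarrow> y \<in> F \<Longrightarrow> x - y \<in> F"
  using add[of x "- y"] uminus[of y] by simp

lemma divide: "x \<in> F \<Longrightarrow> y \<in> F \<Longrightarrow> x / y \<in> F"
  using mult[of x "inverse y"] inverse[of y] by (simp add: field_simps)

lemma power: "x \<in> F \<Longrightarrow> x ^ n \<in> F"
  by (induction n) (auto intro: one mult)

lemma of_nat: "of_nat n \<in> F"
  by (induction n) (auto intro: zero one add)

lemma of_int: "of_int n \<in> F"
  by (cases n) (auto intro: of_nat uminus simp del: of_nat_Suc)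

lemma numeral: "numeral n \<in> F"
  using of_nat[of "numeral n"] by simp

lemma sum: "(\<And>i. i \<in> I \<Longrightarrow> f i \<in> F) \<Longrightarrow> (\<Sum>i\<in>I. f i) \<in> F"
  by (induction I rule: infinite_finite_induct) (auto intro: zero add)

end

lemma sub_field_UNIV: "sub_field UNIV"
  by unfold_locales auto

lemma ring_of_type_algebra_simps:
  "carrier ring_of_type_algebra = UNIV" "x \<otimes>\<^bsub>ring_of_type_algebra\<^esub> y = x * y"
  "\<one>\<^bsub>ring_of_type_algebra\<^esub> = 1" "\<zero>\<^bsub>ring_of_type_algebra\<^esub> = 0"
  "x \<oplus>\<^bsub>ring_of_type_algebra\<^esub> y = x + y"
  by (simp_all add: ring_of_type_algebra_def)

lemma ring_of_type_algebra_uminus: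
  fixes x :: "'a::field"
  shows "\<ominus>\<^bsub>ring_of_type_algebra\<^esub> x = - x"
proof -
  interpret R: field "ring_of_type_algebra :: 'a ring" by (rule field_from_type_algebra)
  have "(- x) \<oplus>\<^bsub>ring_of_type_algebra\<^esub> x = \<zero>\<^bsub>ring_of_type_algebra\<^esub>"
    by (simp add: ring_of_type_algebra_simps)
  then show ?thesis
    by (metis R.minus_equality UNIV_I ring_of_type_algebra_simps(1))
qed

lemma ring_of_type_algebra_inverse:
  fixes x :: "'a::field"
  assumes "x \<noteq> 0"
  shows "inv\<^bsub>ring_of_type_algebra\<^esub> x = inverse x"
proof -
  interpret R: field "ring_of_type_algebra :: 'a ring" by (rule field_from_type_algebra)
  have "x \<otimes>\<^bsub>ring_of_type_algebra\<^esub> inverse x = \<one>\<^bsub>ring_of_type_algebra\<^esub>"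
    using assms by (simp add: ring_of_type_algebra_simps)
  then show ?thesis
    by (metis R.comm_inv_char UNIV_I ring_of_type_algebra_simps(1))
qed

lemma sub_field_of_subfield:
  fixes F :: "'a::field set"
  assumes "subfield F ring_of_type_algebra"
  shows "sub_field F"
proof -
  interpret R: field "ring_of_type_algebra :: 'a ring" by (rule field_from_type_algebra)
  note sr = subringE[OF subfieldE(1)[OF assms], unfolded ring_of_type_algebra_simps
      ring_of_type_algebra_uminus]
  have inv: "inverse x \<in> F" if "x \<in> F" for x
  proof (cases "x = 0")
    case False
    then have "inv\<^bsub>ring_of_type_algebra\<^esub> x \<in> F"
      using R.subfield_m_inv(1)[OF assms, of x] that by (simp add: ring_of_type_algebra_simps)
    then show ?thesis using False by (simp add: ring_of_type_algebra_inverse)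
  qed (use that in simp)
  show ?thesis
    by unfold_locales (use sr inv in auto)
qed

lemma subfield_of_sub_field:
  fixes F :: "'a::field set"
  assumes "sub_field F"
  shows "subfield F ring_of_type_algebra"
proof -
  interpret R: field "ring_of_type_algebra :: 'a ring" by (rule field_from_type_algebra)
  interpret F: sub_field F by fact
  show ?thesis
  proof (rule R.subfieldI')
    show "subring F ring_of_type_algebra"
      by (rule R.subringI)
        (auto simp: ring_of_type_algebra_simps ring_of_type_algebra_uminus
            intro: F.one F.add F.mult F.uminus)
    show "\<And>k. k \<in> F - {\<zero>\<^bsub>ring_of_type_algebra\<^esub>} \<Longrightarrow> inv\<^bsub>ring_of_type_algebra\<^esub> k \<in> F"
      by (auto simp: ring_of_type_algebra_simps ring_of_type_algebra_inverse F.inverse)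
  qed
qed

lemma sub_field_Rats: "sub_field (\<rat> :: 'a::field_char_0 set)"
  by unfold_locales auto

lemma Rats_subset_sub_field:
  fixes F :: "'a::field_char_0 set"
  assumes "sub_field F"
  shows "\<rat> \<subseteq> F"
proof
  interpret F: sub_field F by fact
  fix x :: 'a assume "x \<in> \<rat>"
  then obtain a b :: int where "x = of_int a / of_int b" by (auto elim: Rats_cases')
  then show "x \<in> F" by (auto intro: F.divide F.of_int)
qed

definition poly_over :: "'a::field set \<Rightarrow> 'a poly set" where
  "poly_over F = {p. \<forall>i. poly.coeff p i \<in> F}"

lemma poly_over_mono: "F \<subseteq> G \<Longrightarrow> poly_over F \<subseteq> poly_over G"
  by (auto simp: poly_over_def)

context sub_field begin

lemma poly_over_const [intro]: "c \<in> F \<Longrightarrow> [:c:] \<in> poly_over F"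
  by (auto simp: poly_over_def coeff_pCons zero split: nat.splits)

lemma poly_over_pCons [intro]: "c \<in> F \<Longrightarrow> p \<in> poly_over F \<Longrightarrow> pCons c p \<in> poly_over F"
  by (auto simp: poly_over_def coeff_pCons split: nat.splits)

lemma poly_over_0 [intro, simp]: "0 \<in> poly_over F"
  by (auto simp: poly_over_def zero)

lemma poly_over_monom [intro]: "c \<in> F \<Longrightarrow> Polynomial.monom c n \<in> poly_over F"
  by (auto simp: poly_over_def zero)

lemma poly_over_add [intro]: "p \<in> poly_over F \<Longrightarrow> q \<in> poly_over F \<Longrightarrow> p + q \<in> poly_over F"
  by (auto simp: poly_over_def add)

lemma poly_over_diff [intro]: "p \<in> poly_over F \<Longrightarrow> q \<in> poly_over F \<Longrightarrow> p - q \<in> poly_over F"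
  by (auto simp: poly_over_def diff)

lemma poly_over_uminus [intro]: "p \<in> poly_over F \<Longrightarrow> - p \<in> poly_over F"
  by (auto simp: poly_over_def uminus)

lemma poly_over_mult [intro]: "p \<in> poly_over F \<Longrightarrow> q \<in> poly_over F \<Longrightarrow> p * q \<in> poly_over F"
  by (auto simp: poly_over_def coeff_mult intro!: sum mult)

lemma poly_over_smult [intro]: "c \<in> F \<Longrightarrow> p \<in> poly_over F \<Longrightarrow> Polynomial.smult c p \<in> poly_over F"
  by (auto simp: poly_over_def mult)

lemma poly_closed: "p \<in> poly_over F \<Longrightarrow> x \<in> F \<Longrightarrow> poly p x \<in> F"
  by (auto simp: poly_altdef poly_over_def intro!: sum mult power)

end

definition adjoin :: "'a::field set \<Rightarrow> 'a \<Rightarrow> 'a set" where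
  "adjoin F y = {poly p y / poly q y | p q. p \<in> poly_over F \<and> q \<in> poly_over F \<and> poly q y \<noteq> 0}"

context sub_field begin

lemma adjoin_sub_field: "sub_field (adjoin F y)"
proof
  have *: "x \<in> adjoin F y" if "x * poly q y = poly p y" "p \<in> poly_over F" "q \<in> poly_over F"
    "poly q y \<noteq> 0" for p q x
    proof -
    have "x = poly p y / poly q y" using that by (simp add: field_simps)
    then show ?thesis using that unfolding adjoin_def by blast
  qed
  show "0 \<in> adjoin F y" by (rule *[of _ 1 0]) (auto simp: poly_over_def zero one)
  show "1 \<in> adjoin F y" by (rule *[of _ 1 1]) (auto simp: poly_over_def zero one)
  fix x assume "x \<in> adjoin F y"
  then obtain a b where ab: "a \<in> poly_over F" "b \<in> poly_over F" "poly b y \<noteq> 0"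
    "x = poly a y / poly b y" unfolding adjoin_def by auto
  show "- x \<in> adjoin F y" by (rule *[of _ b "- a"]) (use ab in auto)
  show "inverse x \<in> adjoin F y"
  proof (cases "poly a y = 0")
    case True
    then show ?thesis using ab \<open>0 \<in> adjoin F y\<close> by simp
  next
    case False
    then show ?thesis by (intro *[of _ a b]) (use ab in auto)
  qed
  fix z assume "z \<in> adjoin F y"
  then obtain c d where cd: "c \<in> poly_over F" "d \<in> poly_over F" "poly d y \<noteq> 0"
    "z = poly c y / poly d y" unfolding adjoin_def by auto
  have xz: "x * poly b y = poly a y" "z * poly d y = poly c y" using ab cd by simp_all
  have "(x + z) * poly (b * d) y = poly (a * d + b * c) y"
    by (simp add: xz[symmetric] algebra_simps)
  then show "x + z \<in> adjoin F y" by (rule *) (use ab cd in auto)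
  have "(x * z) * poly (b * d) y = poly (a * c) y" by (simp add: xz[symmetric] algebra_simps)
  then show "x * z \<in> adjoin F y" by (rule *) (use ab cd in auto)
qed

lemma poly_in_adjoin: "p \<in> poly_over F \<Longrightarrow> poly p y \<in> adjoin F y"
  unfolding adjoin_def by (intro CollectI exI[of _ p] exI[of _ 1]) (auto simp: poly_over_def zero one)

lemma adjoin_incl: "F \<subseteq> adjoin F y"
proof
  fix c assume "c \<in> F"
  then show "c \<in> adjoin F y" using poly_in_adjoin[OF poly_over_const, of c y] by simp
qed

lemma adjoin_gen: "y \<in> adjoin F y"
  using poly_in_adjoin[of "[:0, 1:]" y] by (auto intro: zero one)

end

lemma adjoin_min:
  assumes "sub_field L" "F \<subseteq> L" "y \<in> L"
  shows "adjoin F y \<subseteq> L"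
  using assms sub_field.poly_closed[OF assms(1)] sub_field.divide[OF assms(1)] poly_over_mono[OF assms(2)]
  unfolding adjoin_def by blast

definition square_in :: "'a::field set \<Rightarrow> 'a \<Rightarrow> bool" where
  "square_in F a \<longleftrightarrow> (\<exists>r\<in>F. r ^ 2 = a)"

text \<open>
  The group of square classes of \<open>F\<close> is infinite: no finite set \<open>A\<close> represents all classes, since
  \<open>a b\<close> is a square exactly if \<open>a\<close> and \<open>b\<close> have the same class.
\<close>

definition infinite_square_classes :: "'a::field set \<Rightarrow> bool" where
  "infinite_square_classes F \<longleftrightarrow>
     (\<forall>A. finite A \<longrightarrow> A \<subseteq> F - {0} \<longrightarrow> (\<exists>b\<in>F - {0}. \<forall>a\<in>A. \<not> square_in F (a * b)))"

text \<open>
  The kernel of the map from the square classes of \<open>F\<close> to those of \<open>L\<close> is infinite.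
\<close>

definition infinite_square_kernel :: "'a::field set \<Rightarrow> 'a set \<Rightarrow> bool" where
  "infinite_square_kernel F L \<longleftrightarrow>
     (\<forall>A. finite A \<longrightarrow> A \<subseteq> F - {0} \<longrightarrow>
        (\<exists>b\<in>F - {0}. square_in L b \<and> (\<forall>a\<in>A. \<not> square_in F (a * b))))"

lemma (in sub_field) square_in_cancel:
  assumes "square_in F (a * b)" "square_in F (a * c)" "a \<noteq> 0" "a \<in> F"
  shows "square_in F (b * c)"
proof -
  obtain r t where rt: "r \<in> F" "t \<in> F" "r\<^sup>2 = a * b" "t\<^sup>2 = a * c"
    using assms by (auto simp: square_in_def)
  have "(r * t / a)\<^sup>2 = b * c"
    using rt assms(3) by (simp add: power_mult_distrib power_divide) (simp add: field_simps power2_eq_square)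
  then show ?thesis
    using rt assms(4) unfolding square_in_def by (metis divide mult)
qed

lemma square_in_mono: "F \<subseteq> L \<Longrightarrow> square_in F a \<Longrightarrow> square_in L a"
  by (auto simp: square_in_def)

lemma infinite_square_kernel_mono:
  assumes "infinite_square_kernel F L" "L \<subseteq> L'"
  shows "infinite_square_kernel F L'"
  using assms square_in_mono[OF assms(2)] unfolding infinite_square_kernel_def by metis

text \<open>
  An infinite group cannot have both a finite kernel and a finite image: representatives \<open>B\<close> in \<open>F\<close>
  of the classes of \<open>L\<close> that come from \<open>F\<close>, multiplied with representatives \<open>C\<close> of the kernel, would
  represent all classes of \<open>F\<close>.
\<close>

lemma infinite_square_classes_extend:
  assumes "sub_field F" "sub_field L" "F \<subseteq> L"
    and P: "infinite_square_classes F" and N: "\<not> infinite_square_kernel F L"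
  shows "infinite_square_classes L"
  unfolding infinite_square_classes_def
proof (intro allI impI)
  interpret F: sub_field F by fact
  interpret L: sub_field L by fact
  fix A assume A: "finite A" "A \<subseteq> L - {0}"
  define ok where "ok a f \<longleftrightarrow> f \<in> F - {0} \<and> square_in L (a * f)" for a f
  define B where "B = (\<lambda>a. SOME f. ok a f) ` {a \<in> A. \<exists>f. ok a f}"
  have okB: "\<exists>f\<in>B. ok a f" if "a \<in> A" "\<exists>f. ok a f" for a
    using that unfolding B_def by (auto intro!: bexI[of _ a] someI_ex[of "ok a"])
  have "f \<in> F - {0}" if "f \<in> B" for f
  proof -
    obtain a where "f = (SOME f. ok a f)" "\<exists>f. ok a f"
      using \<open>f \<in> B\<close> unfolding B_def by blast
    then have "ok a f" using someI_ex[of "ok a"] by simp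
    then show ?thesis by (simp add: ok_def)
  qed
  moreover have "finite B" using A unfolding B_def by auto
  ultimately have B: "finite B" "B \<subseteq> F - {0}" by auto
  obtain C where C: "finite C" "C \<subseteq> F - {0}"
    "\<And>b. b \<in> F - {0} \<Longrightarrow> square_in L b \<Longrightarrow> \<exists>c\<in>C. square_in F (c * b)"
  proof -
    from N obtain C where C: "finite C" "C \<subseteq> F - {0}"
      and "\<not> (\<exists>b\<in>F - {0}. square_in L b \<and> (\<forall>a\<in>C. \<not> square_in F (a * b)))"
      unfolding infinite_square_kernel_def by auto
    then have "\<exists>c\<in>C. square_in F (c * b)" if "b \<in> F - {0}" "square_in L b" for b
      using that by blast
    then show ?thesis using that C by blast
  qed
  define D where "D = (\<lambda>(f, c). f * c) ` (B \<times> C)"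
  have "finite D" "D \<subseteq> F - {0}" using B C unfolding D_def by (auto intro!: F.mult)
  then obtain b where b: "b \<in> F - {0}" "\<And>d. d \<in> D \<Longrightarrow> \<not> square_in F (d * b)"
    using P[unfolded infinite_square_classes_def, rule_format, of D] by blast
  have "\<not> square_in L (a * b)" if a: "a \<in> A" for a
  proof
    assume sq: "square_in L (a * b)"
    then have "ok a b" using b by (auto simp: ok_def)
    then obtain f where f: "f \<in> B" "ok a f" using okB a by blast
    have "square_in L (f * b)"
      using L.square_in_cancel[of a f b] sq f a A by (auto simp: ok_def)
    moreover have "f * b \<in> F - {0}" using f b by (auto simp: ok_def intro: F.mult)
    ultimately obtain c where "c \<in> C" "square_in F (c * (f * b))" using C by blast
    moreover have "c * (f * b) = (f * c) * b" by simp
    ultimately show False using b(2)[of "f * c"] f unfolding D_def by (metis (lifting) SigmaI case_prod_conv imageI)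
  qed
  then show "\<exists>b\<in>L - {0}. \<forall>a\<in>A. \<not> square_in L (a * b)"
    using b assms(3) by blast
qed

definition quadratic_extension :: "'a::field set \<Rightarrow> 'a \<Rightarrow> 'a set" where
  "quadratic_extension F r = {u + v * r | u v. u \<in> F \<and> v \<in> F}"

lemma (in sub_field) quadratic_extension_sub_field:
  assumes r: "r\<^sup>2 \<in> F" "r \<notin> F"
  shows "sub_field (quadratic_extension F r)"
proof
  have I: "x \<in> quadratic_extension F r" if "x = u + v * r" "u \<in> F" "v \<in> F" for x u v
    using that unfolding quadratic_extension_def by auto
  show "0 \<in> quadratic_extension F r" by (rule I[of _ 0 0]) (auto simp: zero)
  show "1 \<in> quadratic_extension F r" by (rule I[of _ 1 0]) (auto simp: zero one)
  fix x assume "x \<in> quadratic_extension F r"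
  then obtain u v where uv: "x = u + v * r" "u \<in> F" "v \<in> F" unfolding quadratic_extension_def by auto
  show "- x \<in> quadratic_extension F r" by (rule I[of _ "- u" "- v"]) (use uv in \<open>auto intro: uminus\<close>)
  show "inverse x \<in> quadratic_extension F r"
  proof (cases "x = 0")
    case True
    then show ?thesis using \<open>0 \<in> quadratic_extension F r\<close> by simp
  next
    case False
    have "u - v * r \<noteq> 0"
    proof
      assume *: "u - v * r = 0"
      then have "v = 0" using r(2) divide[of u v] uv by (metis eq_iff_diff_eq_0 nonzero_mult_div_cancel_left)
      then show False using * uv False by simp
    qed
    then have n: "u\<^sup>2 - v\<^sup>2 * r\<^sup>2 \<noteq> 0"
      using False uv by (metis (no_types) mult_eq_0_iff power_mult_distrib square_diff_square_factored power2_eq_square)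
    show ?thesis
    proof (rule I[of _ "u / (u\<^sup>2 - v\<^sup>2 * r\<^sup>2)" "- v / (u\<^sup>2 - v\<^sup>2 * r\<^sup>2)"])
      have "x * (u / (u\<^sup>2 - v\<^sup>2 * r\<^sup>2) + - v / (u\<^sup>2 - v\<^sup>2 * r\<^sup>2) * r) = x * (u - v * r) / (u\<^sup>2 - v\<^sup>2 * r\<^sup>2)"
        by (simp add: field_simps diff_divide_distrib)
      also have "\<dots> = 1" using n uv by (simp add: field_simps power2_eq_square)
      finally show "inverse x = u / (u\<^sup>2 - v\<^sup>2 * r\<^sup>2) + - v / (u\<^sup>2 - v\<^sup>2 * r\<^sup>2) * r"
        by (rule inverse_unique)
    qed (use uv r in \<open>auto intro!: divide diff mult uminus power\<close>)
  qed
  fix z assume "z \<in> quadratic_extension F r"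
  then obtain c d where cd: "z = c + d * r" "c \<in> F" "d \<in> F" unfolding quadratic_extension_def by auto
  show "x + z \<in> quadratic_extension F r" by (rule I[of _ "u + c" "v + d"]) (use uv cd in \<open>auto intro: add simp: algebra_simps\<close>)
  show "x * z \<in> quadratic_extension F r"
  proof (rule I)
    show "x * z = (u * c + v * d * r\<^sup>2) + (u * d + v * c) * r"
      using uv cd by (simp add: algebra_simps power2_eq_square)
  qed (use uv cd r in \<open>auto intro!: add mult simp del: power2_eq_square\<close>)
qed

text \<open>
  Adjoining a square root \<open>r\<close> kills only the class of \<open>r\<^sup>2\<close>: if \<open>(u + v r)\<^sup>2\<close> lies in \<open>F\<close>, then
  \<open>u v = 0\<close>.
\<close>

lemma (in sub_field) square_in_quadratic_extension:
  fixes r :: 'a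
  assumes r: "r\<^sup>2 \<in> F" "r \<notin> F" and two: "(2::'a) \<noteq> 0"
    and c: "c \<in> F" "square_in (quadratic_extension F r) c"
  shows "square_in F c \<or> square_in F (r\<^sup>2 * c)"
proof -
  obtain u v where uv: "u \<in> F" "v \<in> F" "(u + v * r)\<^sup>2 = c"
    using c unfolding square_in_def quadratic_extension_def by auto
  have *: "2 * u * v * r = c - u\<^sup>2 - v\<^sup>2 * r\<^sup>2"
    unfolding uv(3)[symmetric] by (simp add: power2_eq_square algebra_simps)
  have "u = 0 \<or> v = 0"
  proof (rule ccontr)
    assume "\<not> ?thesis"
    then have "r = (c - u\<^sup>2 - v\<^sup>2 * r\<^sup>2) / (2 * u * v)" using * two by (simp add: field_simps)
    moreover have "(c - u\<^sup>2 - v\<^sup>2 * r\<^sup>2) / (2 * u * v) \<in> F"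
      using uv c r by (auto intro!: divide diff mult power numeral)
    ultimately show False using r by simp
  qed
  then show ?thesis
  proof
    assume "u = 0"
    then have "r\<^sup>2 * c = (v * r\<^sup>2)\<^sup>2" using uv by (auto simp: power2_eq_square)
    then show ?thesis using uv r unfolding square_in_def by (metis mult)
  next
    assume "v = 0"
    then show ?thesis using uv unfolding square_in_def by auto
  qed
qed

text \<open>
  An infinite kernel survives a quadratic extension inside \<open>L\<close>, because passing from \<open>F\<close> to \<open>F(r)\<close>
  identifies at most two classes at a time.
\<close>

lemma (in sub_field) infinite_square_kernel_step:
  fixes L :: "'a set"
  assumes "(2::'a) \<noteq> 0" "sub_field L" "F \<subseteq> L" "infinite_square_kernel F L"
  obtains r where "r \<in> L" "r\<^sup>2 \<in> F" "r \<notin> F" "infinite_square_kernel (quadratic_extension F r) L"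
proof -
  obtain b where b: "b \<in> F - {0}" "square_in L b" "\<not> square_in F b"
    using assms(4)[unfolded infinite_square_kernel_def, rule_format, of "{1}"] one by auto
  then obtain r where r: "r \<in> L" "r\<^sup>2 = b" by (auto simp: square_in_def)
  have rF: "r \<notin> F" using b r by (auto simp: square_in_def)
  let ?E = "quadratic_extension F r"
  interpret E: sub_field ?E
    using quadratic_extension_sub_field[of r] r rF b by auto
  have FE: "F \<subseteq> ?E" unfolding quadratic_extension_def using zero by force
  have "infinite_square_kernel ?E L"
    unfolding infinite_square_kernel_def
  proof (intro allI impI)
    fix A assume A: "finite A" "A \<subseteq> ?E - {0}"
    define ok where "ok a f \<longleftrightarrow> f \<in> F - {0} \<and> square_in ?E (a * f)" for a f
    define B where "B = (\<lambda>a. SOME f. ok a f) ` {a \<in> A. \<exists>f. ok a f}"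
    have okB: "\<exists>f\<in>B. ok a f" if "a \<in> A" "\<exists>f. ok a f" for a
      using that unfolding B_def by (auto intro!: bexI[of _ a] someI_ex[of "ok a"])
    have "f \<in> F - {0}" if "f \<in> B" for f
    proof -
      obtain a where "f = (SOME f. ok a f)" "\<exists>f. ok a f" using \<open>f \<in> B\<close> unfolding B_def by blast
      then have "ok a f" using someI_ex[of "ok a"] by simp
      then show ?thesis by (simp add: ok_def)
    qed
    moreover have "finite B" using A unfolding B_def by auto
    ultimately have B: "finite B" "B \<subseteq> F - {0}" by auto
    have "finite (B \<union> (\<lambda>f. b * f) ` B)" "B \<union> (\<lambda>f. b * f) ` B \<subseteq> F - {0}"
      using B b by (auto intro: mult)
    then obtain c where c: "c \<in> F - {0}" "square_in L c"
      "\<And>a. a \<in> B \<union> (\<lambda>f. b * f) ` B \<Longrightarrow> \<not> square_in F (a * c)"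
      using assms(4)[unfolded infinite_square_kernel_def, rule_format,
          of "B \<union> (\<lambda>f. b * f) ` B"] by blast
    have "\<not> square_in ?E (a * c)" if a: "a \<in> A" for a
    proof
      assume sq: "square_in ?E (a * c)"
      then have "ok a c" using c by (auto simp: ok_def)
      then obtain f where f: "f \<in> B" "ok a f" using okB a by blast
      have "square_in ?E (f * c)"
        using E.square_in_cancel[of a f c] sq f a A by (auto simp: ok_def)
      then have "square_in F (f * c) \<or> square_in F (r\<^sup>2 * (f * c))"
        using square_in_quadratic_extension[of r "f * c"] r rF b c f assms(1) by (auto simp: ok_def intro: mult)
      then show False
        using c(3)[of f] c(3)[of "b * f"] f r by (auto simp: mult.assoc)
    qed
    then show "\<exists>b\<in>?E - {0}. square_in L b \<and> (\<forall>a\<in>A. \<not> square_in ?E (a * b))"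
      using c FE by blast
  qed
  then show ?thesis using that r rF b by auto
qed

text \<open>
  Division with remainder by \<open>p\<close>, carried out so that the remainder visibly has coefficients in \<open>F\<close>.
\<close>

lemma (in sub_field) reduce_degree:
  assumes p: "p \<in> poly_over F" "p \<noteq> 0" "poly p y = 0" and a: "a \<in> poly_over F"
  shows "\<exists>a'\<in>poly_over F. poly a' y = poly a y \<and> (a' = 0 \<or> Polynomial.degree a' < Polynomial.degree p)"
  using a
proof (induction "Polynomial.degree a" arbitrary: a rule: less_induct)
  case less
  show ?case
  proof (cases "a = 0 \<or> Polynomial.degree a < Polynomial.degree p")
    case True
    then show ?thesis using less by auto
  next
    case False
    define m where "m = Polynomial.monom (Polynomial.lead_coeff a / Polynomial.lead_coeff p) (Polynomial.degree a - Polynomial.degree p)"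
    define a' where "a' = a - m * p"
    have m: "m \<in> poly_over F"
      unfolding m_def using less p by (intro poly_over_monom divide) (auto simp: poly_over_def)
    have a': "a' \<in> poly_over F" "poly a' y = poly a y"
      unfolding a'_def using less m p by auto
    have "m \<noteq> 0" using p False by (simp add: m_def)
    have lm: "Polynomial.lead_coeff m = Polynomial.lead_coeff a / Polynomial.lead_coeff p"
      "Polynomial.degree m = Polynomial.degree a - Polynomial.degree p"
      using False p by (simp_all add: m_def degree_monom_eq)
    have dm: "Polynomial.degree (m * p) = Polynomial.degree a"
      using False p \<open>m \<noteq> 0\<close> lm by (simp add: degree_mult_eq)
    have "Polynomial.lead_coeff (m * p) = Polynomial.lead_coeff a"
      using lm(1) p(2) by (simp add: lead_coeff_mult)
    then have cm: "poly.coeff (m * p) (Polynomial.degree a) = Polynomial.lead_coeff a"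
      unfolding dm .
    show ?thesis
    proof (cases "a' = 0")
      case True
      then show ?thesis using a' by (intro bexI[of _ a']) simp_all
    next
      case nz: False
      have "Polynomial.coeff a' (Polynomial.degree a) = 0" using cm by (simp add: a'_def)
      moreover have "Polynomial.degree a' \<le> Polynomial.degree a" using dm degree_diff_le[of a "Polynomial.degree a" "m * p"] by (simp add: a'_def)
      ultimately have "Polynomial.degree a' < Polynomial.degree a"
        using nz by (metis le_neq_implies_less leading_coeff_0_iff)
      then show ?thesis using less(1)[of a'] a' by auto
    qed
  qed
qed

text \<open>
  Descent on the degree of \<open>y\<close>.  If the kernel for \<open>F(y)\<close> were infinite, there would be a quadratic
  extension \<open>E\<close> of \<open>F\<close> inside \<open>F(y)\<close>, generated by some \<open>r = a(y) / b(y)\<close> with \<open>a, b\<close> of degree below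
  that of \<open>y\<close>.  Then \<open>a - r b\<close> is an equation for \<open>y\<close> over \<open>E\<close> of smaller degree, and the kernel
  for \<open>E(y)\<close> is again infinite.
\<close>

lemma finite_square_kernel_algebraic:
  fixes F :: "'a::field set"
  assumes "(2::'a) \<noteq> 0" "sub_field F" "p \<in> poly_over F" "p \<noteq> 0" "poly p y = 0"
  shows "\<not> infinite_square_kernel F (adjoin F y)"
  using assms(2-)
proof (induction "Polynomial.degree p" arbitrary: F p rule: less_induct)
  case less
  interpret F: sub_field F by fact
  show ?case
  proof
    assume "infinite_square_kernel F (adjoin F y)"
    then obtain r where r: "r \<in> adjoin F y" "r\<^sup>2 \<in> F" "r \<notin> F"
      "infinite_square_kernel (quadratic_extension F r) (adjoin F y)"
      using F.infinite_square_kernel_step[OF assms(1) F.adjoin_sub_field F.adjoin_incl] by blast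
    let ?E = "quadratic_extension F r"
    interpret E: sub_field ?E by (rule F.quadratic_extension_sub_field) (use r in auto)
    have FE: "F \<subseteq> ?E" unfolding quadratic_extension_def using F.zero by force
    have rE: "r \<in> ?E" unfolding quadratic_extension_def using F.zero F.one by force
    have "adjoin F y \<subseteq> adjoin ?E y"
      using adjoin_min[OF E.adjoin_sub_field, of F y y] FE E.adjoin_incl E.adjoin_gen by blast
    then have inf: "infinite_square_kernel ?E (adjoin ?E y)"
      using r(4) infinite_square_kernel_mono by blast
    obtain a0 b0 where ab0: "a0 \<in> poly_over F" "b0 \<in> poly_over F" "poly b0 y \<noteq> 0" "r = poly a0 y / poly b0 y"
      using r(1) unfolding adjoin_def by auto
    obtain a where a: "a \<in> poly_over F" "poly a y = poly a0 y" "a = 0 \<or> Polynomial.degree a < Polynomial.degree p"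
      using F.reduce_degree[OF less(3-5) ab0(1)] by auto
    obtain b where b: "b \<in> poly_over F" "poly b y = poly b0 y" "b = 0 \<or> Polynomial.degree b < Polynomial.degree p"
      using F.reduce_degree[OF less(3-5) ab0(2)] by auto
    define q where "q = a - Polynomial.smult r b"
    have qE: "q \<in> poly_over ?E"
      unfolding q_def using a b rE poly_over_mono[OF FE] by blast
    have q0: "poly q y = 0" using ab0 a b by (simp add: q_def)
    have bnz: "b \<noteq> 0" using b ab0 by auto
    have "q \<noteq> 0"
    proof
      assume "q = 0"
      then have "Polynomial.lead_coeff b * r = Polynomial.coeff a (Polynomial.degree b)" by (simp add: q_def)
      then have "r = Polynomial.coeff a (Polynomial.degree b) / Polynomial.lead_coeff b" using bnz by (simp add: field_simps)
      then have "r \<in> F" using a b by (auto simp: poly_over_def intro: F.divide)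
      then show False using r by simp
    qed
    moreover have "Polynomial.degree q < Polynomial.degree p"
    proof -
      have "Polynomial.degree b < Polynomial.degree p" using b bnz by auto
      moreover have "Polynomial.degree a < Polynomial.degree p" using a calculation by auto
      moreover have "Polynomial.degree (Polynomial.smult r b) < Polynomial.degree p" using calculation degree_smult_le[of r b] by simp
      ultimately show ?thesis unfolding q_def using degree_diff_less by blast
    qed
    ultimately show False
      using less(1)[of q ?E] qE q0 E.sub_field_axioms inf by blast
  qed
qed

definition transcendental_over :: "'a::field set \<Rightarrow> 'a \<Rightarrow> bool" where
  "transcendental_over F y \<longleftrightarrow> (\<forall>p\<in>poly_over F. poly p y = 0 \<longrightarrow> p = 0)"

text \<open>
  A constant \<open>b\<close> that is a square of a rational function is the square of the ratio of the leading
  coefficients.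
\<close>

lemma finite_square_kernel_transcendental:
  assumes "sub_field F" "transcendental_over F y"
  shows "\<not> infinite_square_kernel F (adjoin F y)"
proof
  interpret F: sub_field F by fact
  assume "infinite_square_kernel F (adjoin F y)"
  from this[unfolded infinite_square_kernel_def, rule_format, of "{1}"]
  obtain b where b: "b \<in> F - {0}" "square_in (adjoin F y) b" "\<not> square_in F b"
    using F.one by auto
  then obtain p q where pq: "p \<in> poly_over F" "q \<in> poly_over F" "poly q y \<noteq> 0" "(poly p y / poly q y)\<^sup>2 = b"
    unfolding adjoin_def square_in_def by auto
  have "poly (p\<^sup>2 - Polynomial.smult b (q\<^sup>2)) y = 0" using pq by (simp add: field_simps)
  moreover have "p\<^sup>2 - Polynomial.smult b (q\<^sup>2) \<in> poly_over F" using pq b by (auto simp: power2_eq_square)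
  ultimately have "p\<^sup>2 = Polynomial.smult b (q\<^sup>2)" using assms(2) unfolding transcendental_over_def by fastforce
  then have "Polynomial.lead_coeff (p\<^sup>2) = Polynomial.lead_coeff (Polynomial.smult b (q\<^sup>2))" by simp
  then have "(Polynomial.lead_coeff p)\<^sup>2 = b * (Polynomial.lead_coeff q)\<^sup>2" by (simp add: lead_coeff_power lead_coeff_smult)
  moreover have "q \<noteq> 0" using pq by auto
  ultimately have "(Polynomial.lead_coeff p / Polynomial.lead_coeff q)\<^sup>2 = b" by (simp add: power_divide field_simps)
  moreover have "Polynomial.lead_coeff p / Polynomial.lead_coeff q \<in> F" using pq by (auto simp: poly_over_def intro: F.divide)
  ultimately show False using b unfolding square_in_def by blast
qed

theorem infinite_square_classes_adjoin:
  fixes F :: "'a::field set"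
  assumes "(2::'a) \<noteq> 0" "sub_field F" "infinite_square_classes F"
  shows "infinite_square_classes (adjoin F y)"
proof (rule infinite_square_classes_extend[OF assms(2) _ _ assms(3)])
  interpret F: sub_field F by fact
  show "sub_field (adjoin F y)" by (rule F.adjoin_sub_field)
  show "F \<subseteq> adjoin F y" by (rule F.adjoin_incl)
  show "\<not> infinite_square_kernel F (adjoin F y)"
  proof (cases "transcendental_over F y")
    case True
    then show ?thesis by (rule finite_square_kernel_transcendental[OF assms(2)])
  next
    case False
    then obtain p where "p \<in> poly_over F" "poly p y = 0" "p \<noteq> 0"
      by (auto simp: transcendental_over_def)
    then show ?thesis using finite_square_kernel_algebraic[OF assms(1,2)] by blast
  qed
qed

text \<open>
  \<open>G\<close> is the field generated by \<open>F\<close> and \<open>S\<close>; it is described by its universal property because the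
  applications meet this field in different guises.
\<close>

lemma infinite_square_classes_finitely_generated:
  fixes F :: "'a::field set"
  assumes "(2::'a) \<noteq> 0" "sub_field F" "infinite_square_classes F" "finite S"
  shows "\<exists>G. sub_field G \<and> infinite_square_classes G \<and> F \<union> S \<subseteq> G \<and>
    (\<forall>H. sub_field H \<longrightarrow> F \<union> S \<subseteq> H \<longrightarrow> G \<subseteq> H)"
  using assms(4)
proof (induction S)
  case empty
  then show ?case using assms by auto
next
  case (insert y S)
  then obtain G where G: "sub_field G" "infinite_square_classes G" "F \<union> S \<subseteq> G"
    "\<And>H. sub_field H \<Longrightarrow> F \<union> S \<subseteq> H \<Longrightarrow> G \<subseteq> H" by blast
  interpret G: sub_field G by fact
  show ?case
  proof (intro exI[of _ "adjoin G y"] conjI allI impI)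
    show "F \<union> insert y S \<subseteq> adjoin G y" using G G.adjoin_incl G.adjoin_gen by blast
    fix H assume "sub_field H" "F \<union> insert y S \<subseteq> H"
    then show "adjoin G y \<subseteq> H" using G(4)[of H] by (intro adjoin_min) auto
  qed (use G.adjoin_sub_field infinite_square_classes_adjoin[OF assms(1) G(1,2)] in auto)
qed

lemma infinite_square_classes_nonsquare:
  assumes "sub_field F" "infinite_square_classes F"
  shows "\<exists>d\<in>F. \<not> square_in F d"
  using assms(2)[unfolded infinite_square_classes_def, rule_format, of "{1}"] sub_field.one[OF assms(1)]
  by auto

section \<open>Non-squares in arithmetic fields\<close>

text \<open>
  The prime \<open>q\<close> occurs to an odd power on the left and to an even power on the right.
\<close>

lemma no_square_prime_mult:
  fixes u v m n :: int
  assumes "Factorial_Ring.prime q" "m * q * v\<^sup>2 = n * u\<^sup>2" "\<not> q dvd m" "\<not> q dvd n" "v \<noteq> 0"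
  shows False
proof -
  have q: "prime_elem q" "q \<noteq> 0" using assms(1) by auto
  have nz: "m \<noteq> 0" "n \<noteq> 0" using assms by auto
  then have "u \<noteq> 0" using assms q by auto
  then have "multiplicity q (n * u\<^sup>2) = 2 * multiplicity q u"
    using nz assms(1,3,4,5) q \<open>u \<noteq> 0\<close> by (simp add: prime_elem_multiplicity_mult_distrib prime_elem_multiplicity_power_distrib
        not_dvd_imp_multiplicity_0)
  moreover have "multiplicity q (m * q * v\<^sup>2) = 1 + 2 * multiplicity q v"
    using nz assms(1,3,4,5) q \<open>u \<noteq> 0\<close> by (simp add: prime_elem_multiplicity_mult_distrib prime_elem_multiplicity_power_distrib
        not_dvd_imp_multiplicity_0)
  ultimately have "2 * multiplicity q u = 1 + 2 * multiplicity q v" using assms(2) by simp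
  then show False by presburger
qed

text \<open>
  A prime dividing no numerator or denominator of the elements of \<open>A\<close> lies in a new square class.
\<close>

lemma infinite_square_classes_Rats: "infinite_square_classes (\<rat> :: 'a::field_char_0 set)"
  unfolding infinite_square_classes_def
proof (intro allI impI)
  fix A :: "'a set" assume A: "finite A" "A \<subseteq> \<rat> - {0}"
  have "\<forall>a\<in>A. \<exists>m n. a = of_int m / of_int n \<and> m \<noteq> 0 \<and> n \<noteq> 0"
  proof
    fix a assume "a \<in> A"
    then have "a \<in> \<rat>" "a \<noteq> 0" using A by auto
    then obtain m n :: int where "a = of_int m / of_int n" "n > 0" by (auto elim: Rats_cases')
    then show "\<exists>m n. a = of_int m / of_int n \<and> m \<noteq> 0 \<and> n \<noteq> 0"
      using \<open>a \<noteq> 0\<close> by (intro exI[of _ m] exI[of _ n]) auto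
  qed
  then obtain m n where mn: "\<And>a. a \<in> A \<Longrightarrow> a = of_int (m a) / of_int (n a) \<and> m a \<noteq> 0 \<and> n a \<noteq> (0::int)"
    by metis
  define B where "B = (\<Sum>a\<in>A. nat \<bar>m a\<bar> + nat \<bar>n a\<bar>)"
  obtain q0 where q0: "Factorial_Ring.prime q0" "q0 > B" using bigger_prime by blast
  define q where "q = int q0"
  have q: "Factorial_Ring.prime q" "q > int B" using q0 by (auto simp: q_def)
  have nd: "\<not> q dvd m a" "\<not> q dvd n a" if "a \<in> A" for a
  proof -
    have "nat \<bar>m a\<bar> + nat \<bar>n a\<bar> \<le> B"
      unfolding B_def using A(1) that by (intro member_le_sum) auto
    then have "\<bar>m a\<bar> < q" "\<bar>n a\<bar> < q" using q by auto
    then show "\<not> q dvd m a" "\<not> q dvd n a" using mn[OF that] zdvd_not_zless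
      by (metis abs_ge_zero dvd_abs_iff less_le zero_less_abs_iff)+
  qed
  have "\<not> square_in \<rat> (a * of_int q)" if a: "a \<in> A" for a
  proof
    assume "square_in \<rat> (a * of_int q)"
    then obtain r where r: "r \<in> \<rat>" "r\<^sup>2 = a * of_int q" by (auto simp: square_in_def)
    then obtain u v :: int where uv: "r = of_int u / of_int v" "v > 0" by (auto elim: Rats_cases')
    have "a * of_int (n a) = of_int (m a)" using mn[OF a]
      by (metis nonzero_eq_divide_eq of_int_eq_0_iff)
    moreover have "of_int u ^ 2 = a * of_int q * of_int v ^ 2"
      using r(2) uv by (simp add: power_divide field_simps)
    ultimately have "(of_int (m a) * of_int q * of_int v ^ 2 :: 'a) = of_int (n a) * of_int u ^ 2"
      by (simp add: algebra_simps)
    then have "m a * q * v\<^sup>2 = n a * u\<^sup>2"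
      by (metis (no_types, lifting) of_int_eq_iff of_int_mult of_int_power)
    then show False using no_square_prime_mult[of q "m a" v "n a" u] q nd[OF a] uv by auto
  qed
  moreover have "(of_int q :: 'a) \<in> \<rat> - {0}" using q by auto
  ultimately show "\<exists>b\<in>\<rat> - {0}. \<forall>a\<in>A. \<not> square_in \<rat> (a * b)" by blast
qed

lemma generate_field_sub_field:
  fixes S :: "'a::field set"
  shows "sub_field (generate_field ring_of_type_algebra S)" "S \<subseteq> generate_field ring_of_type_algebra S"
    "\<And>H. sub_field H \<Longrightarrow> S \<subseteq> H \<Longrightarrow> generate_field ring_of_type_algebra S \<subseteq> H"
proof -
  interpret R: field "ring_of_type_algebra :: 'a ring" by (rule field_from_type_algebra)
  show "sub_field (generate_field ring_of_type_algebra S)"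
    by (intro sub_field_of_subfield R.generate_field_is_subfield) (simp add: ring_of_type_algebra_simps)
  show "S \<subseteq> generate_field ring_of_type_algebra S" by (auto intro: generate_field.incl)
  fix H assume "sub_field H" "S \<subseteq> H"
  then show "generate_field ring_of_type_algebra S \<subseteq> H"
    by (intro R.generate_field_min_subfield1 subfield_of_sub_field) (simp_all add: ring_of_type_algebra_simps)
qed

lemma finitely_generated_field_nonsquare:
  fixes k :: "'a::field_char_0 set"
  assumes "finitely_generated_field k"
  shows "\<exists>d\<in>k. \<not> square_in k d"
proof -
  obtain S where S: "finite S" "k = generate_field ring_of_type_algebra S"
    using assms unfolding finitely_generated_field_def by auto
  have k: "sub_field k" "S \<subseteq> k" "\<rat> \<subseteq> k"
    using generate_field_sub_field(1,2)[of S] Rats_subset_sub_field[of k] S by auto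
  obtain G where G: "sub_field G" "infinite_square_classes G" "\<rat> \<union> S \<subseteq> G"
    "\<And>H. sub_field H \<Longrightarrow> \<rat> \<union> S \<subseteq> H \<Longrightarrow> G \<subseteq> H"
    using infinite_square_classes_finitely_generated[OF _ sub_field_Rats infinite_square_classes_Rats S(1)]
    by auto
  have "G = k" using G(4)[OF k(1)] k generate_field_sub_field(3)[OF G(1), of S] G(3) S by auto
  then show ?thesis using infinite_square_classes_nonsquare G by blast
qed

text \<open>
  A basis generates the extension as a field.  The conclusion \<open>0 \<in> E\<close> keeps the induction over the
  construction of \<open>E\<close> going: it puts each new basis vector into the extended space.
\<close>

lemma finite_dimension_generators:
  fixes E :: "'a::field set"
  assumes "ring.dimension ring_of_type_algebra n F E" "sub_field F"
  shows "\<exists>S. finite S \<and> S \<subseteq> E \<and> 0 \<in> E \<and> (\<forall>H. sub_field H \<longrightarrow> F \<union> S \<subseteq> H \<longrightarrow> E \<subseteq> H)"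
proof -
  interpret R: field "ring_of_type_algebra :: 'a ring" by (rule field_from_type_algebra)
  show ?thesis using assms
  proof (induction rule: R.dimension.induct)
    case (zero_dim K)
    show ?case by (rule exI[of _ "{}"]) (auto simp: ring_of_type_algebra_simps sub_field.zero)
  next
    case (Suc_dim v E n K)
    then obtain S where S: "finite S" "S \<subseteq> E" "0 \<in> E"
      "\<And>H. sub_field H \<Longrightarrow> K \<union> S \<subseteq> H \<Longrightarrow> E \<subseteq> H" by blast
    interpret K: sub_field K by fact
    have le: "u \<in> R.line_extension K v E \<longleftrightarrow> (\<exists>c\<in>K. \<exists>e\<in>E. u = c * v + e)" for u
      unfolding R.line_extension_mem_iff by (simp add: ring_of_type_algebra_simps)
    show ?case
    proof (intro exI[of _ "insert v S"] conjI allI impI)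
      show "finite (insert v S)" using S by simp
      show "0 \<in> R.line_extension K v E" unfolding le using S K.zero by (auto intro!: bexI[of _ 0])
      have "v \<in> R.line_extension K v E"
        unfolding le using S K.one by (intro bexI[of _ 1] bexI[of _ 0]) auto
      moreover have "E \<subseteq> R.line_extension K v E"
      proof
        fix x assume "x \<in> E"
        then show "x \<in> R.line_extension K v E"
          unfolding le using K.zero by (intro bexI[of _ 0] bexI[of _ x]) auto
      qed
      ultimately show "insert v S \<subseteq> R.line_extension K v E" using S by auto
      fix H assume H: "sub_field H" "K \<union> insert v S \<subseteq> H"
      then have "E \<subseteq> H" using S by auto
      show "R.line_extension K v E \<subseteq> H"
      proof
        fix x assume "x \<in> R.line_extension K v E"
        then obtain c e where "c \<in> K" "e \<in> E" "x = c * v + e" unfolding le by auto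
        then show "x \<in> H" using H(2) \<open>E \<subseteq> H\<close>
          by (auto intro!: sub_field.add[OF H(1)] sub_field.mult[OF H(1)])
      qed
    qed
  qed
qed

lemma number_field_finitely_generated:
  fixes k :: "'a::field_char_0 set"
  assumes "number_field k"
  shows "finitely_generated_field k"
proof -
  interpret R: field "ring_of_type_algebra :: 'a ring" by (rule field_from_type_algebra)
  have k: "sub_field k" using assms unfolding number_field_def by (auto intro: sub_field_of_subfield)
  obtain n where "ring.dimension ring_of_type_algebra n \<rat> k"
    using assms unfolding number_field_def R.finite_dimension_def by auto
  from finite_dimension_generators[OF this sub_field_Rats]
  obtain S where S: "finite S" "S \<subseteq> k" "\<And>H. sub_field H \<Longrightarrow> \<rat> \<union> S \<subseteq> H \<Longrightarrow> k \<subseteq> H"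
    by blast
  have "k = generate_field ring_of_type_algebra S"
  proof
    show "k \<subseteq> generate_field ring_of_type_algebra S"
      by (intro S(3) Un_least generate_field_sub_field Rats_subset_sub_field)
    show "generate_field ring_of_type_algebra S \<subseteq> k"
      by (rule generate_field_sub_field(3)[OF k S(2)])
  qed
  then show ?thesis using S(1) unfolding finitely_generated_field_def by auto
qed

lemma nonsquare_via_iso:
  assumes "field_of k \<simeq> R" "D \<in> carrier R" "\<And>c. c \<in> carrier R \<Longrightarrow> c \<otimes>\<^bsub>R\<^esub> c \<noteq> D"
  shows "\<exists>d\<in>k. \<not> square_in k d"
proof -
  obtain h where h: "h \<in> ring_iso (field_of k) R"
    using assms(1) unfolding is_ring_iso_def by auto
  then have "h ` k = carrier R" by (auto simp: ring_iso_def bij_betw_def)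
  then obtain d where d: "d \<in> k" "h d = D" using assms(2) by (metis imageE)
  have "\<not> square_in k d"
  proof
    assume "square_in k d"
    then obtain r where r: "r \<in> k" "r * r = d" by (auto simp: square_in_def power2_eq_square)
    then have "h r \<otimes>\<^bsub>R\<^esub> h r = D"
      using ring_iso_memE(2)[OF h, of r r] d by (simp add: ring_of_type_algebra_simps)
    moreover have "h r \<in> carrier R" using ring_iso_memE(1)[OF h, of r] r by simp
    ultimately show False using assms(3) by blast
  qed
  then show ?thesis using d by auto
qed

lemma real_nonsquare:
  assumes "field_of k \<simeq> (ring_of_type_algebra :: real ring)"
  shows "\<exists>d\<in>k. \<not> square_in k d"
proof (rule nonsquare_via_iso[OF assms, of "-1"])
  fix c :: real
  have "c * c \<noteq> -1" using zero_le_square[of c] by linarith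
  then show "c \<otimes>\<^bsub>ring_of_type_algebra\<^esub> c \<noteq> - 1" by (simp add: ring_of_type_algebra_simps)
qed (simp add: ring_of_type_algebra_simps)

lemma fun_ring_simps:
  "carrier (fun_ring S) = S" "f \<otimes>\<^bsub>fun_ring S\<^esub> g = (\<lambda>x. f x * g x)" "\<one>\<^bsub>fun_ring S\<^esub> = (\<lambda>_. 1)"
  "\<zero>\<^bsub>fun_ring S\<^esub> = (\<lambda>_. 0)" "f \<oplus>\<^bsub>fun_ring S\<^esub> g = (\<lambda>x. f x + g x)"
  by (simp_all add: fun_ring_def)

lemma fun_ring_coset: "I +>\<^bsub>fun_ring S\<^esub> f = {(\<lambda>x. i x + f x) | i. i \<in> I}"
  by (auto simp: a_r_coset_def' fun_ring_simps)

text \<open>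
  A square root of the class of \<open>D\<close> is the class of some \<open>g\<close>, and products of cosets contain the
  products of their representatives; so it suffices to compare \<open>g\<^sup>2\<close> with \<open>D\<close> modulo \<open>I\<close>.
\<close>

lemma nonsquare_via_quotient:
  fixes D :: "'x \<Rightarrow> 'b::comm_ring_1"
  assumes iso: "field_of k \<simeq> fun_ring S Quot I"
    and D: "D \<in> S" and I: "(\<lambda>_. 0) \<in> I"
    and N: "\<And>g. g \<in> S \<Longrightarrow> (\<lambda>x. g x * g x - D x) \<notin> I"
  shows "\<exists>d\<in>k. \<not> square_in k d"
proof (rule nonsquare_via_iso[OF iso])
  show "I +>\<^bsub>fun_ring S\<^esub> D \<in> carrier (fun_ring S Quot I)"
    using D by (auto simp: FactRing_def A_RCOSETS_def' a_r_coset_def' fun_ring_simps)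
  fix c assume "c \<in> carrier (fun_ring S Quot I)"
  then obtain g where g: "g \<in> S" "c = I +>\<^bsub>fun_ring S\<^esub> g"
    by (auto simp: FactRing_def A_RCOSETS_def' a_r_coset_def' fun_ring_simps)
  have "g \<in> c" unfolding g fun_ring_coset using I by (auto intro!: exI[of _ "\<lambda>_. 0"])
  then have "(\<lambda>x. g x * g x) \<in> c \<otimes>\<^bsub>fun_ring S Quot I\<^esub> c"
    using I by (auto simp: FactRing_def rcoset_mult_def fun_ring_coset fun_ring_simps
        intro!: bexI[of _ g] exI[of _ "\<lambda>_. 0"])
  moreover have "(\<lambda>x. g x * g x) \<notin> I +>\<^bsub>fun_ring S\<^esub> D"
  proof
    assume "(\<lambda>x. g x * g x) \<in> I +>\<^bsub>fun_ring S\<^esub> D"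
    then obtain i where "i \<in> I" "(\<lambda>x. g x * g x) = (\<lambda>x. i x + D x)"
      unfolding fun_ring_coset by auto
    moreover have "i = (\<lambda>x. g x * g x - D x)" using calculation(2) by (auto simp: fun_eq_iff)
    ultimately show False using N g by auto
  qed
  ultimately show "c \<otimes>\<^bsub>fun_ring S Quot I\<^esub> c \<noteq> I +>\<^bsub>fun_ring S\<^esub> D" by auto
qed

text \<open>
  \<open>p\<close> has odd valuation, so a rational square cannot approximate it to a precision better than \<open>1/p\<close>:
  with \<open>x = a/b\<close>, the valuations of \<open>a\<^sup>2\<close> and \<open>p b\<^sup>2\<close> differ in parity, so that of \<open>a\<^sup>2 - p b\<^sup>2\<close> is at
  most that of \<open>p b\<^sup>2\<close>.
\<close>

lemma padic_abs_square_minus_prime: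
  fixes x :: rat
  assumes "Factorial_Ring.prime p"
  shows "padic_abs p (x\<^sup>2 - of_nat p) \<ge> 1 / real p"
proof -
  define P where "P = int p"
  have P: "Factorial_Ring.prime P" "P > 1" using assms prime_gt_1_nat by (auto simp: P_def)
  obtain a b where ab: "quotient_of x = (a, b)" by (cases "quotient_of x")
  have b: "b > 0" "x = of_int a / of_int b"
    using ab quotient_of_denom_pos quotient_of_div by auto
  define c where "c = a\<^sup>2 - P * b\<^sup>2"
  define \<beta> where "\<beta> = multiplicity P b"
  have notdvd: "\<not> P ^ (2 * \<beta> + 2) dvd c"
  proof
    assume d: "P ^ (2 * \<beta> + 2) dvd c"
    have mb: "multiplicity P (P * b\<^sup>2) = 2 * \<beta> + 1"
      using P b by (simp add: prime_elem_multiplicity_mult_distrib prime_elem_multiplicity_power_distrib \<beta>_def)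
    have "P ^ (2 * \<beta> + 1) dvd P * b\<^sup>2" using mb multiplicity_dvd[of P "P * b\<^sup>2"] by simp
    moreover have "P ^ (2 * \<beta> + 1) dvd c" using d by (rule power_le_dvd) simp
    ultimately have *: "P ^ (2 * \<beta> + 1) dvd a\<^sup>2" 
      using dvd_add[of _ c "P * b\<^sup>2"] by (simp add: c_def)
    have "P ^ (2 * \<beta> + 2) dvd a\<^sup>2"
    proof (cases "a = 0")
      case False
      have "2 * \<beta> + 1 \<le> multiplicity P (a\<^sup>2)"
        using * False P by (intro multiplicity_geI) auto
      also have "\<dots> = 2 * multiplicity P a"
        using P False by (simp add: prime_elem_multiplicity_power_distrib)
      finally have "2 * \<beta> + 2 \<le> 2 * multiplicity P a" by presburger
      then have "2 * \<beta> + 2 \<le> multiplicity P (a\<^sup>2)"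
        using P False by (simp add: prime_elem_multiplicity_power_distrib)
      then show ?thesis by (rule multiplicity_dvd')
    qed simp
    then have "P ^ (2 * \<beta> + 2) dvd a\<^sup>2 - c" using d by (rule dvd_diff)
    also have "a\<^sup>2 - c = P * b\<^sup>2" by (simp add: c_def)
    finally have "P ^ (2 * \<beta> + 2) dvd P * b\<^sup>2" .
    then have "2 * \<beta> + 2 \<le> multiplicity P (P * b\<^sup>2)" using P b by (intro multiplicity_geI) auto
    then show False using mb by simp
  qed
  then have c0: "c \<noteq> 0" by auto
  have mc: "multiplicity P c \<le> 2 * \<beta> + 1"
    using notdvd multiplicity_dvd'[of "2 * \<beta> + 2" P c] by force
  define y where "y = x\<^sup>2 - of_nat p"
  obtain m n where mn: "quotient_of y = (m, n)" by (cases "quotient_of y")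
  have n: "n > 0" "y = of_int m / of_int n"
    using mn quotient_of_denom_pos quotient_of_div by auto
  have yc: "y * of_int (b\<^sup>2) = of_int c"
    using b(1) unfolding y_def c_def P_def b(2) by (simp add: power_divide field_simps)
  then have "of_int (m * b\<^sup>2) = (of_int (n * c) :: rat)"
    using n by (simp add: field_simps)
  then have eq: "m * b\<^sup>2 = n * c" by linarith
  have y0: "y \<noteq> 0" using yc c0 by auto
  then have m0: "m \<noteq> 0" using n by auto
  have "multiplicity P (m * b\<^sup>2) = multiplicity P m + 2 * \<beta>"
    using P b m0 by (simp add: prime_elem_multiplicity_mult_distrib prime_elem_multiplicity_power_distrib \<beta>_def)
  moreover have "multiplicity P (n * c) = multiplicity P n + multiplicity P c"
    using P n c0 by (simp add: prime_elem_multiplicity_mult_distrib)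
  ultimately have "multiplicity P m + 2 * \<beta> = multiplicity P n + multiplicity P c" using eq by simp
  then have "int (multiplicity P n) - int (multiplicity P m) \<ge> -1" using mc by linarith
  then have "real p powi (int (multiplicity P n) - int (multiplicity P m)) \<ge> real p powi (-1)"
    using P by (intro power_int_increasing) (auto simp: P_def)
  then show ?thesis
    using y0 mn unfolding padic_abs_def y_def[symmetric] P_def by (simp add: power_int_minus field_simps)
qed

lemma padic_nonsquare:
  assumes p: "Factorial_Ring.prime p" and iso: "field_of k \<simeq> padic_field p"
  shows "\<exists>d\<in>k. \<not> square_in k d"
proof (rule nonsquare_via_quotient[OF iso[unfolded padic_field_def], of "\<lambda>_. of_nat p"])
  show "(\<lambda>_. of_nat p) \<in> padic_cauchy p" by (auto simp: padic_cauchy_def padic_abs_def)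
  show "(\<lambda>_. 0) \<in> padic_null p" by (auto simp: padic_null_def padic_abs_def)
  fix g
  show "(\<lambda>x. g x * g x - of_nat p) \<notin> padic_null p"
  proof
    assume "(\<lambda>x. g x * g x - of_nat p) \<in> padic_null p"
    then have "(\<lambda>i. padic_abs p (g i * g i - of_nat p)) \<longlonglongrightarrow> 0" by (simp add: padic_null_def)
    moreover have "1 / real p > 0" using p by (simp add: prime_gt_0_nat)
    ultimately have "\<forall>\<^sub>F i in sequentially. padic_abs p (g i * g i - of_nat p) < 1 / real p"
      by (rule order_tendstoD(2))
    then obtain i where "padic_abs p (g i * g i - of_nat p) < 1 / real p"
      by (meson eventually_happens sequentially_bot)
    then show False using padic_abs_square_minus_prime[OF p, of "g i"] by (simp add: power2_eq_square)
  qed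
qed

text \<open>
  Positivity excludes \<open>-1\<close> and \<open>-2\<close>, and \<open>2\<close> is excluded by the preceding approximation bound for \<open>p = 2\<close>.
\<close>

lemma rat_square_ne:
  fixes x :: "'a::field_char_0"
  assumes "x \<in> \<rat>" shows "x\<^sup>2 \<noteq> 2" "x\<^sup>2 \<noteq> -1" "x\<^sup>2 \<noteq> -2"
proof -
  obtain q where q: "x = of_rat q" using assms by (auto elim: Rats_cases)
  have "q\<^sup>2 \<noteq> of_nat 2"
    using padic_abs_square_minus_prime[of 2 q] by (auto simp: padic_abs_def)
  moreover have "q\<^sup>2 \<ge> 0" by simp
  then have "q\<^sup>2 \<noteq> -1" "q\<^sup>2 \<noteq> -2" by linarith+
  moreover have "x\<^sup>2 = of_rat (q\<^sup>2)" using q by (simp add: of_rat_power)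
  moreover have "(2::'a) = of_rat 2" "(-1::'a) = of_rat (-1)" "(-2::'a) = of_rat (-2)"
    by (simp_all add: of_rat_minus)
  ultimately show "x\<^sup>2 \<noteq> 2" "x\<^sup>2 \<noteq> -1" "x\<^sup>2 \<noteq> -2" by (simp_all only: of_rat_eq_iff of_nat_numeral not_False_eq_True)
qed

text \<open>
  If every element is a square, the field contains \<open>i\<close> and \<open>\<theta>\<close> with \<open>\<theta>\<^sup>4 = 2\<close>, and hence \<open>r = \<theta>\<^sup>2\<close>.
  Commutativity of the automorphisms, evaluated at \<open>\<theta>\<close>, forces any automorphism to move \<open>i\<close> exactly
  if it moves \<open>r\<close>.  Then \<open>i r\<close> is fixed by all of them and is a rational number with square \<open>-2\<close>.
\<close>

lemma abelian_extension_nonsquare: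
  fixes k :: "'a::field_char_0 set"
  assumes "abelian_extension_of_Q k"
  shows "\<exists>d\<in>k. \<not> square_in k d"
proof (rule ccontr)
  assume "\<not> ?thesis"
  then have sq: "\<exists>r\<in>k. r\<^sup>2 = d" if "d \<in> k" for d using that by (auto simp: square_in_def)
  define Aut where "Aut = ring_iso (field_of k) (field_of k)"
  interpret k: sub_field k
    using assms unfolding abelian_extension_of_Q_def by (auto intro: sub_field_of_subfield)
  have fixed: "x \<in> \<rat>" if "x \<in> k" "\<And>\<sigma>. \<sigma> \<in> Aut \<Longrightarrow> \<sigma> x = x" for x
    using assms that unfolding abelian_extension_of_Q_def Aut_def by blast
  have comm: "\<sigma> (\<tau> x) = \<tau> (\<sigma> x)" if "x \<in> k" "\<sigma> \<in> Aut" "\<tau> \<in> Aut" for \<sigma> \<tau> x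
    using assms that unfolding abelian_extension_of_Q_def Aut_def by blast
  have hom: "\<sigma> x \<in> k" "\<sigma> (x * y) = \<sigma> x * \<sigma> y" "\<sigma> 1 = 1" "\<sigma> (x + y) = \<sigma> x + \<sigma> y"
    if "\<sigma> \<in> Aut" "x \<in> k" "y \<in> k" for \<sigma> x y
    using ring_iso_memE[OF that(1)[unfolded Aut_def]] that by (simp_all add: ring_of_type_algebra_simps)
  have h0: "\<sigma> 0 = 0" if "\<sigma> \<in> Aut" for \<sigma> using hom(4)[OF that k.zero k.zero] by simp
  have hm: "\<sigma> (- x) = - \<sigma> x" if "\<sigma> \<in> Aut" "x \<in> k" for \<sigma> x
    using hom(4)[OF that k.uminus[OF that(2)]] h0[OF that(1)] by (simp add: eq_neg_iff_add_eq_0 add.commute)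
  obtain r where r: "r \<in> k" "r\<^sup>2 = 2" using sq[OF k.numeral[of "Num.Bit0 Num.One"]] by auto
  obtain \<theta> where \<theta>: "\<theta> \<in> k" "\<theta>\<^sup>2 = r" using sq r by blast
  obtain i where i: "i \<in> k" "i\<^sup>2 = -1" using sq[OF k.uminus[OF k.one]] by auto
  have \<theta>0: "\<theta> \<noteq> 0" using \<theta> r by auto
  have i0: "i \<noteq> 0" using i by auto
  have neg0: "t = 0" if "- t = t" for t :: 'a
  proof -
    have "2 * t = t + - t" unfolding that by (rule mult_2)
    then show ?thesis by simp
  qed
  have two: "\<sigma> 2 = 2" if "\<sigma> \<in> Aut" for \<sigma>
    using hom(4)[OF that k.one k.one] hom(3)[OF that k.one k.one] by simp
  have sr: "\<sigma> r = r \<or> \<sigma> r = - r" if "\<sigma> \<in> Aut" for \<sigma>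
  proof -
    have "(\<sigma> r)\<^sup>2 = r\<^sup>2" using hom(2)[OF that r(1) r(1)] two[OF that] r(2) by (simp add: power2_eq_square)
    then show ?thesis by (simp add: power2_eq_iff)
  qed
  have si: "\<sigma> i = i \<or> \<sigma> i = - i" if "\<sigma> \<in> Aut" for \<sigma>
  proof -
    have "(\<sigma> i)\<^sup>2 = i\<^sup>2" using hom(2)[OF that i(1) i(1)] hm[OF that k.one] hom(3)[OF that k.one k.one] i(2)
      by (simp add: power2_eq_square)
    then show ?thesis by (simp add: power2_eq_iff)
  qed
  have flip_\<theta>: "\<exists>z. (z = i \<or> z = - i) \<and> \<tau> \<theta> = z * \<theta>" if "\<tau> \<in> Aut" "\<tau> r = - r" for \<tau>
  proof -
    have "(\<tau> \<theta>)\<^sup>2 = (i * \<theta>)\<^sup>2"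
      using hom(2)[OF that(1) \<theta>(1) \<theta>(1)] that(2) \<theta>(2) i(2)
      unfolding power_mult_distrib by (simp add: power2_eq_square[symmetric])
    then have "\<tau> \<theta> = i * \<theta> \<or> \<tau> \<theta> = - i * \<theta>" by (simp add: power2_eq_iff)
    then show ?thesis by blast
  qed
  have fix_\<theta>: "\<exists>e. (e = 1 \<or> e = - 1) \<and> \<tau> \<theta> = e * \<theta>" if "\<tau> \<in> Aut" "\<tau> r = r" for \<tau>
  proof -
    have "(\<tau> \<theta>)\<^sup>2 = \<theta>\<^sup>2"
      using hom(2)[OF that(1) \<theta>(1) \<theta>(1)] that(2) \<theta>(2) by (simp add: power2_eq_square[symmetric])
    then have "\<tau> \<theta> = 1 * \<theta> \<or> \<tau> \<theta> = - 1 * \<theta>" by (simp add: power2_eq_iff)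
    then show ?thesis by blast
  qed
  obtain \<tau> where \<tau>: "\<tau> \<in> Aut" "\<tau> r = - r"
    using fixed[OF r(1)] rat_square_ne(1)[of r] r sr by blast
  \<comment> \<open>compare \<open>\<rho> (\<tau> \<theta>)\<close> with \<open>\<tau> (\<rho> \<theta>)\<close>; they would differ by a sign\<close>
  have A: "\<rho> i = i" if \<rho>: "\<rho> \<in> Aut" "\<rho> r = r" for \<rho>
  proof (rule ccontr)
    assume "\<rho> i \<noteq> i"
    then have ri: "\<rho> i = - i" using si \<rho> by blast
    obtain z where z: "z = i \<or> z = - i" "\<tau> \<theta> = z * \<theta>" using flip_\<theta>[OF \<tau>] by blast
    obtain e where e: "e = 1 \<or> e = - 1" "\<rho> \<theta> = e * \<theta>" using fix_\<theta>[OF \<rho>] by blast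
    have k: "z \<in> k" "e \<in> k" using z e i k.one by (auto intro: k.uminus)
    have "\<rho> z = - z" using z(1) ri hm[OF \<rho>(1) i(1)] by auto
    then have "\<rho> (\<tau> \<theta>) = - (z * e * \<theta>)" unfolding z(2) using hom(2)[OF \<rho>(1) k(1) \<theta>(1)] e(2) by simp
    moreover have "\<tau> e = e" using e(1) hm[OF \<tau>(1) k.one] hom(3)[OF \<tau>(1) k.one k.one] by auto
    then have "\<tau> (\<rho> \<theta>) = z * e * \<theta>" unfolding e(2) using hom(2)[OF \<tau>(1) k(2) \<theta>(1)] z(2) by simp
    ultimately have "z * e * \<theta> = 0" using comm[OF \<theta>(1) \<rho>(1) \<tau>(1)]
      by (auto dest!: neg0)
    then show False using z(1) e(1) i0 \<theta>0 by auto
  qed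
  have ir: "i * r \<in> k" "(i * r)\<^sup>2 = -2" using i r by (auto intro: k.mult simp: power_mult_distrib)
  obtain \<rho> where \<rho>: "\<rho> \<in> Aut" "\<rho> (i * r) \<noteq> i * r"
    using fixed[OF ir(1)] rat_square_ne(3)[of "i * r"] ir by blast
  have "\<rho> r = - r" "\<rho> i = i"
    using \<rho> hom(2)[OF \<rho>(1) i(1) r(1)] sr[OF \<rho>(1)] si[OF \<rho>(1)] A[OF \<rho>(1)] by auto
  \<comment> \<open>now \<open>\<rho>\<close> moves \<open>r\<close> but not \<open>i\<close>, and the same comparison with \<open>\<tau>'\<close> fails\<close>
  obtain \<tau>' where \<tau>': "\<tau>' \<in> Aut" "\<tau>' i = - i"
    using fixed[OF i(1)] rat_square_ne(2)[of i] i si by blast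
  then have \<tau>'r: "\<tau>' r = - r" using A[OF \<tau>'(1)] sr[OF \<tau>'(1)] i0 by auto
  obtain z where z: "z = i \<or> z = - i" "\<rho> \<theta> = z * \<theta>"
    using flip_\<theta>[OF \<rho>(1) \<open>\<rho> r = - r\<close>] by blast
  obtain w where w: "w = i \<or> w = - i" "\<tau>' \<theta> = w * \<theta>"
    using flip_\<theta>[OF \<tau>'(1) \<tau>'r] by blast
  have k: "z \<in> k" "w \<in> k" using z w i by (auto intro: k.uminus)
  have "\<tau>' z = - z" using z(1) \<tau>'(2) hm[OF \<tau>'(1) i(1)] by auto
  then have "\<tau>' (\<rho> \<theta>) = - (z * w * \<theta>)" unfolding z(2) using hom(2)[OF \<tau>'(1) k(1) \<theta>(1)] w(2) by simp
  moreover have "\<rho> w = w" using w(1) \<open>\<rho> i = i\<close> hm[OF \<rho>(1) i(1)] by auto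
  then have "\<rho> (\<tau>' \<theta>) = z * w * \<theta>" unfolding w(2) using hom(2)[OF \<rho>(1) k(2) \<theta>(1)] z(2) by simp
  ultimately have "z * w * \<theta> = 0" using comm[OF \<theta>(1) \<rho>(1) \<tau>'(1)]
    by (auto dest!: neg0)
  then show False using z(1) w(1) i0 \<theta>0 by auto
qed

section \<open>Non-squares in function fields of varieties\<close>

text \<open>
  For all but finitely many constants \<open>c\<close>, the elements of \<open>A\<close>, seen as rational functions of \<open>y\<close>,
  have order zero at \<open>c\<close>; multiplied by \<open>y - c\<close> they have odd order there.
\<close>

lemma infinite_square_classes_transcendental:
  fixes F :: "'a::field_char_0 set"
  assumes "sub_field F" "transcendental_over F y"
  shows "infinite_square_classes (adjoin F y)"
  unfolding infinite_square_classes_def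
proof (intro allI impI)
  interpret F: sub_field F by fact
  fix A assume A: "finite A" "A \<subseteq> adjoin F y - {0}"
  have "\<forall>a\<in>A. \<exists>p q. a = poly p y / poly q y \<and> p \<in> poly_over F \<and> q \<in> poly_over F \<and> p \<noteq> 0 \<and> q \<noteq> 0"
  proof
    fix a assume "a \<in> A"
    then have "a \<in> adjoin F y" "a \<noteq> 0" using A by auto
    then show "\<exists>p q. a = poly p y / poly q y \<and> p \<in> poly_over F \<and> q \<in> poly_over F \<and> p \<noteq> 0 \<and> q \<noteq> 0"
      unfolding adjoin_def by fastforce
  qed
  then obtain p q where pq: "\<And>a. a \<in> A \<Longrightarrow> a = poly (p a) y / poly (q a) y"
    "\<And>a. a \<in> A \<Longrightarrow> p a \<in> poly_over F" "\<And>a. a \<in> A \<Longrightarrow> q a \<in> poly_over F"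
    "\<And>a. a \<in> A \<Longrightarrow> p a \<noteq> 0" "\<And>a. a \<in> A \<Longrightarrow> q a \<noteq> 0" by metis
  have "finite (\<Union>a\<in>A. {x. poly (p a * q a) x = 0})"
    using A(1) pq(4,5) by (intro finite_UN_I poly_roots_finite) auto
  moreover have "infinite (range (of_nat :: nat \<Rightarrow> 'a))"
    by (rule range_inj_infinite[OF semiring_char_0_class.inj_of_nat])
  ultimately have "infinite (range of_nat - (\<Union>a\<in>A. {x. poly (p a * q a) x = 0}))"
    by (rule Diff_infinite_finite)
  then obtain c where c: "c \<in> range of_nat" "c \<notin> (\<Union>a\<in>A. {x. poly (p a * q a) x = 0})"
    using infinite_imp_nonempty by blast
  then have cF: "c \<in> F" using F.of_nat by auto
  have nr: "poly (p a) c \<noteq> 0" "poly (q a) c \<noteq> 0" if "a \<in> A" for a using c that by auto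
  have L: "[:- c, 1:] \<in> poly_over F" using cF by (auto intro: F.uminus F.one)
  have "y - c \<noteq> 0" using assms(2) L unfolding transcendental_over_def by fastforce
  have "\<not> square_in (adjoin F y) (a * (y - c))" if a: "a \<in> A" for a
  proof
    assume "square_in (adjoin F y) (a * (y - c))"
    then obtain u v where uv: "u \<in> poly_over F" "v \<in> poly_over F" "poly v y \<noteq> 0"
      "(poly u y / poly v y)\<^sup>2 = a * (y - c)"
      unfolding square_in_def adjoin_def by auto
    have qy: "poly (q a) y \<noteq> 0" using pq[OF a] assms(2) unfolding transcendental_over_def by blast
    define w where "w = [:- c, 1:] * p a * v\<^sup>2 - q a * u\<^sup>2"
    have "(poly u y)\<^sup>2 = a * (y - c) * (poly v y)\<^sup>2"
      using uv(3,4) by (simp add: power_divide field_simps)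
    moreover have "a * poly (q a) y = poly (p a) y" using pq(1)[OF a] qy by (metis nonzero_eq_divide_eq)
    ultimately have "poly (q a) y * (poly u y)\<^sup>2 = poly (p a) y * (y - c) * (poly v y)\<^sup>2"
      by (metis mult.assoc mult.commute)
    then have "poly w y = 0" unfolding w_def by (simp add: algebra_simps)
    moreover have "w \<in> poly_over F"
      unfolding w_def power2_eq_square using uv pq[OF a] L by blast
    ultimately have "w = 0" using assms(2) unfolding transcendental_over_def by blast
    then have eq: "[:- c, 1:] * p a * v\<^sup>2 = q a * u\<^sup>2" by (simp add: w_def)
    have v0: "v \<noteq> 0" using uv by auto
    have X: "[:- c, 1:] \<noteq> 0" "Polynomial.order c [:- c, 1:] = 1" using order_power_n_n[of c 1] by simp_all
    have L1: "[:- c, 1:] * p a \<noteq> 0" using X pq(4)[OF a] by (metis no_zero_divisors)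
    have L0: "[:- c, 1:] * p a * v\<^sup>2 \<noteq> 0" using L1 v0 by (metis no_zero_divisors power_not_zero)
    have ov: "Polynomial.order c (v\<^sup>2) = 2 * Polynomial.order c v" if "v \<noteq> 0" for v
      using that unfolding power2_eq_square by (subst order_mult) auto
    have "Polynomial.order c ([:- c, 1:] * p a * v\<^sup>2) = Polynomial.order c [:- c, 1:] + Polynomial.order c (p a) + Polynomial.order c (v\<^sup>2)"
      using order_mult[OF L0] order_mult[OF L1] by simp
    then have "Polynomial.order c ([:- c, 1:] * p a * v\<^sup>2) = 1 + 2 * Polynomial.order c v"
      unfolding X(2) ov[OF v0] order_0I[OF nr(1)[OF a]] by simp
    moreover have u0: "u \<noteq> 0" "q a * u\<^sup>2 \<noteq> 0" using L0 unfolding eq by auto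
    have "Polynomial.order c (q a * u\<^sup>2) = 2 * Polynomial.order c u"
      unfolding order_mult[OF u0(2)] ov[OF u0(1)] order_0I[OF nr(2)[OF a]] by simp
    ultimately have "1 + 2 * Polynomial.order c v = 2 * Polynomial.order c u" using eq by simp
    then show False by presburger
  qed
  moreover have "y - c \<in> adjoin F y" using F.poly_in_adjoin[OF L, of y] by simp
  ultimately show "\<exists>b\<in>adjoin F y - {0}. \<forall>a\<in>A. \<not> square_in (adjoin F y) (a * b)"
    using \<open>y - c \<noteq> 0\<close> by (intro bexI[of _ "y - c"]) auto
qed

lemma fun_ring_is_ring:
  assumes "(\<lambda>_. 0) \<in> S" "(\<lambda>_. 1) \<in> S" "\<And>f. f \<in> S \<Longrightarrow> (\<lambda>x. - f x) \<in> S"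
    "\<And>f g. f \<in> S \<Longrightarrow> g \<in> S \<Longrightarrow> (\<lambda>x. f x + g x) \<in> S"
    "\<And>f g. f \<in> S \<Longrightarrow> g \<in> S \<Longrightarrow> (\<lambda>x. f x * g x) \<in> S"
  shows "ring (fun_ring S)"
proof (rule ringI)
  show "abelian_group (fun_ring S)"
  proof (rule abelian_groupI)
    fix f assume "f \<in> carrier (fun_ring S)"
    then show "\<exists>g\<in>carrier (fun_ring S). g \<oplus>\<^bsub>fun_ring S\<^esub> f = \<zero>\<^bsub>fun_ring S\<^esub>"
      using assms(3) by (auto simp: fun_ring_simps intro!: bexI[of _ "\<lambda>x. - f x"])
  qed (use assms in \<open>auto simp: fun_ring_simps algebra_simps\<close>)
  show "Group.monoid (fun_ring S)"
    by (rule monoidI) (use assms in \<open>auto simp: fun_ring_simps algebra_simps\<close>)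
qed (auto simp: fun_ring_simps algebra_simps)

lemma poly_fun_ring_closed:
  assumes "sub_field F"
  shows "(\<lambda>_. 0) \<in> poly_fun F n" "(\<lambda>_. 1) \<in> poly_fun F n" "f \<in> poly_fun F n \<Longrightarrow> (\<lambda>x. - f x) \<in> poly_fun F n"
proof -
  interpret F: sub_field F by fact
  show "(\<lambda>_. 0) \<in> poly_fun F n" "(\<lambda>_. 1) \<in> poly_fun F n" by (auto intro: poly_fun.const F.zero F.one)
  show "(\<lambda>x. - f x) \<in> poly_fun F n" if "f \<in> poly_fun F n"
    using poly_fun.mult[OF poly_fun.const[OF F.uminus[OF F.one]] that] by simp
qed

text \<open>
  The embedding of the coordinate ring into its fraction field, composed with the quotient map.
  Afterwards one can calculate with polynomial functions instead of cosets.
\<close>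

lemma coordinate_ring_embedding:
  fixes k :: "'a::field set"
  assumes k0: "sub_field k\<^sub>0" and k: "sub_field k"
    and frac: "is_fraction_field (coordinate_ring k\<^sub>0 n V) (field_of k)"
  obtains e where "\<And>f g. f \<in> poly_fun k\<^sub>0 n \<Longrightarrow> g \<in> poly_fun k\<^sub>0 n \<Longrightarrow> e (\<lambda>x. f x + g x) = e f + e g"
    "\<And>f g. f \<in> poly_fun k\<^sub>0 n \<Longrightarrow> g \<in> poly_fun k\<^sub>0 n \<Longrightarrow> e (\<lambda>x. f x * g x) = e f * e g"
    "e (\<lambda>_. 1) = 1" "\<And>f. f \<in> poly_fun k\<^sub>0 n \<Longrightarrow> e f \<in> k"
    "\<And>f. f \<in> poly_fun k\<^sub>0 n \<Longrightarrow> e f = 0 \<longleftrightarrow> (\<forall>x\<in>V. f x = 0)"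
    "\<And>x. x \<in> k \<Longrightarrow> \<exists>f\<in>poly_fun k\<^sub>0 n. \<exists>g\<in>poly_fun k\<^sub>0 n. x = e f / e g"
proof -
  define S where "S = poly_fun k\<^sub>0 n"
  define I where "I = {f \<in> S. \<forall>x\<in>V. f x = 0}"
  define R where "R = fun_ring S"
  note cl = poly_fun_ring_closed[OF k0, where n = n, folded S_def] poly_fun.add[where k = k\<^sub>0 and n = n, folded S_def] poly_fun.mult[where k = k\<^sub>0 and n = n, folded S_def]
  interpret R: ring R unfolding R_def by (rule fun_ring_is_ring) (use cl in auto)
  have Rs: "carrier R = S" "\<And>f g. f \<otimes>\<^bsub>R\<^esub> g = (\<lambda>x. f x * g x)" "\<one>\<^bsub>R\<^esub> = (\<lambda>_. 1)"
    "\<zero>\<^bsub>R\<^esub> = (\<lambda>_. 0)" "\<And>f g. f \<oplus>\<^bsub>R\<^esub> g = (\<lambda>x. f x + g x)"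
    by (simp_all add: R_def fun_ring_simps)
  have um: "\<ominus>\<^bsub>R\<^esub> f = (\<lambda>x. - f x)" if "f \<in> S" for f
    using R.minus_equality[of "\<lambda>x. - f x" f] cl that by (auto simp: Rs)
  have "subgroup I (add_monoid R)"
    by (rule R.add.subgroupI) (use cl(1) in \<open>auto simp: I_def Rs um cl simp flip: a_inv_def intro!: exI[of _ "\<lambda>_. 0"]\<close>)
  then have idl: "ideal I R"
    by (intro idealI) (auto simp: R.ring_axioms I_def Rs cl)
  interpret I: ideal I R by fact
  have "is_fraction_field (R Quot I) (field_of k)"
    using frac unfolding coordinate_ring_def S_def I_def R_def .
  then have fk: "field (field_of k)" and "\<exists>\<iota> \<in> Ring.ring_hom (R Quot I) (field_of k). inj_on \<iota> (carrier (R Quot I)) \<and>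
        (\<forall>x \<in> carrier (field_of k). \<exists>a \<in> carrier (R Quot I). \<exists>b \<in> carrier (R Quot I). b \<noteq> \<zero>\<^bsub>R Quot I\<^esub> \<and>
            x = \<iota> a \<otimes>\<^bsub>field_of k\<^esub> inv\<^bsub>field_of k\<^esub> (\<iota> b))"
    unfolding is_fraction_field_def by (rule conjunct1, rule conjunct2)
  then obtain \<iota> where \<iota>: "\<iota> \<in> Ring.ring_hom (R Quot I) (field_of k)" "inj_on \<iota> (carrier (R Quot I))"
    "\<forall>x \<in> carrier (field_of k). \<exists>a \<in> carrier (R Quot I). \<exists>b \<in> carrier (R Quot I). b \<noteq> \<zero>\<^bsub>R Quot I\<^esub> \<and>
            x = \<iota> a \<otimes>\<^bsub>field_of k\<^esub> inv\<^bsub>field_of k\<^esub> (\<iota> b)"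
    by (elim bexE conjE)
  interpret fk: field "field_of k" by (rule fk)
  interpret k: sub_field k by (rule k)
  have fks: "carrier (field_of k) = k" "\<And>x y. x \<otimes>\<^bsub>field_of k\<^esub> y = x * y" "\<one>\<^bsub>field_of k\<^esub> = 1"
    "\<zero>\<^bsub>field_of k\<^esub> = 0" "\<And>x y. x \<oplus>\<^bsub>field_of k\<^esub> y = x + y" by (simp_all add: ring_of_type_algebra_simps)
  have inv: "inv\<^bsub>field_of k\<^esub> x = inverse x" if "x \<in> k" "x \<noteq> 0" for x
    using fk.comm_inv_char[of x "inverse x"] that k.inverse[of x]
    by (simp add: fks ring_of_type_algebra_simps)
  define c where "c = (\<lambda>f. I +>\<^bsub>R\<^esub> f)"
  define e where "e = (\<lambda>f. \<iota> (c f))"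
  have ch: "c \<in> Ring.ring_hom R (R Quot I)" unfolding c_def by (rule I.rcos_ring_hom)
  have eh: "e \<in> Ring.ring_hom R (field_of k)"
    using ring_hom_trans[OF ch \<iota>(1)] unfolding e_def comp_def .
  have zQ: "\<zero>\<^bsub>R Quot I\<^esub> = I" by (simp add: FactRing_def)
  have carQ: "x \<in> carrier (R Quot I) \<Longrightarrow> \<exists>f\<in>S. x = c f" for x
    by (auto simp: FactRing_def A_RCOSETS_def' a_r_coset_def' c_def Rs)
  have cz: "c f = \<zero>\<^bsub>R Quot I\<^esub> \<longleftrightarrow> f \<in> I" if "f \<in> S" for f
  proof
    assume "c f = \<zero>\<^bsub>R Quot I\<^esub>"
    then show "f \<in> I" using I.a_rcos_self[of f] that unfolding zQ c_def by (auto simp: Rs)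
  next
    assume "f \<in> I"
    then show "c f = \<zero>\<^bsub>R Quot I\<^esub>" unfolding zQ c_def by (rule I.a_rcos_const)
  qed
  interpret Q: ring "R Quot I" by (rule I.quotient_is_ring)
  have z: "\<iota> \<zero>\<^bsub>R Quot I\<^esub> = 0"
    using ring_hom_zero[OF \<iota>(1) Q.ring_axioms fk.ring_axioms] fks by simp
  have ez: "e f = 0 \<longleftrightarrow> f \<in> I" if "f \<in> S" for f
  proof -
    have "c f \<in> carrier (R Quot I)" using ring_hom_memE(1)[OF ch, of f] that by (simp add: Rs)
    then have "\<iota> (c f) = \<iota> \<zero>\<^bsub>R Quot I\<^esub> \<longleftrightarrow> c f = \<zero>\<^bsub>R Quot I\<^esub>"
      using inj_on_eq_iff[OF \<iota>(2)] Q.zero_closed by blast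
    then show ?thesis unfolding z cz[OF that] e_def .
  qed
  have ek: "e f \<in> k" if "f \<in> S" for f using ring_hom_memE(1)[OF eh, of f] that by (simp add: Rs ring_of_type_algebra_simps)
  show ?thesis
  proof (rule that[of e])
    fix x assume "x \<in> k"
    then have "x \<in> carrier (field_of k)" by simp
    from \<iota>(3)[rule_format, OF this] obtain a b where ab: "a \<in> carrier (R Quot I)"
      "b \<in> carrier (R Quot I)" "b \<noteq> \<zero>\<^bsub>R Quot I\<^esub>"
      "x = \<iota> a \<otimes>\<^bsub>field_of k\<^esub> inv\<^bsub>field_of k\<^esub> (\<iota> b)" by (elim bexE conjE)
    obtain f g where fg: "f \<in> S" "g \<in> S" "a = c f" "b = c g" using carQ ab(1,2) by metis
    then have eg: "e g \<noteq> 0" using ab(3) cz[OF fg(2)] ez[OF fg(2)] by simp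
    have "x = e f \<otimes>\<^bsub>field_of k\<^esub> inv\<^bsub>field_of k\<^esub> (e g)"
      using ab(4) unfolding e_def fg(3,4)[symmetric] .
    then have "x = e f / e g"
      unfolding inv[OF ek[OF fg(2)] eg] fks(2) by (simp add: divide_inverse)
    then show "\<exists>f\<in>poly_fun k\<^sub>0 n. \<exists>g\<in>poly_fun k\<^sub>0 n. x = e f / e g"
      using fg unfolding S_def by blast
  qed (use ring_hom_memE[OF eh] ez in \<open>auto simp: Rs ring_of_type_algebra_simps S_def[symmetric] I_def\<close>)
qed

lemma closedin_subtopology_zariski:
  assumes "sub_field F" "closedin (subtopology (zariski F n) V) Z"
  shows "\<exists>P\<subseteq>poly_fun F n. Z = V \<inter> zero_locus n P"
proof -
  obtain C where "closedin (zariski F n) C" "Z = C \<inter> V"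
    using assms(2) unfolding closedin_subtopology by auto
  then show ?thesis
    using closedin_zariski(2)[OF sub_field.zero[OF assms(1)] sub_field.one[OF assms(1)]]
    by (metis Int_commute)
qed

text \<open>
  Let \<open>k'\<close> be the image of the constants.  If all elements \<open>e f\<close> were algebraic over \<open>k'\<close>, every
  polynomial function that does not vanish on \<open>V\<close> would be invertible on \<open>V\<close>, and \<open>V\<close> would have no
  proper nonempty closed subset, contrary to its positive dimension.  So some \<open>y = e f\<close> is
  transcendental, and \<open>k\<close> is generated by \<open>k'(y)\<close> and the images of the coordinates.
\<close>

lemma variety_function_field_nonsquare:
  fixes k :: "'a::field_char_0 set"
  assumes k: "sub_field k" and vff: "variety_function_field k"
  shows "\<exists>d\<in>k. \<not> square_in k d"
proof -
  obtain k\<^sub>0 :: "'a set" and n V where V: "subfield k\<^sub>0 ring_of_type_algebra"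
    "krull_dim (subtopology (zariski k\<^sub>0 n) V) > 0"
    "is_fraction_field (coordinate_ring k\<^sub>0 n V) (field_of k)"
    using vff unfolding variety_function_field_def by blast
  have k0: "sub_field k\<^sub>0" by (rule sub_field_of_subfield[OF V(1)])
  interpret k0: sub_field k\<^sub>0 by fact
  interpret k: sub_field k by fact
  let ?S = "poly_fun k\<^sub>0 n"
  note cl = poly_fun_ring_closed[OF k0, where n = n] poly_fun.add[where k = k\<^sub>0 and n = n] poly_fun.mult[where k = k\<^sub>0 and n = n]
  obtain e where e: "\<And>f g. f \<in> ?S \<Longrightarrow> g \<in> ?S \<Longrightarrow> e (\<lambda>x. f x + g x) = e f + e g"
    "\<And>f g. f \<in> ?S \<Longrightarrow> g \<in> ?S \<Longrightarrow> e (\<lambda>x. f x * g x) = e f * e g"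
    "e (\<lambda>_. 1) = 1" "\<And>f. f \<in> ?S \<Longrightarrow> e f \<in> k"
    "\<And>f. f \<in> ?S \<Longrightarrow> e f = 0 \<longleftrightarrow> (\<forall>x\<in>V. f x = 0)"
    "\<And>x. x \<in> k \<Longrightarrow> \<exists>f\<in>?S. \<exists>g\<in>?S. x = e f / e g"
    by (rule coordinate_ring_embedding[OF k0 k V(3)]) (assumption | rule that)+
  have e0: "e (\<lambda>_. 0) = 0" using e(5)[OF cl(1)] by simp
  define k' where "k' = (\<lambda>c. e (\<lambda>_. c)) ` k\<^sub>0"
  have cS: "(\<lambda>_. c) \<in> ?S" if "c \<in> k\<^sub>0" for c using that by (rule poly_fun.const)
  have ca: "e (\<lambda>_. c) + e (\<lambda>_. d) = e (\<lambda>_. c + d)" "e (\<lambda>_. c) * e (\<lambda>_. d) = e (\<lambda>_. c * d)"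
    if "c \<in> k\<^sub>0" "d \<in> k\<^sub>0" for c d
    using e(1,2)[OF cS[OF that(1)] cS[OF that(2)]] by simp_all
  have k': "sub_field k'"
  proof
    show "0 \<in> k'" unfolding k'_def using k0.zero e0 by force
    show "1 \<in> k'" unfolding k'_def using k0.one e(3) by force
    fix x assume "x \<in> k'"
    then obtain c where c: "c \<in> k\<^sub>0" "x = e (\<lambda>_. c)" unfolding k'_def by auto
    have "- x = e (\<lambda>_. - c)"
      using ca(1)[OF c(1) k0.uminus[OF c(1)]] c e0 by (simp add: minus_unique)
    then show "- x \<in> k'" unfolding k'_def using c k0.uminus by blast
    show "inverse x \<in> k'"
    proof (cases "c = 0")
      case True
      then show ?thesis using c e0 \<open>0 \<in> k'\<close> by simp
    next
      case False
      then have "x * e (\<lambda>_. inverse c) = 1" using ca(2)[OF c(1) k0.inverse[OF c(1)]] c e(3) by simp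
      then have "inverse x = e (\<lambda>_. inverse c)" by (rule inverse_unique)
      then show ?thesis unfolding k'_def using c k0.inverse by blast
    qed
    fix y assume "y \<in> k'"
    then obtain d where d: "d \<in> k\<^sub>0" "y = e (\<lambda>_. d)" unfolding k'_def by auto
    show "x + y \<in> k'" "x * y \<in> k'"
      unfolding c d ca[OF c(1) d(1)] k'_def using c d k0.add k0.mult by blast+
  qed
  interpret k': sub_field k' by fact
  have k'k: "k' \<subseteq> k" unfolding k'_def using e(4) cS by blast
  have poly_e: "\<exists>g\<in>?S. poly q (e f) = e g" if f: "f \<in> ?S" and q: "q \<in> poly_over k'" for f q
    using q
  proof (induction q)
    case 0
    then show ?case using cl(1) e0 by (intro bexI[of _ "\<lambda>_. 0"]) auto
  next
    case (pCons a q)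
    have "a \<in> k'" using pCons(3) unfolding poly_over_def by (metis mem_Collect_eq coeff_pCons_0)
    moreover have "q \<in> poly_over k'" using pCons(3) unfolding poly_over_def by (auto dest: spec[of _ "Suc _"])
    ultimately obtain c g where cg: "c \<in> k\<^sub>0" "a = e (\<lambda>_. c)" "g \<in> ?S" "poly q (e f) = e g"
      using pCons(2) unfolding k'_def by auto
    have "poly (pCons a q) (e f) = e (\<lambda>x. c + f x * g x)"
      using cg e(1)[OF cS[OF cg(1)] cl(5)[OF f cg(3)]] e(2)[OF f cg(3)] by simp
    then show ?case using cl(4)[OF cS[OF cg(1)] cl(5)[OF f cg(3)]] by blast
  qed
  have "\<exists>f\<in>?S. transcendental_over k' (e f)"
  proof (rule ccontr)
    assume nt: "\<not> ?thesis"
    obtain d :: nat and Z where Z: "d > 0" "\<forall>i\<le>d. closedin (subtopology (zariski k\<^sub>0 n) V) (Z i) \<and>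
        irreducible_in (subtopology (zariski k\<^sub>0 n) V) (Z i)" "\<forall>i<d. Z i \<subset> Z (Suc i)"
      using V(2) unfolding krull_dim_def less_Sup_iff by (auto simp: zero_enat_def)
    have Zs: "closedin (subtopology (zariski k\<^sub>0 n) V) (Z 0)" "Z 0 \<noteq> {}" "Z 0 \<subset> Z 1" "Z 1 \<subseteq> V"
      using Z by (auto simp: irreducible_in_def Suc_le_eq)
    obtain P where P: "P \<subseteq> ?S" "Z 0 = V \<inter> zero_locus n P"
      using closedin_subtopology_zariski[OF k0 Zs(1)] by blast
    obtain z x where z: "z \<in> Z 1" "z \<notin> Z 0" and x: "x \<in> Z 0" using Zs by blast
    have "z \<in> carrier_vec n"
      using z(1) Z(1) Z(2)[rule_format, of 1]
      by (auto simp: irreducible_in_def Suc_le_eq closedin_zariski(1)[OF k0.zero k0.one])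
    then obtain f where f: "f \<in> P" "f z \<noteq> 0" using z P Zs unfolding zero_locus_def by blast
    have fS: "f \<in> ?S" using f P by auto
    have fx: "f x = 0" using x f P by (auto simp: zero_locus_def)
    have ef: "e f \<noteq> 0" using e(5)[OF fS] f z Zs by auto
    obtain p where p: "p \<in> poly_over k'" "poly p (e f) = 0" "p \<noteq> 0"
      using nt fS unfolding transcendental_over_def by blast
    have "\<exists>c q. c \<in> k' \<and> c \<noteq> 0 \<and> q \<in> poly_over k' \<and> c + e f * poly q (e f) = 0"
      using p
    proof (induction p)
      case (pCons a p)
      have ap: "a \<in> k'" "p \<in> poly_over k'"
        using pCons(3) unfolding poly_over_def by (metis mem_Collect_eq coeff_pCons_0, auto dest: spec[of _ "Suc _"])
      show ?case
      proof (cases "a = 0")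
        case True
        then show ?thesis using pCons ap ef by auto
      next
        case False
        then show ?thesis using pCons ap by (intro exI[of _ a] exI[of _ p]) auto
      qed
    qed simp
    then obtain c q where cq: "c \<in> k\<^sub>0" "e (\<lambda>_. c) \<noteq> 0" "q \<in> poly_over k'" "e (\<lambda>_. c) + e f * poly q (e f) = 0"
      unfolding k'_def by blast
    obtain g where g: "g \<in> ?S" "poly q (e f) = e g" using poly_e[OF fS cq(3)] by blast
    have "e (\<lambda>x. c + f x * g x) = 0"
      using cq g e(1)[OF cS[OF cq(1)] cl(5)[OF fS g(1)]] e(2)[OF fS g(1)] by simp
    then have "c + f x * g x = 0"
      using e(5)[OF cl(4)[OF cS[OF cq(1)] cl(5)[OF fS g(1)]]] x P by blast
    then have "c = 0" using fx by simp
    then show False using cq e0 by simp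
  qed
  then obtain f where f: "f \<in> ?S" "transcendental_over k' (e f)" by blast
  define S where "S = (\<lambda>i. e (\<lambda>x. x $ i)) ` {..<n}"
  obtain G where G: "sub_field G" "infinite_square_classes G" "adjoin k' (e f) \<union> S \<subseteq> G"
    "\<And>H. sub_field H \<Longrightarrow> adjoin k' (e f) \<union> S \<subseteq> H \<Longrightarrow> G \<subseteq> H"
    using infinite_square_classes_finitely_generated[OF _ k'.adjoin_sub_field
        infinite_square_classes_transcendental[OF k' f(2)], of S] unfolding S_def by auto
  interpret G: sub_field G by fact
  have k'G: "k' \<subseteq> G" using G(3) k'.adjoin_incl by blast
  have eG: "e g \<in> G" if "g \<in> ?S" for g
    using that
  proof (induction rule: poly_fun.induct)
    case (const c)
    then show ?case using k'G unfolding k'_def by auto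
  next
    case (coord i)
    then show ?case using G(3) unfolding S_def by auto
  qed (simp_all add: e G.add G.mult)
  have "k \<subseteq> G"
  proof
    fix x assume "x \<in> k"
    then show "x \<in> G" using e(6) eG G.divide by metis
  qed
  moreover have "G \<subseteq> k"
  proof (rule G(4)[OF k])
    have "S \<subseteq> k" unfolding S_def by (auto intro: e(4) poly_fun.coord)
    then show "adjoin k' (e f) \<union> S \<subseteq> k" using adjoin_min[OF k k'k e(4)[OF f(1)]] by auto
  qed
  ultimately have "G = k" by auto
  then show ?thesis using infinite_square_classes_nonsquare[OF G(1,2)] by simp
qed

section \<open>Non-squares in fields of meromorphic functions\<close>

lemma has_derivative_line: "((\<lambda>t. a + t *s v) has_derivative (\<lambda>t. t *s v)) (at (t0::complex))"
  for a v :: "complex ^ 'n"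
proof -
  have "linear (\<lambda>t::complex. t *s v)"
    by (rule linearI) (simp_all add: Finite_Cartesian_Product.vec_eq_iff distrib_right)
  then have "bounded_linear (\<lambda>t::complex. t *s v)" by (rule linear_conv_bounded_linear[THEN iffD1])
  then have "((\<lambda>t. t *s v) has_derivative (\<lambda>t. t *s v)) (at t0)" by (rule bounded_linear_imp_has_derivative)
  then show ?thesis by (rule has_derivative_add_const[of _ _ _ a, simplified add.commute])
qed

text \<open>
  Functions of several variables are studied through their restrictions to complex lines.
\<close>

lemma holomorphic_sev_line:
  fixes f :: "complex ^ 'n \<Rightarrow> complex"
  assumes "(f has_derivative D) (at (a + t *s v))" "\<And>c w. D (c *s w) = c * D w"
  shows "((\<lambda>t. f (a + t *s v)) has_field_derivative D v) (at t)"
proof -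
  have "((\<lambda>t. f (a + t *s v)) has_derivative (\<lambda>u. D (u *s v))) (at t)"
    using has_derivative_compose[OF has_derivative_line assms(1)] .
  then show ?thesis unfolding assms(2) has_field_derivative_def by (simp add: mult_commute_abs)
qed

lemma holomorphic_sev_line_holomorphic:
  assumes "holomorphic_sev f S" "\<And>t. t \<in> T \<Longrightarrow> a + t *s v \<in> S"
  shows "(\<lambda>t. f (a + t *s v)) holomorphic_on T"
  unfolding holomorphic_on_def
proof
  fix t assume "t \<in> T"
  then obtain D where D: "(f has_derivative D) (at (a + t *s v))" "\<And>c w. D (c *s w) = c * D w"
    using assms unfolding holomorphic_sev_def by blast
  show "(\<lambda>t. f (a + t *s v)) field_differentiable at t within T"
    using holomorphic_sev_line[OF D] field_differentiable_at_within field_differentiable_def by blast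
qed

lemma holomorphic_sev_mono: "holomorphic_sev f S \<Longrightarrow> T \<subseteq> S \<Longrightarrow> holomorphic_sev f T"
  unfolding holomorphic_sev_def by blast

lemma holomorphic_sev_continuous: "holomorphic_sev f S \<Longrightarrow> continuous_on S f"
  unfolding holomorphic_sev_def
  by (meson continuous_at_imp_continuous_on has_derivative_continuous)

lemma holomorphic_sev_diff_cmult:
  assumes "holomorphic_sev f S" "holomorphic_sev g S"
  shows "holomorphic_sev (\<lambda>z. f z - c * g z) S"
  unfolding holomorphic_sev_def
proof
  fix z assume "z \<in> S"
  then obtain D E where "(f has_derivative D) (at z)" "\<And>c v. D (c *s v) = c * D v"
    "(g has_derivative E) (at z)" "\<And>c v. E (c *s v) = c * E v"
    using assms unfolding holomorphic_sev_def by blast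
  then show "\<exists>D. ((\<lambda>z. f z - c * g z) has_derivative D) (at z) \<and> (\<forall>c v. D (c *s v) = c * D v)"
    by (intro exI[of _ "\<lambda>v. D v - c * E v"] conjI has_derivative_diff has_derivative_mult_right) (auto simp: algebra_simps)
qed

lemma holomorphic_sev_divide:
  assumes "holomorphic_sev f S" "holomorphic_sev g S" "\<And>z. z \<in> S \<Longrightarrow> g z \<noteq> 0"
  shows "holomorphic_sev (\<lambda>z. f z / g z) S"
  unfolding holomorphic_sev_def
proof
  fix z assume z: "z \<in> S"
  then obtain D E where *: "(f has_derivative D) (at z)" "\<And>c v. D (c *s v) = c * D v"
    "(g has_derivative E) (at z)" "\<And>c v. E (c *s v) = c * E v"
    using assms unfolding holomorphic_sev_def by blast
  show "\<exists>D. ((\<lambda>z. f z / g z) has_derivative D) (at z) \<and> (\<forall>c v. D (c *s v) = c * D v)"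
    using has_derivative_divide'[OF *(1,3) assms(3)[OF z]] *(2,4)
    by (intro exI[of _ "\<lambda>h. (D h * g z - f z * E h) / (g z * g z)"] conjI) (auto simp: algebra_simps diff_divide_distrib)
qed

lemma line_open_convex:
  fixes a v :: "complex ^ 'n"
  assumes "open B" "convex B"
  shows "open {t. a + t *s v \<in> B}" "convex {t. a + t *s v \<in> B}"
proof -
  have "continuous_on UNIV (\<lambda>t. a + t *s v)"
    by (intro continuous_at_imp_continuous_on ballI has_derivative_continuous[OF has_derivative_line])
  then show "open {t. a + t *s v \<in> B}" using open_vimage[OF assms(1), of "\<lambda>t. a + t *s v"] by (simp add: vimage_def)
  show "convex {t. a + t *s v \<in> B}"
    unfolding convex_def
  proof (intro ballI allI impI)
    fix t u :: complex and x y :: real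
    assume *: "t \<in> {t. a + t *s v \<in> B}" "u \<in> {t. a + t *s v \<in> B}" "0 \<le> x" "0 \<le> y" "x + y = 1"
    have "a + (x *\<^sub>R t + y *\<^sub>R u) *s v = x *\<^sub>R (a + t *s v) + y *\<^sub>R (a + u *s v)"
    proof -
      have "a = x *\<^sub>R a + y *\<^sub>R a" using *(5) by (simp add: scaleR_left_distrib[symmetric])
      then show ?thesis by (subst \<open>a = x *\<^sub>R a + y *\<^sub>R a\<close>) (simp add: Finite_Cartesian_Product.vec_eq_iff algebra_simps)
    qed
    then show "x *\<^sub>R t + y *\<^sub>R u \<in> {t. a + t *s v \<in> B}"
      using assms(2) * unfolding convex_def by simp
  qed
qed

text \<open>
  On the complex line through a point of \<open>S\<close> and \<open>z\<close> this is the identity theorem in one variable.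
\<close>

lemma holomorphic_sev_identity:
  fixes f :: "complex ^ 'n \<Rightarrow> complex"
  assumes B: "open B" "convex B" "holomorphic_sev f B" and S: "open S" "S \<subseteq> B" "S \<noteq> {}" "\<And>z. z \<in> S \<Longrightarrow> f z = 0"
    and z: "z \<in> B"
  shows "f z = 0"
proof -
  obtain a where a: "a \<in> S" using S by blast
  define v where "v = z - a"
  define T where "T = {t. a + t *s v \<in> B}"
  have T: "open T" "connected T" unfolding T_def
    using line_open_convex[OF B(1,2)] convex_connected by blast+
  have "{t. a + t *s v \<in> S} = (\<lambda>t. a + t *s v) -` S" by auto
  moreover have "continuous_on UNIV (\<lambda>t. a + t *s v)"
    by (intro continuous_at_imp_continuous_on ballI has_derivative_continuous[OF has_derivative_line])
  ultimately have oS: "open {t. a + t *s v \<in> S}" using open_vimage[OF S(1)] by metis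
  have 1: "1 \<in> T" "0 \<in> {t. a + t *s v \<in> S}" unfolding T_def v_def using z a by simp_all
  have ne: "{t. a + t *s v \<in> S} \<noteq> {}" using 1(2) by blast
  have "f (a + 1 *s v) = 0"
    by (rule analytic_continuation_open[OF oS T(1) ne T(2) _ holomorphic_sev_line_holomorphic[OF B(3)] holomorphic_on_const _ 1(1)])
      (use 1 S in \<open>auto simp: T_def\<close>)
  then show ?thesis by (simp add: v_def)
qed

text \<open>
  The order of vanishing at \<open>0\<close> is even on the left of \<open>g\<^sup>2 = a b\<^sup>2\<close> and odd on the right.
\<close>

lemma simple_zero_not_square_ratio:
  fixes a b g :: "complex \<Rightarrow> complex"
  assumes T: "open T" "connected T" "0 \<in> T"
    and hol: "a holomorphic_on T" "b holomorphic_on T" "g holomorphic_on T"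
    and eq: "\<And>t. t \<in> T \<Longrightarrow> g t * g t = a t * (b t * b t)"
    and a: "a 0 = 0" "deriv a 0 \<noteq> 0" and b: "t1 \<in> T" "b t1 \<noteq> 0"
  shows False
proof -
  have an: "a analytic_on {0}" "b analytic_on {0}" "g analytic_on {0}"
    using hol T(1,3) analytic_at by blast+
  have "\<exists>t2\<in>T. a t2 \<noteq> 0"
  proof (rule ccontr)
    assume "\<not> ?thesis"
    then have "(a has_field_derivative 0) (at 0)"
      by (intro has_field_derivative_transform_within_open[OF DERIV_const[of 0] T(1,3)]) auto
    then show False using a(2) DERIV_imp_deriv by blast
  qed
  then obtain t2 where t2: "t2 \<in> T" "a t2 \<noteq> 0" by blast
  have ea: "\<forall>\<^sub>F w in at 0. a w \<noteq> 0 \<and> w \<in> T" by (rule non_zero_neighbour_alt[OF hol(1) T t2])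
  have eb: "\<forall>\<^sub>F w in at 0. b w \<noteq> 0 \<and> w \<in> T" by (rule non_zero_neighbour_alt[OF hol(2) T b])
  have e1: "\<forall>\<^sub>F w in at 0. b w * b w \<noteq> 0" using eb by eventually_elim auto
  have e2: "\<forall>\<^sub>F w in at 0. a w * (b w * b w) \<noteq> 0" using ea eb by eventually_elim auto
  have e3: "\<forall>\<^sub>F w in at 0. g w * g w \<noteq> 0" using ea eb by eventually_elim (auto simp: eq)
  have "zorder a 0 = 1"
    by (rule zorder_zero_eqI[OF hol(1) T(1,3)]) (use a in auto)
  moreover have "zorder (\<lambda>w. a w * (b w * b w)) 0 = zorder a 0 + (zorder b 0 + zorder b 0)"
    using zorder_times_analytic[OF an(1) analytic_on_mult[OF an(2,2)] e2] zorder_times_analytic[OF an(2,2) e1] by simp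
  moreover have "zorder (\<lambda>w. g w * g w) 0 = zorder g 0 + zorder g 0"
    by (rule zorder_times_analytic[OF an(3,3) e3])
  moreover have "zorder (\<lambda>w. g w * g w) 0 = zorder (\<lambda>w. a w * (b w * b w)) 0"
    by (rule zorder_cong) (use eventually_at_in_open'[OF T(1,3)] in \<open>auto elim!: eventually_mono simp: eq\<close>)
  ultimately show False by presburger
qed

text \<open>
  The ratio is constant on a small ball avoiding the zeros of \<open>h\<close>; the identity theorem extends the
  relation \<open>g = c h\<close> across those zeros.
\<close>

lemma constant_ratio_of_zero_derivative:
  fixes g h :: "complex ^ 'n \<Rightarrow> complex"
  assumes B: "open B" "convex B" and gh: "holomorphic_sev g B" "holomorphic_sev h B"
    and z0: "z0 \<in> B" "h z0 \<noteq> 0"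
    and der: "\<And>z. z \<in> B \<Longrightarrow> h z \<noteq> 0 \<Longrightarrow> ((\<lambda>z. g z / h z) has_derivative (\<lambda>_. 0)) (at z)"
  shows "\<exists>c. \<forall>z\<in>B. g z = c * h z"
proof -
  have "open {z \<in> B. h z \<noteq> 0}"
  proof -
    have "{z \<in> B. h z \<noteq> 0} = B \<inter> h -` (- {0})" by auto
    moreover have "open (B \<inter> h -` (- {0}))"
      by (rule continuous_open_preimage[OF holomorphic_sev_continuous[OF gh(2)] B(1)]) auto
    ultimately show ?thesis by simp
  qed
  then obtain e where e: "e > 0" "ball z0 e \<subseteq> {z \<in> B. h z \<noteq> 0}" using z0 open_contains_ball by blast
  have "((\<lambda>z. g z / h z) has_derivative (\<lambda>_. 0)) (at z within ball z0 e)" if "z \<in> ball z0 e" for z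
    using der[of z] e(2) that has_derivative_at_withinI by blast
  then obtain c where c: "\<And>z. z \<in> ball z0 e \<Longrightarrow> g z / h z = c"
    using has_derivative_zero_constant[of "ball z0 e" "\<lambda>z. g z / h z"] by auto
  have "g z - c * h z = 0" if "z \<in> B" for z
  proof (rule holomorphic_sev_identity[OF B holomorphic_sev_diff_cmult[OF gh] open_ball _ _ _ that])
    show "ball z0 e \<subseteq> B" "ball z0 e \<noteq> {}" using e by auto
    fix w assume "w \<in> ball z0 e"
    then show "g w - c * h w = 0" using c[of w] e(2) by (auto simp: field_simps)
  qed
  then show ?thesis by auto
qed

text \<open>
  A single chart, with the properties that an atlas requires of each of its members.
\<close>

locale complex_chart =
  fixes M :: "'m topology" and U :: "'m set" and \<phi> :: "'m \<Rightarrow> complex ^ 'n"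
  assumes openU: "openin M U" and open_image: "open (\<phi> ` U)"
    and homeo: "homeomorphic_map (subtopology M U) (top_of_set (\<phi> ` U)) \<phi>"
begin

lemma topspace_U: "topspace (subtopology M U) = U"
  using openin_subset[OF openU] by auto

lemma inj: "inj_on \<phi> U"
  using homeomorphic_imp_injective_map[OF homeo] unfolding topspace_U .

lemma inv_chart: "y \<in> U \<Longrightarrow> inv_into U \<phi> (\<phi> y) = y" "z \<in> \<phi> ` U \<Longrightarrow> \<phi> (inv_into U \<phi> z) = z"
  "z \<in> \<phi> ` U \<Longrightarrow> inv_into U \<phi> z \<in> U"
  by (auto simp: inv_into_f_f[OF inj] f_inv_into_f inv_into_into)

lemma pull_open:
  assumes "open Q"
  shows "openin M {y \<in> U. \<phi> y \<in> Q}"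
proof -
  have "continuous_map (subtopology M U) (top_of_set (\<phi> ` U)) \<phi>" by (rule homeomorphic_imp_continuous_map[OF homeo])
  moreover have "openin (top_of_set (\<phi> ` U)) (\<phi> ` U \<inter> Q)" using assms by (rule openin_open_Int)
  ultimately have "openin (subtopology M U) {y \<in> topspace (subtopology M U). \<phi> y \<in> \<phi> ` U \<inter> Q}"
    by (rule openin_continuous_map_preimage)
  moreover have "{y \<in> topspace (subtopology M U). \<phi> y \<in> \<phi> ` U \<inter> Q} = {y \<in> U. \<phi> y \<in> Q}"
    unfolding topspace_U by auto
  ultimately show ?thesis using openin_open_subtopology[OF openU] by simp
qed

lemma push_open:
  assumes "openin M W"
  shows "open (\<phi> ` (U \<inter> W))"
proof -
  have "openin (subtopology M U) (U \<inter> W)"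
    using assms openU by (simp add: openin_open_subtopology openin_Int)
  then have "openin (top_of_set (\<phi> ` U)) (\<phi> ` (U \<inter> W))"
    using homeomorphic_imp_open_map[OF homeo] unfolding open_map_def by blast
  then show ?thesis using open_image openin_open_eq by blast
qed

end

lemma complex_manifold_chart:
  assumes "complex_manifold M \<A>" "x \<in> topspace M"
  obtains U \<phi> where "(U, \<phi>) \<in> \<A>" "x \<in> U" "complex_chart M U \<phi>"
proof -
  have "x \<in> (\<Union>(U, \<phi>)\<in>\<A>. U)" using assms unfolding complex_manifold_def by blast
  then obtain U \<phi> where U: "(U, \<phi>) \<in> \<A>" "x \<in> U" by auto
  moreover have "complex_chart M U \<phi>"
    using assms(1) U(1) unfolding complex_manifold_def complex_chart_def by blast
  ultimately show ?thesis using that by blast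
qed

lemma (in complex_chart) local_quotient:
  assumes A: "(U, \<phi>) \<in> \<A>" and f: "f \<in> meromorphic_reps M \<A>" and x: "x \<in> U"
  obtains Q g h where "open Q" "\<phi> x \<in> Q" "Q \<subseteq> \<phi> ` U" "holomorphic_sev g Q" "holomorphic_sev h Q"
    "\<And>Q'. open Q' \<Longrightarrow> Q' \<subseteq> Q \<Longrightarrow> Q' \<noteq> {} \<Longrightarrow> \<exists>z\<in>Q'. h z \<noteq> 0"
    "\<And>z. z \<in> Q \<Longrightarrow> h z \<noteq> 0 \<Longrightarrow> f (inv_into U \<phi> z) = g z / h z"
proof -
  have "x \<in> topspace M" using openin_subset[OF openU] x by blast
  from f[unfolded meromorphic_reps_def mem_Collect_eq, THEN bspec, OF this]
  obtain W g h where W: "openin M W" "x \<in> W" "holomorphic_mfd \<A> g W" "holomorphic_mfd \<A> h W"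
    "\<forall>W'. openin M W' \<and> W' \<subseteq> W \<and> W' \<noteq> {} \<longrightarrow> (\<exists>y\<in>W'. h y \<noteq> 0)"
    "\<forall>y\<in>W. h y \<noteq> 0 \<longrightarrow> f y = g y / h y"
    by (elim exE conjE)
  let ?Q = "\<phi> ` (U \<inter> W)" and ?i = "inv_into U \<phi>"
  show ?thesis
  proof (rule that[of ?Q "\<lambda>z. g (?i z)" "\<lambda>z. h (?i z)"])
    show "open ?Q" by (rule push_open[OF W(1)])
    show "\<phi> x \<in> ?Q" "?Q \<subseteq> \<phi> ` U" using x W(2) by auto
    show "holomorphic_sev (\<lambda>z. g (?i z)) ?Q" "holomorphic_sev (\<lambda>z. h (?i z)) ?Q"
      using W(3,4) A unfolding holomorphic_mfd_def by auto
    fix Q' assume Q': "open Q'" "Q' \<subseteq> ?Q" "Q' \<noteq> {}"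
    have "openin M {y \<in> U. \<phi> y \<in> Q'}" by (rule pull_open[OF Q'(1)])
    moreover have "{y \<in> U. \<phi> y \<in> Q'} \<subseteq> W"
    proof
      fix y assume y: "y \<in> {y \<in> U. \<phi> y \<in> Q'}"
      then obtain w where "w \<in> U \<inter> W" "\<phi> y = \<phi> w" using Q'(2) by auto
      then show "y \<in> W" using y inj by (auto dest: inj_onD)
    qed
    moreover have "{y \<in> U. \<phi> y \<in> Q'} \<noteq> {}" using Q'(2,3) by blast
    ultimately obtain y where "y \<in> U" "\<phi> y \<in> Q'" "h y \<noteq> 0" using W(5) by blast
    then show "\<exists>z\<in>Q'. h (?i z) \<noteq> 0" by (intro bexI[of _ "\<phi> y"]) (simp_all add: inv_chart)
  next
    fix z assume "z \<in> ?Q" "h (?i z) \<noteq> 0"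
    then show "f (?i z) = g (?i z) / h (?i z)" using W(6) by (auto simp: inv_chart)
  qed
qed

lemma meromorphic_reps_diff_const:
  assumes "f \<in> meromorphic_reps M \<A>"
  shows "(\<lambda>x. f x - c) \<in> meromorphic_reps M \<A>"
  unfolding meromorphic_reps_def mem_Collect_eq
proof
  fix x assume "x \<in> topspace M"
  from assms[unfolded meromorphic_reps_def mem_Collect_eq, THEN bspec, OF this]
  obtain W g h where W: "openin M W" "x \<in> W" "holomorphic_mfd \<A> g W" "holomorphic_mfd \<A> h W"
    "\<forall>W'. openin M W' \<and> W' \<subseteq> W \<and> W' \<noteq> {} \<longrightarrow> (\<exists>y\<in>W'. h y \<noteq> 0)"
    "\<forall>y\<in>W. h y \<noteq> 0 \<longrightarrow> f y = g y / h y" by (elim exE conjE)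
  have "holomorphic_mfd \<A> (\<lambda>x. g x - c * h x) W"
    using W(3,4) unfolding holomorphic_mfd_def by (auto intro: holomorphic_sev_diff_cmult)
  moreover have "\<forall>y\<in>W. h y \<noteq> 0 \<longrightarrow> f y - c = (g y - c * h y) / h y"
    using W(6) by (simp add: diff_divide_distrib)
  ultimately show "\<exists>W g h. openin M W \<and> x \<in> W \<and> holomorphic_mfd \<A> g W \<and> holomorphic_mfd \<A> h W \<and>
     (\<forall>W'. openin M W' \<and> W' \<subseteq> W \<and> W' \<noteq> {} \<longrightarrow> (\<exists>y\<in>W'. h y \<noteq> 0)) \<and>
     (\<forall>y\<in>W. h y \<noteq> 0 \<longrightarrow> f y - c = g y / h y)"
    using W by blast
qed

text \<open>
  Here \<open>E\<close> is a dense open part of the neighbourhood \<open>N\<close> of \<open>x\<close> on which \<open>f\<close> is constant.  The value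
  depends only on \<open>x\<close>, since two such dense open parts meet in every neighbourhood of \<open>x\<close>; it is
  locally constant in \<open>x\<close>, hence constant by connectedness.
\<close>

lemma locally_constant_imp_constant:
  assumes conn: "connected_space M" and f: "f \<in> meromorphic_reps M \<A>"
    and loc: "\<And>x. x \<in> topspace M \<Longrightarrow> \<exists>c N E. openin M N \<and> x \<in> N \<and> openin M E \<and> E \<subseteq> N \<and>
      (\<forall>y\<in>E. f y = c) \<and> (\<forall>W. openin M W \<and> W \<subseteq> N \<and> W \<noteq> {} \<longrightarrow> W \<inter> E \<noteq> {})"
  shows "\<exists>c. (\<lambda>x. f x - c) \<in> meromorphic_null M \<A>"
proof -
  define P where "P x c N E \<longleftrightarrow> openin M N \<and> x \<in> N \<and> openin M E \<and> E \<subseteq> N \<and>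
      (\<forall>y\<in>E. f y = c) \<and> (\<forall>W. openin M W \<and> W \<subseteq> N \<and> W \<noteq> {} \<longrightarrow> W \<inter> E \<noteq> {})" for x c N E
  define L where "L c = {x \<in> topspace M. \<exists>N E. P x c N E}" for c
  have cover: "x \<in> topspace M \<Longrightarrow> \<exists>c. x \<in> L c" for x
    using loc[of x] unfolding L_def P_def by auto
  have disj: "c = c'" if "x \<in> L c" "x \<in> L c'" for x c c'
  proof -
    obtain N E where P: "P x c N E" using \<open>x \<in> L c\<close> unfolding L_def by auto
    obtain N' E' where P': "P x c' N' E'" using \<open>x \<in> L c'\<close> unfolding L_def by auto
    have "openin M (N \<inter> N')" "x \<in> N \<inter> N'" using P P' unfolding P_def by auto
    then have ne: "(N \<inter> N') \<inter> E \<noteq> {}" using P unfolding P_def by blast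
    have "openin M ((N \<inter> N') \<inter> E)" using P P' unfolding P_def by auto
    then have "((N \<inter> N') \<inter> E) \<inter> E' \<noteq> {}" using P' ne unfolding P_def by blast
    then show ?thesis using P P' unfolding P_def by auto
  qed
  have op: "openin M (L c)" for c
  proof (subst openin_subopen, intro ballI)
    fix x assume "x \<in> L c"
    then obtain N E where P: "P x c N E" unfolding L_def by auto
    then have "P y c N E" if "y \<in> N" for y using that unfolding P_def by blast
    moreover have "openin M N" "x \<in> N" using P unfolding P_def by auto
    ultimately have "N \<subseteq> L c" using openin_subset unfolding L_def by blast
    then show "\<exists>T. openin M T \<and> x \<in> T \<and> T \<subseteq> L c" using \<open>openin M N\<close> \<open>x \<in> N\<close> by blast
  qed
  have sub: "L c \<subseteq> topspace M" for c by (auto simp: L_def)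
  have "\<exists>c. topspace M \<subseteq> L c"
  proof (cases "topspace M = {}")
    case False
    then obtain x0 c where c: "x0 \<in> L c" using cover by blast
    define R where "R = (\<Union>c'\<in>-{c}. L c')"
    have "openin M R" unfolding R_def using op by blast
    moreover have "topspace M \<subseteq> L c \<union> R" using cover unfolding R_def by blast
    moreover have "L c \<inter> R = {}" using disj unfolding R_def by auto
    ultimately have "R = {}" using conn op[of c] c unfolding connected_space_def by blast
    then show ?thesis using \<open>topspace M \<subseteq> L c \<union> R\<close> by blast
  qed auto
  then obtain c where c: "\<And>x. x \<in> topspace M \<Longrightarrow> x \<in> L c" by blast
  define D where "D = \<Union>{E. openin M E \<and> (\<forall>y\<in>E. f y = c)}"
  have "openin M D" unfolding D_def by (rule openin_Union) auto
  moreover have "M closure_of D = topspace M"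
  proof (rule antisym[OF closure_of_subset_topspace], rule subsetI)
    fix x assume x: "x \<in> topspace M"
    then obtain N E where P: "P x c N E" using c[OF x] unfolding L_def by blast
    have "\<exists>y. y \<in> D \<and> y \<in> T" if T: "x \<in> T" "openin M T" for T
    proof -
      have "openin M (N \<inter> T)" "N \<inter> T \<subseteq> N" "N \<inter> T \<noteq> {}" using P T unfolding P_def by auto
      then have "(N \<inter> T) \<inter> E \<noteq> {}" using P unfolding P_def by blast
      moreover have "E \<subseteq> D" using P unfolding D_def P_def by blast
      ultimately show ?thesis by blast
    qed
    then show "x \<in> M closure_of D" using x unfolding in_closure_of by blast
  qed
  moreover have "\<forall>x\<in>D. f x - c = 0" unfolding D_def by auto
  ultimately show ?thesis
    using meromorphic_reps_diff_const[OF f] unfolding meromorphic_null_def by blast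
qed

lemma open_nonzero_set: "open Q \<Longrightarrow> continuous_on Q h \<Longrightarrow> open {z \<in> Q. h z \<noteq> (0::complex)}"
proof -
  assume "open Q" "continuous_on Q h"
  moreover have "{z \<in> Q. h z \<noteq> 0} = Q \<inter> h -` (- {0})" by auto
  ultimately show ?thesis using continuous_open_preimage[of Q h "- {0}"] by auto
qed

text \<open>
  Otherwise the derivative of \<open>f\<close> vanishes wherever \<open>f\<close> is visibly holomorphic, so \<open>f\<close> is constant
  on a dense open part of a neighbourhood of each point.
\<close>

lemma exists_noncritical_point:
  assumes mfd: "complex_manifold M \<A>" and conn: "connected_space M" and f: "f \<in> meromorphic_reps M \<A>"
    and nc: "\<And>c. (\<lambda>x. f x - c) \<notin> meromorphic_null M \<A>"
  shows "\<exists>U \<phi> Q g h z D. (U, \<phi>) \<in> \<A> \<and> complex_chart M U \<phi> \<and> open Q \<and> Q \<subseteq> \<phi> ` U \<and>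
    holomorphic_sev g Q \<and> holomorphic_sev h Q \<and>
    (\<forall>z\<in>Q. h z \<noteq> 0 \<longrightarrow> f (inv_into U \<phi> z) = g z / h z) \<and> z \<in> Q \<and> h z \<noteq> 0 \<and>
    ((\<lambda>z. g z / h z) has_derivative D) (at z) \<and> (\<forall>c v. D (c *s v) = c * D v) \<and> D \<noteq> (\<lambda>_. 0)"
proof (rule ccontr)
  assume neg: "\<not> ?thesis"
  have "\<exists>c. (\<lambda>x. f x - c) \<in> meromorphic_null M \<A>"
  proof (rule locally_constant_imp_constant[OF conn f])
    fix x assume "x \<in> topspace M"
    then obtain U \<phi> where U: "(U, \<phi>) \<in> \<A>" "x \<in> U" "complex_chart M U \<phi>"
      using complex_manifold_chart[OF mfd] by metis
    interpret complex_chart M U \<phi> by (rule U(3))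
    obtain Q g h where Q: "open Q" "\<phi> x \<in> Q" "Q \<subseteq> \<phi> ` U" "holomorphic_sev g Q" "holomorphic_sev h Q"
      and dense: "\<And>Q'. open Q' \<Longrightarrow> Q' \<subseteq> Q \<Longrightarrow> Q' \<noteq> {} \<Longrightarrow> \<exists>z\<in>Q'. h z \<noteq> 0"
      and fq: "\<And>z. z \<in> Q \<Longrightarrow> h z \<noteq> 0 \<Longrightarrow> f (inv_into U \<phi> z) = g z / h z"
      by (rule local_quotient[OF U(1) f U(2)]) (rule that)
    obtain e where e: "e > 0" "ball (\<phi> x) e \<subseteq> Q" using Q(1,2) open_contains_ball by blast
    define B where "B = ball (\<phi> x) e"
    have B: "open B" "convex B" "B \<subseteq> Q" "B \<noteq> {}" "\<phi> x \<in> B" using e by (auto simp: B_def)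
    have gh: "holomorphic_sev g B" "holomorphic_sev h B" using Q(4,5) B(3) holomorphic_sev_mono by blast+
    obtain z0 where z0: "z0 \<in> B" "h z0 \<noteq> 0" using dense[OF B(1,3,4)] by blast
    have "((\<lambda>z. g z / h z) has_derivative (\<lambda>_. 0)) (at z)" if z: "z \<in> B" "h z \<noteq> 0" for z
    proof -
      have "holomorphic_sev (\<lambda>z. g z / h z) {z \<in> B. h z \<noteq> 0}"
        by (intro holomorphic_sev_divide holomorphic_sev_mono[OF gh(1)] holomorphic_sev_mono[OF gh(2)]) auto
      then obtain D where D: "((\<lambda>z. g z / h z) has_derivative D) (at z)" "\<forall>c v. D (c *s v) = c * D v"
        using z unfolding holomorphic_sev_def by blast
      have "z \<in> Q" using z(1) B(3) by blast
      have "D = (\<lambda>_. 0)"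
      proof (rule ccontr)
        assume nz: "D \<noteq> (\<lambda>_. 0)"
        have "\<forall>z\<in>Q. h z \<noteq> 0 \<longrightarrow> f (inv_into U \<phi> z) = g z / h z" using fq by blast
        then show False using U(1,3) Q(1,3-5) \<open>z \<in> Q\<close> z(2) D nz
          by - (rule notE[OF neg], intro exI conjI; assumption)
      qed
      then show ?thesis using D(1) by simp
    qed
    then obtain c where c: "\<And>z. z \<in> B \<Longrightarrow> g z = c * h z"
      using constant_ratio_of_zero_derivative[OF B(1,2) gh z0] by blast
    let ?N = "{y \<in> U. \<phi> y \<in> B}" and ?E = "{y \<in> U. \<phi> y \<in> {z \<in> B. h z \<noteq> 0}}"
    have "openin M ?N" by (rule pull_open[OF B(1)])
    moreover have "openin M ?E" by (rule pull_open[OF open_nonzero_set[OF B(1) holomorphic_sev_continuous[OF gh(2)]]])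
    moreover have "\<forall>y\<in>?E. f y = c"
    proof
      fix y assume y: "y \<in> ?E"
      then show "f y = c" using fq[of "\<phi> y"] c[of "\<phi> y"] B(3) by (auto simp: inv_chart)
    qed
    moreover have "\<forall>W. openin M W \<and> W \<subseteq> ?N \<and> W \<noteq> {} \<longrightarrow> W \<inter> ?E \<noteq> {}"
    proof (intro allI impI, elim conjE)
      fix W assume W: "openin M W" "W \<subseteq> ?N" "W \<noteq> {}"
      have "open (\<phi> ` (U \<inter> W))" "\<phi> ` (U \<inter> W) \<subseteq> Q" "\<phi> ` (U \<inter> W) \<noteq> {}"
        using push_open[OF W(1)] W(2,3) B(3) by auto
      from dense[OF this] show "W \<inter> ?E \<noteq> {}" using W(2) by auto
    qed
    moreover have "x \<in> ?N" "?E \<subseteq> ?N" using U(2) B(5) by auto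
    ultimately show "\<exists>c N E. openin M N \<and> x \<in> N \<and> openin M E \<and> E \<subseteq> N \<and>
      (\<forall>y\<in>E. f y = c) \<and> (\<forall>W. openin M W \<and> W \<subseteq> N \<and> W \<noteq> {} \<longrightarrow> W \<inter> E \<noteq> {})"
      by (intro exI[of _ c] exI[of _ ?N] exI[of _ ?E] conjI)
  qed
  then show False using nc by blast
qed

text \<open>
  At the noncritical point \<open>z0\<close> the function \<open>f - c\<close> has a simple zero in every direction \<open>v\<close> with
  \<open>D v \<noteq> 0\<close>.  A square root \<open>g2 / h2\<close> would give \<open>g2\<^sup>2 = (f - c) h2\<^sup>2\<close> near \<open>z0\<close>, which is impossible
  on a line in such a direction on which \<open>h2\<close> does not vanish identically.
\<close>

theorem meromorphic_nonsquare:
  assumes mfd: "complex_manifold M \<A>" and conn: "connected_space M" and adm: "admits_nonconstant_meromorphic M \<A>"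
    and iso: "field_of k \<simeq> meromorphic_field M \<A>"
  shows "\<exists>d\<in>k. \<not> square_in k d"
proof -
  obtain f where f: "f \<in> meromorphic_reps M \<A>" "\<And>c. (\<lambda>x. f x - c) \<notin> meromorphic_null M \<A>"
    using adm unfolding admits_nonconstant_meromorphic_def by blast
  from exists_noncritical_point[OF mfd conn f] obtain U \<phi> Q g h z0 D where
    U: "(U, \<phi>) \<in> \<A>" "complex_chart M U \<phi>" and Q: "open Q" "Q \<subseteq> \<phi> ` U" "holomorphic_sev g Q" "holomorphic_sev h Q"
    and fq: "\<forall>z\<in>Q. h z \<noteq> 0 \<longrightarrow> f (inv_into U \<phi> z) = g z / h z" and z0: "z0 \<in> Q" "h z0 \<noteq> 0"
    and D: "((\<lambda>z. g z / h z) has_derivative D) (at z0)" "\<forall>c v. D (c *s v) = c * D v" "D \<noteq> (\<lambda>_. 0)"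
    by (elim exE conjE)
  interpret complex_chart M U \<phi> by (rule U(2))
  define c where "c = g z0 / h z0"
  let ?F = "\<lambda>z. g z / h z"
  show ?thesis
  proof (rule nonsquare_via_quotient[OF iso[unfolded meromorphic_field_def]])
    show "(\<lambda>x. f x - c) \<in> meromorphic_reps M \<A>" by (rule meromorphic_reps_diff_const[OF f(1)])
    have one: "holomorphic_sev (\<lambda>z. a) S" for a :: complex and S :: "(complex ^ 'b) set"
      unfolding holomorphic_sev_def by (intro ballI exI[of _ "\<lambda>_. 0"]) auto
    have "(\<lambda>_. 0) \<in> meromorphic_reps M \<A>"
      unfolding meromorphic_reps_def mem_Collect_eq
      by (intro ballI exI[of _ "topspace M"] exI[of _ "\<lambda>_. 0"] exI[of _ "\<lambda>_. 1"]) (auto simp: holomorphic_mfd_def one)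
    then show "(\<lambda>_. 0) \<in> meromorphic_null M \<A>"
      unfolding meromorphic_null_def by (auto intro!: exI[of _ "topspace M"])
    fix r assume r: "r \<in> meromorphic_reps M \<A>"
    show "(\<lambda>x. r x * r x - (f x - c)) \<notin> meromorphic_null M \<A>"
    proof
      assume "(\<lambda>x. r x * r x - (f x - c)) \<in> meromorphic_null M \<A>"
      then obtain E where E: "openin M E" "M closure_of E = topspace M" "\<And>x. x \<in> E \<Longrightarrow> r x * r x = f x - c"
        unfolding meromorphic_null_def by auto
      have z0U: "inv_into U \<phi> z0 \<in> U" "\<phi> (inv_into U \<phi> z0) = z0" using z0(1) Q(2) by (auto simp: inv_chart)
      obtain Q2 g2 h2 where Q2: "open Q2" "z0 \<in> Q2" "Q2 \<subseteq> \<phi> ` U" "holomorphic_sev g2 Q2" "holomorphic_sev h2 Q2"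
        and dense: "\<And>Q'. open Q' \<Longrightarrow> Q' \<subseteq> Q2 \<Longrightarrow> Q' \<noteq> {} \<Longrightarrow> \<exists>z\<in>Q'. h2 z \<noteq> 0"
        and rq: "\<And>z. z \<in> Q2 \<Longrightarrow> h2 z \<noteq> 0 \<Longrightarrow> r (inv_into U \<phi> z) = g2 z / h2 z"
        by (rule local_quotient[OF U(1) r z0U(1), unfolded z0U(2)]) (rule that)
      have "open (Q2 \<inter> {z \<in> Q. h z \<noteq> 0})"
        by (intro open_Int Q2(1) open_nonzero_set Q(1) holomorphic_sev_continuous[OF Q(4)])
      then obtain e where e: "e > 0" "ball z0 e \<subseteq> Q2 \<inter> {z \<in> Q. h z \<noteq> 0}"
        using z0 Q2(2) open_contains_ball by blast
      define B where "B = ball z0 e"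
      have B: "open B" "convex B" "z0 \<in> B" "B \<subseteq> Q2" "B \<subseteq> Q" "\<And>z. z \<in> B \<Longrightarrow> h z \<noteq> 0"
        using e by (auto simp: B_def)
      have hol: "holomorphic_sev ?F B" "holomorphic_sev g2 B" "holomorphic_sev h2 B"
        using B(4-6) Q(3,4) Q2(4,5) by (auto intro!: holomorphic_sev_divide intro: holomorphic_sev_mono)
      have eq: "g2 z * g2 z = (?F z - c) * (h2 z * h2 z)" if z: "z \<in> B" for z
      proof (rule ccontr)
        define K where "K z = g2 z * g2 z - (?F z - c) * (h2 z * h2 z)" for z
        assume "\<not> ?thesis"
        then have "K z \<noteq> 0" by (simp add: K_def)
        have "continuous_on B K"
          unfolding K_def by (intro continuous_intros holomorphic_sev_continuous[OF hol(1)]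
              holomorphic_sev_continuous[OF hol(2)] holomorphic_sev_continuous[OF hol(3)])
        then have o1: "open {z \<in> B. K z \<noteq> 0}" by (rule open_nonzero_set[OF B(1)])
        define Q3 where "Q3 = {w \<in> {z \<in> B. K z \<noteq> 0}. h2 w \<noteq> 0}"
        have "open Q3" unfolding Q3_def
          by (rule open_nonzero_set[OF o1], rule continuous_on_subset[OF holomorphic_sev_continuous[OF hol(3)]]) auto
        have "\<exists>w\<in>{z \<in> B. K z \<noteq> 0}. h2 w \<noteq> 0"
          by (rule dense[OF o1]) (use B(4) z \<open>K z \<noteq> 0\<close> in auto)
        then obtain w where w: "w \<in> Q3" unfolding Q3_def by blast
        have oQ3: "openin M {y \<in> U. \<phi> y \<in> Q3}" by (rule pull_open[OF \<open>open Q3\<close>])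
        have "w \<in> \<phi> ` U" using w B(4) Q2(3) unfolding Q3_def by blast
        then obtain y0 where y0: "y0 \<in> U" "\<phi> y0 = w" by blast
        have "y0 \<in> M closure_of E" using E(2) openin_subset[OF openU] y0(1) by blast
        then have near: "\<forall>T. y0 \<in> T \<and> openin M T \<longrightarrow> (\<exists>y. y \<in> E \<and> y \<in> T)" unfolding in_closure_of by (rule conjunct2)
        have "y0 \<in> {y \<in> U. \<phi> y \<in> Q3}" using y0 w by simp
        from near[THEN spec, THEN mp, OF conjI[OF this oQ3]]
        obtain y where y: "y \<in> E" "y \<in> U" "\<phi> y \<in> Q3" by blast
        have "\<phi> y \<in> B" "h2 (\<phi> y) \<noteq> 0" "K (\<phi> y) \<noteq> 0" using y(3) unfolding Q3_def by auto
        then have "r y = g2 (\<phi> y) / h2 (\<phi> y)" "f y = ?F (\<phi> y)"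
          using rq[of "\<phi> y"] fq[rule_format, of "\<phi> y"] B(4-6) y(2) by (auto simp: inv_chart)
        then have "(g2 (\<phi> y) / h2 (\<phi> y)) * (g2 (\<phi> y) / h2 (\<phi> y)) = ?F (\<phi> y) - c" using E(3)[OF y(1)] by simp
        then have "K (\<phi> y) = 0" using \<open>h2 (\<phi> y) \<noteq> 0\<close> unfolding K_def by (simp add: divide_eq_eq)
        then show False using \<open>K (\<phi> y) \<noteq> 0\<close> by simp
      qed
      obtain v0 where v0: "D v0 \<noteq> 0" using D(3) by auto
      have linD: "bounded_linear D" using D(1) by (rule has_derivative_bounded_linear)
      define Q4 where "Q4 = {z \<in> B. D (z - z0) \<noteq> 0}"
      have "open Q4" unfolding Q4_def
        by (rule open_nonzero_set[OF B(1)]) (intro bounded_linear.continuous_on[OF linD] continuous_intros)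
      moreover have "Q4 \<noteq> {}"
      proof -
        have nv: "v0 \<noteq> 0" using v0 linD by (auto simp: linear_simps)
        define \<delta> where "\<delta> = e / (2 * norm v0)"
        have "\<delta> > 0" "norm (\<delta> *\<^sub>R v0) < e" using e(1) nv by (auto simp: \<delta>_def)
        then have "z0 + \<delta> *\<^sub>R v0 \<in> Q4"
          using v0 linD unfolding Q4_def B_def by (auto simp: dist_norm linear_simps)
        then show ?thesis by blast
      qed
      ultimately obtain z1 where z1: "z1 \<in> Q4" "h2 z1 \<noteq> 0"
        using dense[of Q4] B(4) unfolding Q4_def by blast
      define v where "v = z1 - z0"
      define T where "T = {t. z0 + t *s v \<in> B}"
      have T: "open T" "connected T" unfolding T_def
        by (rule line_open_convex[OF B(1,2)], rule convex_connected[OF line_open_convex(2)[OF B(1,2)]])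
      have T01: "0 \<in> T" "1 \<in> T" using B(3) z1(1) by (simp_all add: T_def v_def Q4_def)
      have holT: "(\<lambda>t. F (z0 + t *s v)) holomorphic_on T" if "holomorphic_sev F B" for F
        by (rule holomorphic_sev_line_holomorphic[OF that]) (simp add: T_def)
      have d: "((\<lambda>t. ?F (z0 + t *s v)) has_field_derivative D v) (at 0)"
        using holomorphic_sev_line[of ?F D z0 0 v] D(1,2) by simp
      show False
      proof (rule simple_zero_not_square_ratio[OF T T01(1), of "\<lambda>t. ?F (z0 + t *s v) - c" "\<lambda>t. h2 (z0 + t *s v)" "\<lambda>t. g2 (z0 + t *s v)" 1])
        show "(\<lambda>t. ?F (z0 + t *s v) - c) holomorphic_on T" by (intro holomorphic_on_diff holT hol(1) holomorphic_on_const)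
        show "(\<lambda>t. h2 (z0 + t *s v)) holomorphic_on T" "(\<lambda>t. g2 (z0 + t *s v)) holomorphic_on T"
          by (intro holT hol)+
        show "g2 (z0 + t *s v) * g2 (z0 + t *s v) = (?F (z0 + t *s v) - c) * (h2 (z0 + t *s v) * h2 (z0 + t *s v))" if "t \<in> T" for t
          using eq[of "z0 + t *s v"] that by (simp add: T_def)
        show "?F (z0 + 0 *s v) - c = 0" by (simp add: c_def)
        have "((\<lambda>t. ?F (z0 + t *s v) - c) has_field_derivative D v - 0) (at 0)"
          by (intro DERIV_diff d DERIV_const)
        then show "deriv (\<lambda>t. ?F (z0 + t *s v) - c) 0 \<noteq> 0"
          using z1(1) by (simp add: DERIV_imp_deriv v_def Q4_def)
        show "1 \<in> T" by (rule T01(2))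
        show "h2 (z0 + 1 *s v) \<noteq> 0" using z1(2) by (simp add: v_def)
      qed
    qed
  qed
qed

section \<open>Polynomial functions, gradients and conjugation\<close>

lemma poly_eqI_char_0:
  fixes p q :: "'a::field_char_0 poly"
  assumes "\<And>t. t \<noteq> 0 \<Longrightarrow> poly p t = poly q t"
  shows "p = q"
proof -
  have "poly ([:0, 1:] * (p - q)) t = poly 0 t" for t
    using assms[of t] by (cases "t = 0") auto
  then have "[:0, 1:] * (p - q) = 0" by (metis poly_eq_poly_eq_iff ext)
  then show ?thesis by simp
qed

lemma poly_fun_compose:
  assumes "f \<in> poly_fun K m" "\<And>i. i < m \<Longrightarrow> g i \<in> poly_fun K n"
  shows "(\<lambda>x. f (Matrix.vec m (\<lambda>i. g i x))) \<in> poly_fun K n"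
  using assms(1)
proof (induction rule: poly_fun.induct)
  case (coord i)
  then show ?case using assms(2)[of i] by simp
qed (auto intro: poly_fun.intros)

lemma poly_fun_mono: "f \<in> poly_fun K n \<Longrightarrow> K \<subseteq> L \<Longrightarrow> f \<in> poly_fun L n"
  by (induction rule: poly_fun.induct) (auto intro: poly_fun.intros)

text \<open>
  Polynomial functions are handled through their restrictions to polynomial curves, where degrees,
  coefficients and the uniqueness of the representing polynomial are available.
\<close>

lemma poly_fun_along_curve:
  fixes c :: "nat \<Rightarrow> 'a::field poly"
  assumes "f \<in> poly_fun K n"
  shows "\<exists>P. \<forall>t. f (Matrix.vec n (\<lambda>i. poly (c i) t)) = poly P t"
  using assms
proof (induction rule: poly_fun.induct)
  case (const a)
  show ?case by (rule exI[of _ "[:a:]"]) simp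
next
  case (coord i)
  then show ?case by (intro exI[of _ "c i"]) simp
next
  case (add f g)
  then obtain P Q where "\<forall>t. f (Matrix.vec n (\<lambda>i. poly (c i) t)) = poly P t"
    "\<forall>t. g (Matrix.vec n (\<lambda>i. poly (c i) t)) = poly Q t" by blast
  then show ?case by (intro exI[of _ "P + Q"]) simp
next
  case (mult f g)
  then obtain P Q where "\<forall>t. f (Matrix.vec n (\<lambda>i. poly (c i) t)) = poly P t"
    "\<forall>t. g (Matrix.vec n (\<lambda>i. poly (c i) t)) = poly Q t" by blast
  then show ?case by (intro exI[of _ "P * Q"]) simp
qed

lemma poly_fun_closed:
  assumes "sub_field K" "f \<in> poly_fun K n" "\<And>i. i < n \<Longrightarrow> x $ i \<in> K"
  shows "f x \<in> K"
  using assms(2)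
  by (induction rule: poly_fun.induct) (auto intro: assms(3) sub_field.add[OF assms(1)] sub_field.mult[OF assms(1)])

text \<open>
  The chain rule along polynomial curves is taken as the definition of a gradient; it needs only the
  coefficient of degree one of the composite.
\<close>

definition gradient_of :: "nat \<Rightarrow> ('a::field Matrix.vec \<Rightarrow> 'a) \<Rightarrow> (nat \<Rightarrow> 'a Matrix.vec \<Rightarrow> 'a) \<Rightarrow> bool" where
  "gradient_of n f G \<longleftrightarrow> (\<forall>c P. (\<forall>t. f (Matrix.vec n (\<lambda>i. poly (c i) t)) = poly P t) \<longrightarrow>
     poly.coeff P 1 = (\<Sum>i<n. G i (Matrix.vec n (\<lambda>i. poly (c i) 0)) * poly.coeff (c i) 1))"

lemma gradient_ofD:
  assumes "gradient_of n f G" "\<And>t. f (Matrix.vec n (\<lambda>i. poly (c i) t)) = poly P t"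
  shows "poly.coeff P 1 = (\<Sum>i<n. G i (Matrix.vec n (\<lambda>i. poly (c i) 0)) * poly.coeff (c i) 1)"
  using assms unfolding gradient_of_def by blast

lemma poly_coeff_1_mult:
  fixes P Q :: "'a::field poly"
  shows "poly.coeff (P * Q) 1 = poly P 0 * poly.coeff Q 1 + poly.coeff P 1 * poly Q 0"
  by (simp add: coeff_mult poly_0_coeff_0)

lemma poly_fun_gradient:
  fixes K :: "'a::field_char_0 set"
  assumes K: "sub_field K" and "f \<in> poly_fun K n"
  shows "\<exists>G. (\<forall>i<n. G i \<in> poly_fun K n) \<and> gradient_of n f G"
  using assms(2)
proof (induction rule: poly_fun.induct)
  case (const a)
  have "gradient_of n (\<lambda>_. a) (\<lambda>_ _. 0)"
    unfolding gradient_of_def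
  proof (intro allI impI)
    fix c :: "nat \<Rightarrow> 'a poly" and P assume "\<forall>t. a = poly P t"
    then have "poly P = poly [:a:]" by auto
    then have "P = [:a:]" by (simp only: poly_eq_poly_eq_iff)
    then show "poly.coeff P 1 = (\<Sum>i<n. 0 * poly.coeff (c i) 1)" by simp
  qed
  moreover have "(\<lambda>_. 0) \<in> poly_fun K n" using sub_field.zero[OF K] by (rule poly_fun.const)
  ultimately show ?case by (intro exI[of _ "\<lambda>_ _. 0"]) auto
next
  case (coord j)
  have "gradient_of n (\<lambda>x :: 'a Matrix.vec. x $ j) (\<lambda>i _. if i = j then 1 else 0)"
    unfolding gradient_of_def
  proof (intro allI impI)
    fix c :: "nat \<Rightarrow> 'a poly" and P assume "\<forall>t. Matrix.vec n (\<lambda>i. poly (c i) t) $ j = poly P t"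
    then have "poly (c j) = poly P" using coord by auto
    then have "P = c j" by (simp only: poly_eq_poly_eq_iff)
    then show "poly.coeff P 1 = (\<Sum>i<n. (if i = j then 1 else 0) * poly.coeff (c i) 1)"
      using coord by (simp add: if_distrib[of "\<lambda>a. a * _"] cong: if_cong)
  qed
  moreover have "(\<lambda>_. if i = j then 1 else 0) \<in> poly_fun K n" for i
    using sub_field.zero[OF K] sub_field.one[OF K] by (intro poly_fun.const) auto
  ultimately show ?case by (intro exI[of _ "\<lambda>i _. if i = j then 1 else 0"]) auto
next
  case (add f g)
  then obtain G H where G: "\<forall>i<n. G i \<in> poly_fun K n" "gradient_of n f G"
    and H: "\<forall>i<n. H i \<in> poly_fun K n" "gradient_of n g H" by blast
  have "gradient_of n (\<lambda>x. f x + g x) (\<lambda>i x. G i x + H i x)"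
    unfolding gradient_of_def
  proof (intro allI impI)
    fix c :: "nat \<Rightarrow> 'a poly" and P
    assume P: "\<forall>t. f (Matrix.vec n (\<lambda>i. poly (c i) t)) + g (Matrix.vec n (\<lambda>i. poly (c i) t)) = poly P t"
    obtain Q R where QR: "\<And>t. f (Matrix.vec n (\<lambda>i. poly (c i) t)) = poly Q t"
      "\<And>t. g (Matrix.vec n (\<lambda>i. poly (c i) t)) = poly R t"
      using poly_fun_along_curve add(1,2) by metis
    have "poly P = poly (Q + R)" using P QR by auto
    then have "P = Q + R" by (simp only: poly_eq_poly_eq_iff)
    then show "poly.coeff P 1 = (\<Sum>i<n. (G i (Matrix.vec n (\<lambda>i. poly (c i) 0)) + H i (Matrix.vec n (\<lambda>i. poly (c i) 0))) * poly.coeff (c i) 1)"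
      using gradient_ofD[OF G(2) QR(1)] gradient_ofD[OF H(2) QR(2)] by (simp add: sum.distrib algebra_simps)
  qed
  moreover have "(\<lambda>x. G i x + H i x) \<in> poly_fun K n" if "i < n" for i
    using G H that by (intro poly_fun.add) auto
  ultimately show ?case by (intro exI[of _ "\<lambda>i x. G i x + H i x"]) auto
next
  case (mult f g)
  then obtain G H where G: "\<forall>i<n. G i \<in> poly_fun K n" "gradient_of n f G"
    and H: "\<forall>i<n. H i \<in> poly_fun K n" "gradient_of n g H" by blast
  have "gradient_of n (\<lambda>x. f x * g x) (\<lambda>i x. f x * H i x + G i x * g x)"
    unfolding gradient_of_def
  proof (intro allI impI)
    fix c :: "nat \<Rightarrow> 'a poly" and P
    assume P: "\<forall>t. f (Matrix.vec n (\<lambda>i. poly (c i) t)) * g (Matrix.vec n (\<lambda>i. poly (c i) t)) = poly P t"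
    obtain Q R where QR: "\<And>t. f (Matrix.vec n (\<lambda>i. poly (c i) t)) = poly Q t"
      "\<And>t. g (Matrix.vec n (\<lambda>i. poly (c i) t)) = poly R t"
      using poly_fun_along_curve mult(1,2) by metis
    have "poly P = poly (Q * R)" using P QR by auto
    then have "P = Q * R" by (simp only: poly_eq_poly_eq_iff)
    then show "poly.coeff P 1 = (\<Sum>i<n. (f (Matrix.vec n (\<lambda>i. poly (c i) 0)) * H i (Matrix.vec n (\<lambda>i. poly (c i) 0)) + G i (Matrix.vec n (\<lambda>i. poly (c i) 0)) * g (Matrix.vec n (\<lambda>i. poly (c i) 0))) * poly.coeff (c i) 1)"
      unfolding QR \<open>P = Q * R\<close> poly_coeff_1_mult gradient_ofD[OF G(2) QR(1)] gradient_ofD[OF H(2) QR(2)]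
      unfolding sum_distrib_left sum_distrib_right sum.distrib[symmetric]
      by (intro sum.cong refl) (simp add: algebra_simps)
  qed
  moreover have "(\<lambda>x. f x * H i x + G i x * g x) \<in> poly_fun K n" if "i < n" for i
    using G H that mult(1,2) by (intro poly_fun.add poly_fun.mult) auto
  ultimately show ?case by (intro exI[of _ "\<lambda>i x. f x * H i x + G i x * g x"]) auto
qed

locale quadratic = sub_field k for k :: "'a::{alg_closed_field, field_char_0} set" +
  fixes s :: 'a
  assumes s_notin: "s \<notin> k" and s_square: "s\<^sup>2 \<in> k"
begin

abbreviation "d \<equiv> s\<^sup>2"

lemma s_nonzero: "s \<noteq> 0" using s_notin zero by auto

lemma combination_eq_0: "a \<in> k \<Longrightarrow> b \<in> k \<Longrightarrow> a + s * b = 0 \<Longrightarrow> b = 0 \<and> a = 0"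
proof -
  assume ab: "a \<in> k" "b \<in> k" "a + s * b = 0"
  have "b = 0"
  proof (rule ccontr)
    assume "b \<noteq> 0"
    then have "s = - a / b" using ab by (simp add: field_simps eq_neg_iff_add_eq_0)
    then show False using ab s_notin divide uminus by metis
  qed
  then show ?thesis using ab by simp
qed

text \<open>
  \<open>P\<close> and \<open>P'\<close> have coefficients in \<open>k(s)\<close> and are exchanged by the conjugation \<open>s \<mapsto> -s\<close>.  As a
  relation this makes sense without extending the conjugation to the ambient field.
\<close>

definition conj_pair :: "'a poly \<Rightarrow> 'a poly \<Rightarrow> bool" where
  "conj_pair P P' \<longleftrightarrow> (\<exists>A\<in>poly_over k. \<exists>B\<in>poly_over k.
     P = A + Polynomial.smult s B \<and> P' = A - Polynomial.smult s B)"

lemma conj_pair_base: "P \<in> poly_over k \<Longrightarrow> conj_pair P P"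
  unfolding conj_pair_def by (rule bexI[of _ P], rule bexI[of _ 0]) auto

lemma conj_pair_s: "conj_pair [:s:] [:- s:]"
  unfolding conj_pair_def
  by (rule bexI[of _ 0], rule bexI[of _ "[:1:]"]) (auto intro: one)

lemma conj_pair_add: "conj_pair P P' \<Longrightarrow> conj_pair Q Q' \<Longrightarrow> conj_pair (P + Q) (P' + Q')"
proof -
  assume "conj_pair P P'" "conj_pair Q Q'"
  then obtain A B C D where *: "A \<in> poly_over k" "B \<in> poly_over k" "C \<in> poly_over k" "D \<in> poly_over k"
    "P = A + Polynomial.smult s B" "P' = A - Polynomial.smult s B"
    "Q = C + Polynomial.smult s D" "Q' = C - Polynomial.smult s D" unfolding conj_pair_def by blast
  then show ?thesis unfolding conj_pair_def
    by (intro bexI[of _ "A + C"] bexI[of _ "B + D"]) (auto simp: smult_add_right)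
qed

lemma conj_pair_mult: "conj_pair P P' \<Longrightarrow> conj_pair Q Q' \<Longrightarrow> conj_pair (P * Q) (P' * Q')"
proof -
  assume "conj_pair P P'" "conj_pair Q Q'"
  then obtain A B C D where *: "A \<in> poly_over k" "B \<in> poly_over k" "C \<in> poly_over k" "D \<in> poly_over k"
    "P = A + Polynomial.smult s B" "P' = A - Polynomial.smult s B"
    "Q = C + Polynomial.smult s D" "Q' = C - Polynomial.smult s D" unfolding conj_pair_def by blast
  have "P * Q = (A * C + Polynomial.smult d (B * D)) + Polynomial.smult s (A * D + B * C)"
    "P' * Q' = (A * C + Polynomial.smult d (B * D)) - Polynomial.smult s (A * D + B * C)"
    unfolding *(5-8) by (simp_all add: algebra_simps smult_add_right power2_eq_square)
  then show ?thesis unfolding conj_pair_def using * s_square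
    by (intro bexI[of _ "A * C + Polynomial.smult d (B * D)"] bexI[of _ "A * D + B * C"]) auto
qed

lemma conj_pair_coeff_0_iff:
  assumes "conj_pair P P'"
  shows "poly.coeff P i = 0 \<longleftrightarrow> poly.coeff P' i = 0"
proof -
  obtain A B where *: "A \<in> poly_over k" "B \<in> poly_over k"
    "P = A + Polynomial.smult s B" "P' = A - Polynomial.smult s B"
    using assms unfolding conj_pair_def by blast
  have "poly.coeff A i \<in> k" "poly.coeff B i \<in> k" "- poly.coeff B i \<in> k" using * uminus by (auto simp: poly_over_def)
  then show ?thesis
    using combination_eq_0[of "poly.coeff A i" "poly.coeff B i"]
      combination_eq_0[of "poly.coeff A i" "- poly.coeff B i"] * by auto
qed

lemma conj_pair_degree: "conj_pair P P' \<Longrightarrow> Polynomial.degree P = Polynomial.degree P'"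
  using conj_pair_coeff_0_iff[of P P'] unfolding Polynomial.degree_def by simp

lemma conj_pair_0_iff: "conj_pair P P' \<Longrightarrow> P = 0 \<longleftrightarrow> P' = 0"
  using conj_pair_coeff_0_iff[of P P'] by (simp add: poly_eq_iff)

lemma conj_pair_inverse: "conj_pair [:1 / (2 * s):] [:- 1 / (2 * s):]"
proof -
  have "1 / (2 * s) = s * (1 / (2 * d))" using s_nonzero by (simp add: field_simps power2_eq_square)
  moreover have "1 / (2 * d) \<in> k" using s_square by (intro divide mult numeral one)
  then have "conj_pair ([:s:] * [:1 / (2 * d):]) ([:- s:] * [:1 / (2 * d):])"
    by (intro conj_pair_mult conj_pair_s conj_pair_base poly_over_const)
  ultimately show ?thesis by simp
qed

text \<open>
  A polynomial function over \<open>k\<close> commutes with conjugation.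
\<close>

lemma poly_fun_along_conj_pair:
  assumes "f \<in> poly_fun k n" "\<And>i. i < n \<Longrightarrow> conj_pair (c i) (c' i)"
  shows "\<exists>P P'. conj_pair P P' \<and> (\<forall>t. f (Matrix.vec n (\<lambda>i. poly (c i) t)) = poly P t) \<and>
    (\<forall>t. f (Matrix.vec n (\<lambda>i. poly (c' i) t)) = poly P' t)"
  using assms(1)
proof (induction rule: poly_fun.induct)
  case (const a)
  then show ?case using conj_pair_base[of "[:a:]"] by (intro exI[of _ "[:a:]"]) auto
next
  case (coord i)
  then show ?case using assms(2)[of i] by (intro exI[of _ "c i"] exI[of _ "c' i"]) auto
next
  case (add f g)
  then obtain P P' Q Q' where "conj_pair P P'" "conj_pair Q Q'"
    "\<forall>t. f (Matrix.vec n (\<lambda>i. poly (c i) t)) = poly P t" "\<forall>t. f (Matrix.vec n (\<lambda>i. poly (c' i) t)) = poly P' t"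
    "\<forall>t. g (Matrix.vec n (\<lambda>i. poly (c i) t)) = poly Q t" "\<forall>t. g (Matrix.vec n (\<lambda>i. poly (c' i) t)) = poly Q' t"
    by blast
  then show ?case by (intro exI[of _ "P + Q"] exI[of _ "P' + Q'"]) (auto intro: conj_pair_add)
next
  case (mult f g)
  then obtain P P' Q Q' where "conj_pair P P'" "conj_pair Q Q'"
    "\<forall>t. f (Matrix.vec n (\<lambda>i. poly (c i) t)) = poly P t" "\<forall>t. f (Matrix.vec n (\<lambda>i. poly (c' i) t)) = poly P' t"
    "\<forall>t. g (Matrix.vec n (\<lambda>i. poly (c i) t)) = poly Q t" "\<forall>t. g (Matrix.vec n (\<lambda>i. poly (c' i) t)) = poly Q' t"
    by blast
  then show ?case by (intro exI[of _ "P * Q"] exI[of _ "P' * Q'"]) (auto intro: conj_pair_mult)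
qed

end

section \<open>Rigidity of equivariant embeddings\<close>

lemma sum_lessThan_4: "(\<Sum>i<4. f i) = f 0 + f 1 + f 2 + f (3::nat)" for f :: "nat \<Rightarrow> 'a::comm_monoid_add"
  by (simp add: eval_nat_numeral add.assoc)

lemma eq_uminus_imp_0:
  fixes x :: "'a::field_char_0"
  assumes "x = - x" shows "x = 0"
proof -
  have "2 * x = x + x" by (rule mult_2)
  also have "\<dots> = 0" by (subst (2) assms) (rule add.right_inverse)
  finally show ?thesis by simp
qed

context quadratic
begin

text \<open>
  The point of affine four-space with weight coordinates \<open>x, y, U, U'\<close>: the first two components are
  those of the pair \<open>x = z\<^sub>1 + s z\<^sub>2\<close>, \<open>y = z\<^sub>1 - s z\<^sub>2\<close>, and similarly for the last two.
\<close>

definition pt :: "'a \<Rightarrow> 'a \<Rightarrow> 'a \<Rightarrow> 'a \<Rightarrow> 'a Matrix.vec" where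
  "pt x y U V = Matrix.vec 4 (\<lambda>i. [(x + y) / 2, (x - y) / (2 * s), (U + V) / 2, (U - V) / (2 * s)] ! i)"

lemma pt_carrier [simp]: "pt x y U V \<in> carrier_vec 4"
  by (simp add: pt_def)

lemma pt_nth: "pt x y U V $ 0 = (x + y) / 2" "pt x y U V $ 1 = (x - y) / (2 * s)"
  "pt x y U V $ 2 = (U + V) / 2" "pt x y U V $ 3 = (U - V) / (2 * s)"
  by (simp_all add: pt_def)

lemma pt_eq: "v \<in> carrier_vec 4 \<Longrightarrow> v = pt (v $ 0 + s * v $ 1) (v $ 0 - s * v $ 1) (v $ 2 + s * v $ 3) (v $ 2 - s * v $ 3)"
  using s_nonzero
  by (intro eq_vecI) (auto simp: pt_def eval_nat_numeral less_Suc_eq)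

lemma pt_pairs: "pt x y U V $ 0 + s * pt x y U V $ 1 = x" "pt x y U V $ 0 - s * pt x y U V $ 1 = y"
  "pt x y U V $ 2 + s * pt x y U V $ 3 = U" "pt x y U V $ 2 - s * pt x y U V $ 3 = V"
  unfolding pt_nth using s_nonzero by (simp_all add: field_simps)

text \<open>
  The curve \<open>t \<mapsto> pt (x t) (y t) (U t) (V t)\<close> as a tuple of polynomials, whose conjugates and degrees
  can be compared.
\<close>

definition ptc :: "'a poly \<Rightarrow> 'a poly \<Rightarrow> 'a poly \<Rightarrow> 'a poly \<Rightarrow> nat \<Rightarrow> 'a poly" where
  "ptc x y U V i = [Polynomial.smult (1 / 2) (x + y), Polynomial.smult (1 / (2 * s)) (x - y),
     Polynomial.smult (1 / 2) (U + V), Polynomial.smult (1 / (2 * s)) (U - V)] ! i"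

lemma ptc: "Matrix.vec 4 (\<lambda>i. poly (ptc x y U V i) t) = pt (poly x t) (poly y t) (poly U t) (poly V t)"
  unfolding pt_def ptc_def
  by (intro eq_vecI) (auto simp: eval_nat_numeral less_Suc_eq)

text \<open>
  In weight coordinates, conjugation exchanges \<open>x\<close> with \<open>y\<close> and \<open>U\<close> with \<open>V\<close>.
\<close>

lemma ptc_conj_pair:
  assumes "x \<in> poly_over k" "y \<in> poly_over k" "U \<in> poly_over k" "V \<in> poly_over k" "i < 4"
  shows "conj_pair (ptc x y U V i) (ptc y x V U i)"
proof -
  have h: "1 / 2 \<in> k" by (intro divide numeral one)
  have a: "conj_pair (Polynomial.smult (1 / 2) (a + b)) (Polynomial.smult (1 / 2) (b + a))"
    if "a \<in> poly_over k" "b \<in> poly_over k" for a b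
    using conj_pair_base[of "Polynomial.smult (1 / 2) (a + b)"] that h by (simp add: add.commute poly_over_add poly_over_smult)
  have b: "conj_pair (Polynomial.smult (1 / (2 * s)) (a - b)) (Polynomial.smult (1 / (2 * s)) (b - a))"
    if "a \<in> poly_over k" "b \<in> poly_over k" for a b
  proof -
    have "conj_pair ([:1 / (2 * s):] * (a - b)) ([:- 1 / (2 * s):] * (a - b))"
      by (intro conj_pair_mult conj_pair_inverse conj_pair_base poly_over_diff that)
    moreover have "[:- 1 / (2 * s):] * (a - b) = Polynomial.smult (1 / (2 * s)) (b - a)"
      by (simp add: smult_diff_right)
    ultimately show ?thesis by simp
  qed
  show ?thesis using assms a b unfolding ptc_def
    by (auto simp: eval_nat_numeral less_Suc_eq)
qed

text \<open>
  The two weight functions \<open>F\<^sub>2\<^sub>j \<plusminus> s F\<^sub>2\<^sub>j\<^sub>+\<^sub>1\<close> attached to consecutive components of \<open>F\<close>.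
\<close>

definition pair :: "(nat \<Rightarrow> 'a Matrix.vec \<Rightarrow> 'a) \<Rightarrow> nat \<Rightarrow> bool \<Rightarrow> 'a Matrix.vec \<Rightarrow> 'a" where
  "pair F j b v = F (2 * j) v + (if b then - s else s) * F (2 * j + 1) v"

lemma pair_conj_polys:
  assumes F: "\<And>j. j < 6 \<Longrightarrow> F j \<in> poly_fun k 4" and j: "j < 3"
    and "x \<in> poly_over k" "y \<in> poly_over k" "U \<in> poly_over k" "V \<in> poly_over k"
  shows "\<exists>P P'. conj_pair P P' \<and>
    (\<forall>t. pair F j b (pt (poly x t) (poly y t) (poly U t) (poly V t)) = poly P t) \<and>
    (\<forall>t. pair F j (\<not> b) (pt (poly y t) (poly x t) (poly V t) (poly U t)) = poly P' t)"
proof -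
  note ex = poly_fun_along_conj_pair[OF F, of _ "ptc x y U V" "ptc y x V U", unfolded ptc]
  have ip: "\<And>i. i < 4 \<Longrightarrow> conj_pair (ptc x y U V i) (ptc y x V U i)"
    by (rule ptc_conj_pair) (use assms in auto)
  obtain P P' where P: "conj_pair P P'"
    "\<And>t. F (2 * j) (pt (poly x t) (poly y t) (poly U t) (poly V t)) = poly P t"
    "\<And>t. F (2 * j) (pt (poly y t) (poly x t) (poly V t) (poly U t)) = poly P' t"
    using ex[of "2 * j", OF _ ip] j by auto
  obtain Q Q' where Q: "conj_pair Q Q'"
    "\<And>t. F (2 * j + 1) (pt (poly x t) (poly y t) (poly U t) (poly V t)) = poly Q t"
    "\<And>t. F (2 * j + 1) (pt (poly y t) (poly x t) (poly V t) (poly U t)) = poly Q' t"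
    using ex[of "2 * j + 1", OF _ ip] j by auto
  define \<sigma> where "\<sigma> = (if b then - s else s)"
  have "conj_pair [:\<sigma>:] [:- \<sigma>:]"
  proof (cases b)
    case True
    have "conj_pair ([:- 1:] * [:s:]) ([:- 1:] * [:- s:])"
      by (intro conj_pair_mult conj_pair_s conj_pair_base poly_over_const uminus one)
    then show ?thesis using True by (simp add: \<sigma>_def)
  qed (use conj_pair_s in \<open>simp add: \<sigma>_def\<close>)
  then have "conj_pair (P + [:\<sigma>:] * Q) (P' + [:- \<sigma>:] * Q')"
    by (intro conj_pair_add conj_pair_mult P Q)
  then show ?thesis unfolding pair_def P Q
    by (intro exI[of _ "P + [:\<sigma>:] * Q"] exI[of _ "P' + [:- \<sigma>:] * Q'"]) (simp add: \<sigma>_def)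
qed

end

text \<open>
  What a linearization would provide: the six components \<open>F\<close> of an equivariant map over \<open>k\<close> from the
  tangent representation to the bundle, together with a polynomial left inverse \<open>H\<close>.  The
  assumptions \<open>E1\<close> and \<open>E2\<close> place the image on the bundle; the three pairs have weights \<open>2, 3, 1\<close>.
\<close>

locale equivariant_embedding = quadratic k s for k :: "'a::{alg_closed_field, field_char_0} set" and s +
  fixes F :: "nat \<Rightarrow> 'a Matrix.vec \<Rightarrow> 'a" and H :: "nat \<Rightarrow> 'a Matrix.vec \<Rightarrow> 'a"
  assumes F: "\<And>j. j < 6 \<Longrightarrow> F j \<in> poly_fun k 4"
    and H: "\<And>i. i < 4 \<Longrightarrow> H i \<in> poly_fun UNIV 6"
    and HF: "\<And>v i. v \<in> carrier_vec 4 \<Longrightarrow> i < 4 \<Longrightarrow> H i (Matrix.vec 6 (\<lambda>j. F j v)) = v $ i"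
    and E1: "\<And>v. v \<in> carrier_vec 4 \<Longrightarrow>
      pair F 0 True v * pair F 1 False v = pair F 2 False v - pair F 0 False v * pair F 2 True v"
    and E2: "\<And>v. v \<in> carrier_vec 4 \<Longrightarrow>
      pair F 0 False v * pair F 1 True v = pair F 2 True v - pair F 0 True v * pair F 2 False v"
    and equivariant: "\<And>g j x y U V. g \<noteq> 0 \<Longrightarrow> j < 3 \<Longrightarrow>
      pair F j False (pt (g\<^sup>2 * x) (y / g\<^sup>2) (g ^ 3 * U) (V / g ^ 3)) = g ^ ([2, 3, 1] ! j) * pair F j False (pt x y U V)"
    and equivariant': "\<And>g j x y U V. g \<noteq> 0 \<Longrightarrow> j < 3 \<Longrightarrow>
      pair F j True (pt (g\<^sup>2 * x) (y / g\<^sup>2) (g ^ 3 * U) (V / g ^ 3)) = pair F j True (pt x y U V) / g ^ ([2, 3, 1] ! j)"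
begin

abbreviation base :: "nat \<Rightarrow> bool \<Rightarrow> 'a \<Rightarrow> 'a \<Rightarrow> 'a" where
  "base j b x y \<equiv> pair F j b (pt x y 0 0)"

lemma F_from_pairs: "j < 3 \<Longrightarrow> F (2 * j) v = (pair F j False v + pair F j True v) / 2"
  "j < 3 \<Longrightarrow> F (2 * j + 1) v = (pair F j False v - pair F j True v) / (2 * s)"
  using s_nonzero by (simp_all add: pair_def)

text \<open>
  The element \<open>-1\<close> of the torus fixes the points with \<open>U = V = 0\<close> and acts by \<open>-1\<close> on the pairs of
  odd weight.
\<close>

lemma base_minus:
  assumes "j < 3" "j \<noteq> 0"
  shows "base j b x y = 0"
proof -
  have "[2, 3, 1] ! j = (3::nat) \<or> [2, 3, 1] ! j = (1::nat)" using assms by (auto simp: eval_nat_numeral less_Suc_eq)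
  then have "base j b x y = - base j b x y"
    using equivariant[of "-1" j x y 0 0] equivariant'[of "-1" j x y 0 0] assms(1) by (cases b) auto
  then show ?thesis by (rule eq_uminus_imp_0)
qed

text \<open>
  By equivariance the map restricted to the fixed plane is \<open>(x, y) \<mapsto> (x f(t), y f'(t))\<close> with
  \<open>t = x y\<close>.  At a root \<open>t0\<close> of \<open>f\<close> the points \<open>(x, t0 / x)\<close> would go to \<open>(0, c / x)\<close> for a constant \<open>c\<close>,
  and applying the left inverse would express \<open>x\<close> as a polynomial in \<open>1 / x\<close>.  Having no root, \<open>f\<close> is
  constant, and so is its conjugate \<open>f'\<close>.
\<close>

lemma base_constant: "\<exists>c. c \<noteq> 0 \<and> (\<forall>t. base 0 False 1 t = c) \<and> (\<exists>c'. c' \<noteq> 0 \<and> (\<forall>t. base 0 True t 1 = c'))"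
proof -
  obtain f f' where f: "conj_pair f f'" "\<And>t. base 0 False 1 t = poly f t" "\<And>t. base 0 True t 1 = poly f' t"
    using pair_conj_polys[of F 0 "[:1:]" "[:0, 1:]" 0 0 False, OF F] by (auto intro: one zero)
  have "poly f t0 \<noteq> 0" for t0
  proof
    assume "poly f t0 = 0"
    define c where "c = base 0 True 1 t0"
    have "H 0 (Matrix.vec 6 (\<lambda>j. [c / x / 2, - c / x / (2 * s), 0, 0, 0, 0] ! j)) + s * H 1 (Matrix.vec 6 (\<lambda>j. [c / x / 2, - c / x / (2 * s), 0, 0, 0, 0] ! j)) = x"
      if x: "x \<noteq> 0" for x
    proof -
      obtain g where g: "g\<^sup>2 = x" using nth_root_exists[of 2 x] by auto
      then have g0: "g \<noteq> 0" using x by auto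
      have a: "base 0 False x (t0 / x) = 0"
        using equivariant[OF g0, of 0 1 t0 0 0] g f(2)[of t0] \<open>poly f t0 = 0\<close> by simp
      have a': "base 0 True x (t0 / x) = c / x"
        using equivariant'[OF g0, of 0 1 t0 0 0] g by (simp add: c_def)
      let ?p = "pt x (t0 / x) 0 0"
      have Fp: "F 0 ?p = c / x / 2" "F 1 ?p = - c / x / (2 * s)" "F 2 ?p = 0" "F 3 ?p = 0" "F 4 ?p = 0" "F 5 ?p = 0"
        using F_from_pairs[of 0 ?p] F_from_pairs[of 1 ?p] F_from_pairs[of 2 ?p]
        by (simp_all add: a a' base_minus)
      have *: "Matrix.vec 6 (\<lambda>j. F j ?p) = Matrix.vec 6 (\<lambda>j. [c / x / 2, - c / x / (2 * s), 0, 0, 0, 0] ! j)"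
        using Fp by (intro eq_vecI) (auto simp: eval_nat_numeral less_Suc_eq)
      show ?thesis unfolding *[symmetric] using HF[of ?p 0] HF[of ?p 1] pt_pairs(1)[of x "t0 / x" 0 0] by simp
    qed
    note X = this
    \<comment> \<open>the same points, parametrized polynomially by \<open>t = 1 / x\<close>\<close>
    define cc where "cc j = [[:0, c / 2:], [:0, - c / (2 * s):], 0, 0, 0, 0] ! j" for j :: nat
    obtain P where P: "\<And>t. H 0 (Matrix.vec 6 (\<lambda>i. poly (cc i) t)) = poly P t"
      using poly_fun_along_curve[OF H[of 0], of cc] by auto
    obtain Q where Q: "\<And>t. H 1 (Matrix.vec 6 (\<lambda>i. poly (cc i) t)) = poly Q t"
      using poly_fun_along_curve[OF H[of 1], of cc] by auto
    have "poly ([:0, 1:] * (P + [:s:] * Q)) t = poly 1 t" if t: "t \<noteq> 0" for t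
    proof -
      have "Matrix.vec 6 (\<lambda>i. poly (cc i) t) = Matrix.vec 6 (\<lambda>j. [c / (1 / t) / 2, - c / (1 / t) / (2 * s), 0, 0, 0, 0] ! j)"
        by (intro eq_vecI) (auto simp: cc_def eval_nat_numeral less_Suc_eq)
      then have "poly P t + s * poly Q t = 1 / t" using X[of "1 / t"] t P[of t] Q[of t] by simp
      then show ?thesis using t by (simp add: field_simps)
    qed
    then have "[:0, 1:] * (P + [:s:] * Q) = 1" by (rule poly_eqI_char_0)
    then have "poly ([:0, 1:] * (P + [:s:] * Q)) 0 = 1" by simp
    then show False by simp
  qed
  then have "Polynomial.degree f = 0" using alg_closed_imp_poly_has_root by (metis gr0I)
  then obtain c where c: "f = [:c:]" by (metis degree_eq_zeroE)
  moreover obtain c' where c': "f' = [:c':]" using conj_pair_degree[OF f(1)] \<open>Polynomial.degree f = 0\<close> by (metis degree_eq_zeroE)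
  moreover have "c \<noteq> 0" using \<open>\<And>t0. poly f t0 \<noteq> 0\<close> c by auto
  moreover have "c' \<noteq> 0" using conj_pair_0_iff[OF f(1)] c c' \<open>c \<noteq> 0\<close> by auto
  ultimately show ?thesis using f by auto
qed

text \<open>
  The derivative of \<open>F\<close> at a point of the fixed plane in the normal direction \<open>(A, B)\<close>, written as a
  function of the point \<open>pt x y A B\<close>.  In this form it is again a polynomial map over \<open>k\<close>, so the
  facts on conjugation apply to it.
\<close>

lemma normal_linearization:
  obtains T where "\<And>j. j < 6 \<Longrightarrow> T j \<in> poly_fun k 4"
    "\<And>j x y A B P. j < 6 \<Longrightarrow> (\<And>\<epsilon>. F j (pt x y (A * \<epsilon>) (B * \<epsilon>)) = poly P \<epsilon>) \<Longrightarrow> poly.coeff P 1 = T j (pt x y A B)"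
    "\<And>j x y A B. j < 6 \<Longrightarrow> T j (pt x y A B) = A * T j (pt x y 1 0) + B * T j (pt x y 0 1)"
proof -
  have "\<forall>j<6. \<exists>G. (\<forall>i<4. G i \<in> poly_fun k 4) \<and> gradient_of 4 (F j) G"
    using poly_fun_gradient[OF sub_field_axioms F] by blast
  then obtain G where G: "\<And>j i. j < 6 \<Longrightarrow> i < 4 \<Longrightarrow> G j i \<in> poly_fun k 4"
    "\<And>j. j < 6 \<Longrightarrow> gradient_of 4 (F j) (G j)" by metis
  define proj where "proj i v = (if i < 2 then v $ i else 0)" for i :: nat and v :: "'a Matrix.vec"
  define T where "T j v = G j 2 (Matrix.vec 4 (\<lambda>i. proj i v)) * v $ 2 + G j 3 (Matrix.vec 4 (\<lambda>i. proj i v)) * v $ 3" for j v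
  have pr: "Matrix.vec 4 (\<lambda>i. proj i (pt x y A B)) = pt x y 0 0" for x y A B
    unfolding proj_def pt_def by (intro eq_vecI) (auto simp: eval_nat_numeral less_Suc_eq)
  have Tpt: "T j (pt x y A B) = G j 2 (pt x y 0 0) * ((A + B) / 2) + G j 3 (pt x y 0 0) * ((A - B) / (2 * s))" for j x y A B
    unfolding T_def pr pt_nth ..
  show ?thesis
  proof (rule that[of T])
    fix j :: nat assume j: "j < 6"
    have "proj i \<in> poly_fun k 4" if "i < 4" for i
      using that poly_fun.coord[of i 4 k] poly_fun.const[OF zero, of 4]
      unfolding proj_def by (cases "i < 2") auto
    then have "(\<lambda>v. G j i (Matrix.vec 4 (\<lambda>i. proj i v))) \<in> poly_fun k 4" if "i < 4" for i
      using G(1)[OF j that] by (intro poly_fun_compose) auto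
    then show "T j \<in> poly_fun k 4" unfolding T_def
      by (intro poly_fun.add poly_fun.mult poly_fun.coord) auto
    fix x y A B
    show "T j (pt x y A B) = A * T j (pt x y 1 0) + B * T j (pt x y 0 1)"
      unfolding Tpt by (simp add: algebra_simps add_divide_distrib diff_divide_distrib)
    fix P assume P: "\<And>\<epsilon>. F j (pt x y (A * \<epsilon>) (B * \<epsilon>)) = poly P \<epsilon>"
    show "poly.coeff P 1 = T j (pt x y A B)"
      using gradient_ofD[OF G(2)[OF j], of "ptc [:x:] [:y:] [:0, A:] [:0, B:]" P] P
      unfolding ptc sum_lessThan_4 Tpt by (simp add: ptc_def mult.commute)
  qed
qed

text \<open>
  The proof computes with the normal derivative \<open>T\<close> along the curve \<open>x = 1\<close>, \<open>y = t\<close> in the fixed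
  plane.  Equivariance describes the derivatives of \<open>w\<close> and \<open>w'\<close> by the matrix with rows \<open>(t e, h)\<close>
  and \<open>(t\<^sup>2 h', e')\<close>, whose determinant is \<open>t (e e' - t h h')\<close>; the letters \<open>eb\<close> and \<open>hb\<close> stand for
  \<open>e'\<close> and \<open>h'\<close>.
\<close>

theorem no_equivariant_embedding: False
proof -
  obtain T where T: "\<And>j. j < 6 \<Longrightarrow> T j \<in> poly_fun k 4"
    and Tcurve: "\<And>j x y A B P. j < 6 \<Longrightarrow> (\<And>\<epsilon>. F j (pt x y (A * \<epsilon>) (B * \<epsilon>)) = poly P \<epsilon>) \<Longrightarrow> poly.coeff P 1 = T j (pt x y A B)"
    and Tlin: "\<And>j x y A B. j < 6 \<Longrightarrow> T j (pt x y A B) = A * T j (pt x y 1 0) + B * T j (pt x y 0 1)"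
    using normal_linearization by blast
  have curve: "\<exists>P. \<forall>\<epsilon>. F j (pt x y (A * \<epsilon>) (B * \<epsilon>)) = poly P \<epsilon>" if "j < 6" for j x y A B
    using poly_fun_along_curve[OF F[OF that], of "ptc [:x:] [:y:] [:0, A:] [:0, B:]"]
    unfolding ptc by (simp add: mult.commute)
  have pcurve: "\<exists>P. (\<forall>\<epsilon>. pair F j b (pt x y (A * \<epsilon>) (B * \<epsilon>)) = poly P \<epsilon>) \<and>
      poly P 0 = base j b x y \<and> poly.coeff P 1 = pair T j b (pt x y A B)" if j3: "j < 3" for j b x y A B
  proof -
    have j: "2 * j < 6" "2 * j + 1 < 6" using j3 by auto
    obtain P where P: "\<And>\<epsilon>. F (2 * j) (pt x y (A * \<epsilon>) (B * \<epsilon>)) = poly P \<epsilon>" using curve[OF j(1)] by blast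
    obtain Q where Q: "\<And>\<epsilon>. F (2 * j + 1) (pt x y (A * \<epsilon>) (B * \<epsilon>)) = poly Q \<epsilon>" using curve[OF j(2)] by blast
    show ?thesis
      using Tcurve[OF j(1) P] Tcurve[OF j(2) Q] P[of 0] Q[of 0] P Q
      by (intro exI[of _ "P + Polynomial.smult (if b then - s else s) Q"]) (simp add: pair_def)
  qed
  have uniq: "P = Q" if "\<And>\<epsilon>. poly P \<epsilon> = poly Q \<epsilon>" for P Q :: "'a poly"
    by (rule poly_eqI_char_0) (rule that)
  have Teq: "pair T j False (pt (g\<^sup>2 * x) (y / g\<^sup>2) (g ^ 3 * A) (B / g ^ 3)) = g ^ ([2, 3, 1] ! j) * pair T j False (pt x y A B)"
    if g: "g \<noteq> 0" "j < 3" for g j x y A B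
  proof -
    obtain P where P: "\<And>\<epsilon>. pair F j False (pt x y (A * \<epsilon>) (B * \<epsilon>)) = poly P \<epsilon>" "poly.coeff P 1 = pair T j False (pt x y A B)"
      using pcurve[OF g(2)] by metis
    obtain Q where Q: "\<And>\<epsilon>. pair F j False (pt (g\<^sup>2 * x) (y / g\<^sup>2) (g ^ 3 * A * \<epsilon>) (B / g ^ 3 * \<epsilon>)) = poly Q \<epsilon>"
      "poly.coeff Q 1 = pair T j False (pt (g\<^sup>2 * x) (y / g\<^sup>2) (g ^ 3 * A) (B / g ^ 3))"
      using pcurve[OF g(2)] by metis
    have "Q = Polynomial.smult (g ^ ([2, 3, 1] ! j)) P"
      using equivariant[OF g, of x y "A * \<epsilon>" "B * \<epsilon>" for \<epsilon>] P(1) Q(1) by (intro uniq) (simp add: mult.assoc)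
    then show ?thesis using P(2) Q(2) by simp
  qed
  have Teq': "pair T j True (pt (g\<^sup>2 * x) (y / g\<^sup>2) (g ^ 3 * A) (B / g ^ 3)) = pair T j True (pt x y A B) / g ^ ([2, 3, 1] ! j)"
    if g: "g \<noteq> 0" "j < 3" for g j x y A B
  proof -
    obtain P where P: "\<And>\<epsilon>. pair F j True (pt x y (A * \<epsilon>) (B * \<epsilon>)) = poly P \<epsilon>" "poly.coeff P 1 = pair T j True (pt x y A B)"
      using pcurve[OF g(2)] by metis
    obtain Q where Q: "\<And>\<epsilon>. pair F j True (pt (g\<^sup>2 * x) (y / g\<^sup>2) (g ^ 3 * A * \<epsilon>) (B / g ^ 3 * \<epsilon>)) = poly Q \<epsilon>"
      "poly.coeff Q 1 = pair T j True (pt (g\<^sup>2 * x) (y / g\<^sup>2) (g ^ 3 * A) (B / g ^ 3))"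
      using pcurve[OF g(2)] by metis
    have "Q = Polynomial.smult (1 / g ^ ([2, 3, 1] ! j)) P"
      using equivariant'[OF g, of x y "A * \<epsilon>" "B * \<epsilon>" for \<epsilon>] P(1) Q(1) by (intro uniq) (simp add: mult.assoc)
    then show ?thesis using P(2) Q(2) by simp
  qed
  have Plin: "pair T j b (pt x y A B) = A * pair T j b (pt x y 1 0) + B * pair T j b (pt x y 0 1)" if "j < 3" for j b x y A B
    using Tlin[of "2 * j" x y A B] Tlin[of "2 * j + 1" x y A B] that by (simp add: pair_def algebra_simps)
  have T0: "pair T 0 b (pt x y A B) = 0" for b x y A B
  proof -
    have "pair T 0 b (pt x y (- A) (- B)) = pair T 0 b (pt x y A B)"
      using Teq[of "-1" 0 x y A B] Teq'[of "-1" 0 x y A B] by (cases b) auto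
    moreover have "pair T 0 b (pt x y (- A) (- B)) = - pair T 0 b (pt x y A B)"
      unfolding Plin[of 0 b x y "- A" "- B", OF zero_less_numeral] Plin[of 0 b x y A B, OF zero_less_numeral] by simp
    ultimately show ?thesis by (metis eq_uminus_imp_0)
  qed
  have E1T: "base 0 True x y * pair T 1 False (pt x y A B) = pair T 2 False (pt x y A B) - base 0 False x y * pair T 2 True (pt x y A B)"
    and E2T: "base 0 False x y * pair T 1 True (pt x y A B) = pair T 2 True (pt x y A B) - base 0 True x y * pair T 2 False (pt x y A B)" for x y A B
  proof -
    have "\<forall>j<3. \<forall>b. \<exists>P. (\<forall>\<epsilon>. pair F j b (pt x y (A * \<epsilon>) (B * \<epsilon>)) = poly P \<epsilon>) \<and>
      poly P 0 = base j b x y \<and> poly.coeff P 1 = pair T j b (pt x y A B)" using pcurve by blast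
    then obtain P where P: "\<And>j b \<epsilon>. j < 3 \<Longrightarrow> pair F j b (pt x y (A * \<epsilon>) (B * \<epsilon>)) = poly (P j b) \<epsilon>"
      "\<And>j b. j < 3 \<Longrightarrow> poly (P j b) 0 = base j b x y"
      "\<And>j b. j < 3 \<Longrightarrow> poly.coeff (P j b) 1 = pair T j b (pt x y A B)" by metis
    have "P 0 True * P 1 False = P 2 False - P 0 False * P 2 True"
      using E1[OF pt_carrier, of x y "A * \<epsilon>" "B * \<epsilon>" for \<epsilon>] by (intro uniq) (simp add: P)
    then have "poly.coeff (P 0 True * P 1 False) 1 = poly.coeff (P 2 False - P 0 False * P 2 True) 1" by simp
    then show "base 0 True x y * pair T 1 False (pt x y A B) = pair T 2 False (pt x y A B) - base 0 False x y * pair T 2 True (pt x y A B)"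
      unfolding coeff_diff poly_coeff_1_mult by (simp only: P(2,3) base_minus T0, simp add: P(2,3) base_minus T0)
    have "P 0 False * P 1 True = P 2 True - P 0 True * P 2 False"
      using E2[OF pt_carrier, of x y "A * \<epsilon>" "B * \<epsilon>" for \<epsilon>] by (intro uniq) (simp add: P)
    then have "poly.coeff (P 0 False * P 1 True) 1 = poly.coeff (P 2 True - P 0 True * P 2 False) 1" by simp
    then show "base 0 False x y * pair T 1 True (pt x y A B) = pair T 2 True (pt x y A B) - base 0 True x y * pair T 2 False (pt x y A B)"
      unfolding coeff_diff poly_coeff_1_mult by (simp only: P(2,3) base_minus T0, simp add: P(2,3) base_minus T0)
  qed
  have inj: "A = 0 \<and> B = 0" if TAB: "\<And>j b. j < 3 \<Longrightarrow> pair T j b (pt x y A B) = 0" for x y A B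
  proof -
    have T0: "T j (pt x y A B) = 0" if "j < 6" for j
    proof -
      have "T (2 * i) v = (pair T i False v + pair T i True v) / 2"
        "T (2 * i + 1) v = (pair T i False v - pair T i True v) / (2 * s)" for i v
        using s_nonzero by (simp_all add: pair_def)
      from this[of "j div 2" "pt x y A B"] have "T (2 * (j div 2)) (pt x y A B) = 0" "T (2 * (j div 2) + 1) (pt x y A B) = 0"
        using TAB[of "j div 2"] that by auto
      then show ?thesis by (cases "even j") (auto simp: odd_two_times_div_two_succ)
    qed
    have "\<forall>j<6. \<exists>P. \<forall>\<epsilon>. F j (pt x y (A * \<epsilon>) (B * \<epsilon>)) = poly P \<epsilon>" using curve by blast
    then obtain P where P: "\<And>j \<epsilon>. j < 6 \<Longrightarrow> F j (pt x y (A * \<epsilon>) (B * \<epsilon>)) = poly (P j) \<epsilon>" by metis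
    have P1: "poly.coeff (P j) 1 = 0" if "j < 6" for j
      using Tcurve[OF that P[OF that]] T0[OF that] by simp
    have ptc0: "poly.coeff (ptc [:x:] [:y:] [:0, A:] [:0, B:] i) 1 = 0" if i: "i < 4" for i
    proof -
      obtain G where G: "gradient_of 6 (H i) G" using poly_fun_gradient[OF sub_field_UNIV H[OF i]] by blast
      have "H i (Matrix.vec 6 (\<lambda>j. poly (P j) \<epsilon>)) = poly (ptc [:x:] [:y:] [:0, A:] [:0, B:] i) \<epsilon>" for \<epsilon>
      proof -
        have "Matrix.vec 6 (\<lambda>j. poly (P j) \<epsilon>) = Matrix.vec 6 (\<lambda>j. F j (pt x y (A * \<epsilon>) (B * \<epsilon>)))"
          by (intro eq_vecI) (simp_all add: P)
        then have "H i (Matrix.vec 6 (\<lambda>j. poly (P j) \<epsilon>)) = pt x y (A * \<epsilon>) (B * \<epsilon>) $ i"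
          using HF[OF pt_carrier i] by simp
        also have "\<dots> = Matrix.vec 4 (\<lambda>i. poly (ptc [:x:] [:y:] [:0, A:] [:0, B:] i) \<epsilon>) $ i"
          unfolding ptc by (simp add: mult.commute)
        finally show ?thesis using i by simp
      qed
      from gradient_ofD[OF G this] show ?thesis using P1 by simp
    qed
    have "A + B = 0" "A - B = 0" using ptc0[of 2] ptc0[of 3] s_nonzero by (simp_all add: ptc_def)
    then have "A = B" "2 * A = 0" by simp_all
    then show ?thesis by simp
  qed
  obtain c c' where c: "c \<noteq> 0" "\<And>t. base 0 False 1 t = c" "c' \<noteq> 0" "\<And>t. base 0 True t 1 = c'"
    using base_constant by blast
  have in_k: "1 \<in> poly_over k" "0 \<in> poly_over k" "[:0, 1:] \<in> poly_over k"
    using poly_over_const[OF one] by (auto simp: one_pCons intro: zero one)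
  have sqrt: "\<exists>g. g \<noteq> 0 \<and> g\<^sup>2 = 1 / t" if "t \<noteq> 0" for t :: 'a
  proof -
    obtain g where g: "g\<^sup>2 = 1 / t" using nth_root_exists[of 2 "1 / t"] by auto
    then have "g \<noteq> 0" using that by auto
    then show ?thesis using g by blast
  qed
  obtain e eb where e: "conj_pair e eb" "\<And>t. pair T 2 False (pt t 1 1 0) = poly e t" "\<And>t. pair T 2 True (pt 1 t 0 1) = poly eb t"
    using pair_conj_polys[of T 2 "[:0, 1:]" 1 1 0 False, OF T] in_k by auto
  obtain h hb where h: "conj_pair h hb" "\<And>t. pair T 2 False (pt 1 t 0 1) = poly h t" "\<And>t. pair T 2 True (pt t 1 1 0) = poly hb t"
    using pair_conj_polys[of T 2 1 "[:0, 1:]" 0 1 False, OF T] in_k by auto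
  have g1: "pair T 2 False (pt 1 t 1 0) = t * poly e t" for t
  proof -
    obtain g1 where g1: "\<And>t. pair T 2 False (pt 1 t 1 0) = poly g1 t"
      using pair_conj_polys[of T 2 1 "[:0, 1:]" 1 0 False, OF T] in_k by auto
    have "poly g1 t = poly ([:0, 1:] * e) t" if t: "t \<noteq> 0" for t
    proof -
      obtain g where g: "g \<noteq> 0" "g\<^sup>2 = 1 / t" using sqrt[OF t] by blast
      have "g ^ 3 * pair T 2 False (pt 1 t 1 0) = g * poly e t"
        using Teq[OF g(1), of 2 t 1 1 0] t Plin[of 2 False 1 t "g ^ 3" 0] unfolding g(2) e(2) by simp
      then have "g\<^sup>2 * pair T 2 False (pt 1 t 1 0) = poly e t"
        using g(1) by (simp add: power3_eq_cube power2_eq_square mult.assoc)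
      then show ?thesis unfolding g(2) g1 using t by (simp add: field_simps)
    qed
    then have "g1 = [:0, 1:] * e" by (rule poly_eqI_char_0)
    then show ?thesis unfolding g1 by simp
  qed
  have g2: "pair T 2 True (pt 1 t 1 0) = t\<^sup>2 * poly hb t" for t
  proof -
    obtain g2 where g2: "\<And>t. pair T 2 True (pt 1 t 1 0) = poly g2 t"
      using pair_conj_polys[of T 2 1 "[:0, 1:]" 1 0 True, OF T] in_k by auto
    have "poly g2 t = poly ([:0, 1:] * [:0, 1:] * hb) t" if t: "t \<noteq> 0" for t
    proof -
      obtain g where g: "g \<noteq> 0" "g\<^sup>2 = 1 / t" using sqrt[OF t] by blast
      have "g ^ 3 * pair T 2 True (pt 1 t 1 0) = poly hb t / g"
        using Teq'[OF g(1), of 2 t 1 1 0] t Plin[of 2 True 1 t "g ^ 3" 0] unfolding g(2) h(3) by simp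
      then have "g\<^sup>2 * g\<^sup>2 * pair T 2 True (pt 1 t 1 0) = poly hb t"
        using g(1) by (simp add: field_simps power3_eq_cube power2_eq_square)
      then show ?thesis unfolding g(2) g2 using t by (simp add: field_simps)
    qed
    then have "g2 = [:0, 1:] * [:0, 1:] * hb" by (rule poly_eqI_char_0)
    then show ?thesis unfolding g2 by (simp add: power2_eq_square)
  qed
  have a1: "base 0 True 1 t = t * c'" for t
  proof -
    obtain a1 where a1: "\<And>t. base 0 True 1 t = poly a1 t"
      using pair_conj_polys[of F 0 1 "[:0, 1:]" 0 0 True, OF F] in_k by auto
    have "poly a1 t = poly [:0, c':] t" if t: "t \<noteq> 0" for t
    proof -
      obtain g where g: "g \<noteq> 0" "g\<^sup>2 = 1 / t" using sqrt[OF t] by blast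
      show ?thesis using equivariant'[OF g(1), of 0 t 1 0 0] t g(2) c(4)[of t] a1[of t] by simp
    qed
    then have "a1 = [:0, c':]" by (rule poly_eqI_char_0)
    then show ?thesis unfolding a1 by simp
  qed
  \<comment> \<open>the equation of the bundle, linearized at \<open>x = 1\<close>, \<open>y = 0\<close>\<close>
  have h0: "poly h 0 = c * poly eb 0"
    using E1T[of 1 0 0 1] a1[of 0] c(2)[of 0] unfolding h(2) e(3) by simp
  \<comment> \<open>at \<open>t = 0\<close> the determinant carries the factor \<open>t\<close>, so this point needs its own argument\<close>
  have eb0: "poly eb 0 \<noteq> 0"
  proof
    assume 0: "poly eb 0 = 0"
    then have T2: "pair T 2 b (pt 1 0 A B) = 0" for b A B
      using Plin[of 2 b 1 0 A B] g1[of 0] g2[of 0] h(2)[of 0] e(3)[of 0] h0 by (cases b) auto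
    define A where "A = (if pair T 1 False (pt 1 0 1 0) = 0 then 1 else - pair T 1 False (pt 1 0 0 1))"
    define B where "B = (if pair T 1 False (pt 1 0 1 0) = 0 then 0 else pair T 1 False (pt 1 0 1 0))"
    have "A \<noteq> 0 \<or> B \<noteq> 0" unfolding A_def B_def by auto
    moreover have "A = 0 \<and> B = 0"
    proof (rule inj)
      fix j b assume "j < (3::nat)"
      then consider "j = 0" | "j = 1" | "j = 2" by linarith
      then show "pair T j b (pt 1 0 A B) = 0"
      proof cases
        case 2
        have "pair T 1 False (pt 1 0 A B) = A * pair T 1 False (pt 1 0 1 0) + B * pair T 1 False (pt 1 0 0 1)"
          by (rule Plin) simp
        also have "\<dots> = 0" unfolding A_def B_def by simp
        finally have "pair T 1 False (pt 1 0 A B) = 0" .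
        moreover have "pair T 1 True (pt 1 0 A B) = 0" using E2T[of 1 0 A B] T2 c by simp
        ultimately show ?thesis using 2 by (cases b) auto
      qed (use T0 T2 in auto)
    qed
    ultimately show False by blast
  qed
  then have e0: "poly e 0 \<noteq> 0" using conj_pair_coeff_0_iff[OF e(1), of 0] by (simp add: poly_0_coeff_0)
  define D where "D = e * eb - [:0, 1:] * (h * hb)"
  have "poly D t \<noteq> 0" for t
  proof (cases "t = 0")
    case True
    then show ?thesis using e0 eb0 by (simp add: D_def)
  next
    case t: False
    show ?thesis
    proof
      assume D0: "poly D t = 0"
      \<comment> \<open>a normal direction \<open>(A, B)\<close> in which \<open>w\<close> and \<open>w'\<close>, and hence all coordinates, are stationary\<close>
      have det: "(t * poly e t) * poly eb t = poly h t * (t\<^sup>2 * poly hb t)"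
        using D0 by (simp add: D_def power2_eq_square algebra_simps)
      have "\<exists>A B. (A \<noteq> 0 \<or> B \<noteq> 0) \<and> A * (t * poly e t) + B * poly h t = 0 \<and> A * (t\<^sup>2 * poly hb t) + B * poly eb t = 0"
      proof (cases "t * poly e t = 0 \<and> poly h t = 0")
        case True
        show ?thesis
        proof (cases "poly eb t = 0")
          case True
          show ?thesis
            by (cases "t\<^sup>2 * poly hb t = 0")
              (use True \<open>t * poly e t = 0 \<and> poly h t = 0\<close> in \<open>auto intro: exI[of _ 1] exI[of _ 0]\<close>)
        next
          case False
          then show ?thesis using True
            by (intro exI[of _ "poly eb t"] exI[of _ "- (t\<^sup>2 * poly hb t)"]) auto
        qed
      next
        case False
        then show ?thesis using det
          by (intro exI[of _ "poly h t"] exI[of _ "- (t * poly e t)"]) (auto simp: algebra_simps)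
      qed
      then obtain A B where AB: "A \<noteq> 0 \<or> B \<noteq> 0" "A * (t * poly e t) + B * poly h t = 0" "A * (t\<^sup>2 * poly hb t) + B * poly eb t = 0"
        by blast
      have T2: "pair T 2 b (pt 1 t A B) = 0" for b
        using Plin[of 2 b 1 t A B] g1[of t] g2[of t] h(2)[of t] e(3)[of t] AB by (cases b) auto
      have "A = 0 \<and> B = 0"
      proof (rule inj)
        fix j b assume "j < (3::nat)"
        then consider "j = 0" | "j = 1" | "j = 2" by linarith
        then show "pair T j b (pt 1 t A B) = 0"
        proof cases
          case 2
          have "pair T 1 False (pt 1 t A B) = 0" using E1T[of 1 t A B] T2 c a1[of t] t by simp
          moreover have "pair T 1 True (pt 1 t A B) = 0" using E2T[of 1 t A B] T2 c by simp
          ultimately show ?thesis using 2 by (cases b) auto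
        qed (use T0 T2 in auto)
      qed
      then show False using AB by blast
    qed
  qed
  then have degD: "Polynomial.degree D = 0" using alg_closed_imp_poly_has_root by (metis gr0I)
  have nz: "e \<noteq> 0" "eb \<noteq> 0" using e0 eb0 by auto
  have "h \<noteq> 0" using h0 eb0 c(1) by auto
  then have hbnz: "hb \<noteq> 0" using conj_pair_0_iff[OF h(1)] by simp
  have d1: "Polynomial.degree (e * eb) = 2 * Polynomial.degree e"
    using nz conj_pair_degree[OF e(1)] by (simp add: degree_mult_eq)
  have d2: "Polynomial.degree (- ([:0, 1:] * (h * hb))) = 1 + 2 * Polynomial.degree h"
    using \<open>h \<noteq> 0\<close> hbnz conj_pair_degree[OF h(1)] by (simp add: degree_mult_eq)
  have "Polynomial.degree D = max (Polynomial.degree (e * eb)) (Polynomial.degree (- ([:0, 1:] * (h * hb))))"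
  proof -
    have "Polynomial.degree (e * eb) \<noteq> Polynomial.degree (- ([:0, 1:] * (h * hb)))"
      unfolding d1 d2 by presburger
    then consider "Polynomial.degree (e * eb) < Polynomial.degree (- ([:0, 1:] * (h * hb)))"
      | "Polynomial.degree (- ([:0, 1:] * (h * hb))) < Polynomial.degree (e * eb)" by linarith
    moreover have "D = e * eb + - ([:0, 1:] * (h * hb))" by (simp add: D_def)
    ultimately show ?thesis by cases (simp_all only: degree_add_eq_left degree_add_eq_right max_absorb1 max_absorb2 less_imp_le)
  qed
  then show False using degD d2 by simp
qed

end

section \<open>The norm-one torus\<close>

lemma regular_mapI:
  assumes "\<And>x. x \<in> E \<Longrightarrow> f x \<in> F" "\<And>i. i < m \<Longrightarrow> p i \<in> poly_fun K n"
    "\<And>x. x \<in> E \<Longrightarrow> f x = Matrix.vec m (\<lambda>i. p i x)"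
  shows "regular_map K n E m F f"
  unfolding regular_map_def using assms by blast

context quadratic
begin

definition torus :: "'a Matrix.vec monoid" where
  "torus = \<lparr>carrier = {v \<in> carrier_vec 2. (v $ 0)\<^sup>2 - d * (v $ 1)\<^sup>2 = 1},
     monoid.mult = (\<lambda>v w. Matrix.vec 2 (\<lambda>i. [v $ 0 * w $ 0 + d * (v $ 1 * w $ 1), v $ 0 * w $ 1 + v $ 1 * w $ 0] ! i)),
     one = Matrix.vec 2 (\<lambda>i. [1, 0] ! i)\<rparr>"

text \<open>
  The parametrization inverse to the character \<open>chr\<close>; it identifies the group of geometric points
  with the multiplicative group.
\<close>

definition torus_pt :: "'a \<Rightarrow> 'a Matrix.vec" where
  "torus_pt g = Matrix.vec 2 (\<lambda>i. [(g + 1 / g) / 2, (g - 1 / g) / (2 * s)] ! i)"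

definition chr :: "'a Matrix.vec \<Rightarrow> 'a" where "chr v = v $ 0 + s * v $ 1"

lemma All_less_2: "(\<forall>i<2. P i) \<longleftrightarrow> P 0 \<and> P (1::nat)"
  by (auto simp: eval_nat_numeral less_Suc_eq)

lemma vec2_eqI: "v \<in> carrier_vec 2 \<Longrightarrow> w \<in> carrier_vec 2 \<Longrightarrow> v $ 0 = w $ 0 \<Longrightarrow> v $ 1 = w $ 1 \<Longrightarrow> v = w"
  by (rule eq_vecI) (auto simp: eval_nat_numeral less_Suc_eq)

lemma torus_simps:
  "v \<in> carrier torus \<longleftrightarrow> v \<in> carrier_vec 2 \<and> (v $ 0)\<^sup>2 - d * (v $ 1)\<^sup>2 = 1"
  "v \<otimes>\<^bsub>torus\<^esub> w \<in> carrier_vec 2" "(v \<otimes>\<^bsub>torus\<^esub> w) $ 0 = v $ 0 * w $ 0 + d * (v $ 1 * w $ 1)"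
  "(v \<otimes>\<^bsub>torus\<^esub> w) $ 1 = v $ 0 * w $ 1 + v $ 1 * w $ 0"
  "\<one>\<^bsub>torus\<^esub> \<in> carrier_vec 2" "\<one>\<^bsub>torus\<^esub> $ 0 = 1" "\<one>\<^bsub>torus\<^esub> $ 1 = 0"
  by (simp_all add: torus_def)

lemma torus_pt_simps: "torus_pt g \<in> carrier_vec 2" "torus_pt g $ 0 = (g + 1 / g) / 2" "torus_pt g $ 1 = (g - 1 / g) / (2 * s)"
  by (simp_all add: torus_pt_def)

lemmas torus_simps' = torus_simps torus_simps(4,7)[unfolded One_nat_def]
  torus_pt_simps torus_pt_simps(3)[unfolded One_nat_def]

lemma torus_pt_in: "g \<noteq> 0 \<Longrightarrow> torus_pt g \<in> carrier torus"
  unfolding torus_simps torus_pt_simps using s_nonzero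
  by (simp add: torus_pt_def field_simps power2_eq_square)

lemma chr_torus_pt: "chr (torus_pt g) = g"
  unfolding chr_def torus_pt_simps using s_nonzero by (simp add: field_simps)

lemma chr_norm: "v \<in> carrier torus \<Longrightarrow> chr v * (v $ 0 - s * v $ 1) = 1"
  unfolding torus_simps chr_def by (simp add: algebra_simps power2_eq_square)

lemma chr_nonzero: "v \<in> carrier torus \<Longrightarrow> chr v \<noteq> 0"
  using chr_norm by fastforce

lemma chr_inverse: "v \<in> carrier torus \<Longrightarrow> v $ 0 - s * v $ 1 = 1 / chr v"
  using chr_norm[of v] chr_nonzero[of v] by (simp add: field_simps)

lemma torus_pt_chr: "v \<in> carrier torus \<Longrightarrow> torus_pt (chr v) = v"
proof (rule vec2_eqI)
  assume v: "v \<in> carrier torus"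
  show "v \<in> carrier_vec 2" using v by (simp add: torus_simps)
  show "torus_pt (chr v) $ 0 = v $ 0" "torus_pt (chr v) $ 1 = v $ 1"
    unfolding torus_pt_simps unfolding chr_inverse[OF v, symmetric] unfolding chr_def using s_nonzero by simp_all
qed (simp add: torus_pt_simps)

lemma torus_pt_mult: "g \<noteq> 0 \<Longrightarrow> h \<noteq> 0 \<Longrightarrow> torus_pt g \<otimes>\<^bsub>torus\<^esub> torus_pt h = torus_pt (g * h)"
  by (rule vec2_eqI) (use s_nonzero in \<open>simp_all add: torus_simps' field_simps power2_eq_square\<close>)

lemma torus_pt_one: "\<one>\<^bsub>torus\<^esub> = torus_pt 1"
  by (rule vec2_eqI) (simp_all add: torus_simps')

lemma torus_comm_group: "comm_group torus"
proof (rule comm_groupI)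
  have ex: "\<exists>g. g \<noteq> 0 \<and> v = torus_pt g" if "v \<in> carrier torus" for v
    using torus_pt_chr[OF that] chr_nonzero[OF that] by metis
  show "\<one>\<^bsub>torus\<^esub> \<in> carrier torus" unfolding torus_pt_one by (rule torus_pt_in) simp
  fix v assume "v \<in> carrier torus"
  then obtain g where g: "g \<noteq> 0" "v = torus_pt g" using ex by blast
  show "\<one>\<^bsub>torus\<^esub> \<otimes>\<^bsub>torus\<^esub> v = v" unfolding g torus_pt_one using torus_pt_mult[of 1 g] g by simp
  show "\<exists>w\<in>carrier torus. w \<otimes>\<^bsub>torus\<^esub> v = \<one>\<^bsub>torus\<^esub>"
    unfolding g torus_pt_one using torus_pt_mult[of "1 / g" g] g torus_pt_in[of "1 / g"] by (intro bexI[of _ "torus_pt (1 / g)"]) auto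
  fix w assume "w \<in> carrier torus"
  then obtain h where h: "h \<noteq> 0" "w = torus_pt h" using ex by blast
  show "v \<otimes>\<^bsub>torus\<^esub> w \<in> carrier torus" unfolding g h using torus_pt_mult[of g h] torus_pt_in[of "g * h"] g h by simp
  show "v \<otimes>\<^bsub>torus\<^esub> w = w \<otimes>\<^bsub>torus\<^esub> v" unfolding g h using torus_pt_mult[of g h] torus_pt_mult[of h g] g h by (simp add: mult.commute)
  fix u assume "u \<in> carrier torus"
  then obtain l where l: "l \<noteq> 0" "u = torus_pt l" using ex by blast
  show "v \<otimes>\<^bsub>torus\<^esub> w \<otimes>\<^bsub>torus\<^esub> u = v \<otimes>\<^bsub>torus\<^esub> (w \<otimes>\<^bsub>torus\<^esub> u)"
    unfolding g h l using torus_pt_mult[of g h] torus_pt_mult[of h l] torus_pt_mult[of "g * h" l] torus_pt_mult[of g "h * l"] g h l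
    by (simp add: mult.assoc)
qed

lemma torus_inv: "v \<in> carrier torus \<Longrightarrow> inv\<^bsub>torus\<^esub> v = Matrix.vec 2 (\<lambda>i. [v $ 0, - v $ 1] ! i)"
proof -
  assume v: "v \<in> carrier torus"
  interpret comm_group torus by (rule torus_comm_group)
  let ?w = "Matrix.vec 2 (\<lambda>i. [v $ 0, - v $ 1] ! i)"
  have w: "?w \<in> carrier torus" using v by (simp add: torus_simps)
  have "?w \<otimes>\<^bsub>torus\<^esub> v = \<one>\<^bsub>torus\<^esub>"
    by (rule vec2_eqI) (use v in \<open>simp_all add: torus_simps' power2_eq_square algebra_simps\<close>)
  then show ?thesis using inv_equality[OF _ v w] by simp
qed

lemma torus_mult_chr: "v \<in> carrier torus \<Longrightarrow> w \<in> carrier torus \<Longrightarrow> chr (v \<otimes>\<^bsub>torus\<^esub> w) = chr v * chr w"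
  by (simp add: chr_def torus_simps' algebra_simps power2_eq_square)

lemma torus_k_group: "k_group k 2 torus"
  unfolding k_group_def
proof (intro conjI)
  interpret comm_group torus by (rule torus_comm_group)
  show "group torus" by (rule group_axioms)
  let ?f = "\<lambda>x :: 'a Matrix.vec. x $ 0 * x $ 0 + ((- d) * (x $ 1 * x $ 1) + (- 1))"
  have "?f \<in> poly_fun k 2"
    using s_square one by (intro poly_fun.add poly_fun.mult poly_fun.coord poly_fun.const uminus) auto
  moreover have "carrier torus = zero_locus 2 {?f}"
    by (auto simp: torus_simps zero_locus_def power2_eq_square algebra_simps)
  ultimately show "closedin (zariski k 2) (carrier torus)"
    unfolding closedin_zariski(2)[OF zero one] by blast
  show "\<forall>i<2. \<one>\<^bsub>torus\<^esub> $ i \<in> k" unfolding All_less_2 torus_simps using zero one by simp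
  show "regular_map k (2 + 2) (aff_prod (carrier torus) (carrier torus)) 2 (carrier torus)
       (\<lambda>z. vec_first z 2 \<otimes>\<^bsub>torus\<^esub> vec_last z 2)"
  proof (rule regular_mapI)
    let ?p = "\<lambda>i z. [z $ 0 * z $ 2 + d * (z $ 1 * z $ 3), z $ 0 * z $ 3 + z $ 1 * z $ 2] ! i"
    have "(\<lambda>z. z $ 0 * z $ 2 + d * (z $ 1 * z $ 3)) \<in> poly_fun k (2 + 2)"
      "(\<lambda>z. z $ 0 * z $ 3 + z $ 1 * z $ 2) \<in> poly_fun k (2 + 2)"
      using s_square by (intro poly_fun.add poly_fun.mult poly_fun.coord poly_fun.const; simp)+
    then show "?p i \<in> poly_fun k (2 + 2)" if "i < 2" for i
      using that by (cases i) (auto simp: less_Suc_eq eval_nat_numeral)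
    fix z assume "z \<in> aff_prod (carrier torus) (carrier torus)"
    then obtain v w where z: "z = v @\<^sub>v w" "v \<in> carrier torus" "w \<in> carrier torus" unfolding aff_prod_def by blast
    then have c: "v \<in> carrier_vec 2" "w \<in> carrier_vec 2" by (simp_all add: torus_simps)
    have vw: "vec_first z 2 = v" "vec_last z 2 = w"
      unfolding z(1) vec_first_def vec_last_def using c by (auto intro!: eq_vecI)
    show "vec_first z 2 \<otimes>\<^bsub>torus\<^esub> vec_last z 2 \<in> carrier torus" unfolding vw by (rule m_closed[OF z(2,3)])
    have "z $ 0 = v $ 0" "z $ 1 = v $ 1" "z $ 2 = w $ 0" "z $ 3 = w $ 1" using c unfolding z(1) by auto
    then show "vec_first z 2 \<otimes>\<^bsub>torus\<^esub> vec_last z 2 = Matrix.vec 2 (\<lambda>i. ?p i z)"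
      unfolding vw by (simp add: torus_def)
  qed
  show "regular_map k 2 (carrier torus) 2 (carrier torus) (m_inv torus)"
  proof (rule regular_mapI)
    let ?p = "\<lambda>i v. [v $ 0, (- 1) * v $ 1] ! i"
    have "(\<lambda>v. v $ 0) \<in> poly_fun k 2" "(\<lambda>v. (- 1) * v $ 1) \<in> poly_fun k 2"
      by (intro poly_fun.mult poly_fun.coord poly_fun.const uminus one; simp)+
    then show "?p i \<in> poly_fun k 2" if "i < 2" for i
      using that by (cases i) (auto simp: less_Suc_eq eval_nat_numeral)
    fix v assume v: "v \<in> carrier torus"
    show "m_inv torus v \<in> carrier torus" by (rule inv_closed[OF v])
    show "m_inv torus v = Matrix.vec 2 (\<lambda>i. ?p i v)" unfolding torus_inv[OF v] by simp
  qed
qed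

lemma poly_fun_on_torus:
  assumes "f \<in> poly_fun UNIV 2"
  shows "\<exists>N Q. \<forall>g. g \<noteq> 0 \<longrightarrow> g ^ N * f (torus_pt g) = poly Q g"
  using assms
proof (induction rule: poly_fun.induct)
  case (const c)
  show ?case by (rule exI[of _ 0], rule exI[of _ "[:c:]"]) simp
next
  case (coord i)
  then consider "i = 0" | "i = 1" by linarith
  then show ?case
  proof cases
    case 1
    have "g ^ 1 * torus_pt g $ 0 = poly [:1 / 2, 0, 1 / 2:] g" if "g \<noteq> 0" for g
      unfolding torus_pt_simps using that by (simp add: field_simps)
    then show ?thesis unfolding 1 by blast
  next
    case 2
    have "g ^ 1 * torus_pt g $ 1 = poly [:- 1 / (2 * s), 0, 1 / (2 * s):] g" if "g \<noteq> 0" for g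
      unfolding torus_pt_simps using that s_nonzero by (simp add: field_simps)
    then show ?thesis unfolding 2 by blast
  qed
next
  case (add f h)
  from add(3) obtain N Q where 1: "\<forall>g. g \<noteq> 0 \<longrightarrow> g ^ N * f (torus_pt g) = poly Q g" by (elim exE)
  from add(4) obtain N' Q' where 2: "\<forall>g. g \<noteq> 0 \<longrightarrow> g ^ N' * h (torus_pt g) = poly Q' g" by (elim exE)
  note * = 1[rule_format] 2[rule_format]
  have "g ^ (N + N') * (f (torus_pt g) + h (torus_pt g)) = poly (Polynomial.monom 1 N' * Q + Polynomial.monom 1 N * Q') g"
    if "g \<noteq> 0" for g
    using *[OF that, symmetric] by (simp add: poly_monom power_add algebra_simps)
  then show ?case by (intro exI allI impI)
next
  case (mult f h)
  from mult(3) obtain N Q where 1: "\<forall>g. g \<noteq> 0 \<longrightarrow> g ^ N * f (torus_pt g) = poly Q g" by (elim exE)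
  from mult(4) obtain N' Q' where 2: "\<forall>g. g \<noteq> 0 \<longrightarrow> g ^ N' * h (torus_pt g) = poly Q' g" by (elim exE)
  note * = 1[rule_format] 2[rule_format]
  have "g ^ (N + N') * (f (torus_pt g) * h (torus_pt g)) = poly (Q * Q') g" if "g \<noteq> 0" for g
    using *[OF that, symmetric] by (simp add: power_add algebra_simps)
  then show ?case by (intro exI allI impI)
qed

text \<open>
  In terms of the parameter, a polynomial function is a Laurent polynomial in one variable.
\<close>

lemma finite_zeros_on_torus:
  assumes f: "f \<in> poly_fun UNIV 2" and v: "v \<in> carrier torus" "f v \<noteq> 0"
  shows "finite {w \<in> carrier torus. f w = 0}"
proof -
  obtain N Q where "\<forall>g. g \<noteq> 0 \<longrightarrow> g ^ N * f (torus_pt g) = poly Q g"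
    using poly_fun_on_torus[OF f] by (elim exE)
  note Q = this[rule_format]
  have "poly Q (chr v) \<noteq> 0"
    using Q[OF chr_nonzero[OF v(1)]] v chr_nonzero[OF v(1)] by (simp add: torus_pt_chr flip: Q)
  then have "finite {g. poly Q g = 0}" by (intro poly_roots_finite) auto
  moreover have "{w \<in> carrier torus. f w = 0} \<subseteq> torus_pt ` {g. poly Q g = 0}"
  proof
    fix w assume w: "w \<in> {w \<in> carrier torus. f w = 0}"
    then have "poly Q (chr w) = 0" using Q[OF chr_nonzero[of w]] by (simp add: torus_pt_chr)
    then show "w \<in> torus_pt ` {g. poly Q g = 0}" using w torus_pt_chr[of w] by (metis (mono_tags) image_eqI mem_Collect_eq)
  qed
  ultimately show ?thesis by (rule finite_subset[OF _ finite_imageI, rotated])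
qed

lemma infinite_torus: "infinite (carrier torus)"
proof
  assume "finite (carrier torus)"
  then have "finite (chr ` carrier torus)" by (rule finite_imageI)
  moreover have "UNIV - {0} \<subseteq> chr ` carrier torus"
  proof
    fix g :: 'a assume "g \<in> UNIV - {0}"
    then have "torus_pt g \<in> carrier torus" by (intro torus_pt_in) simp
    then show "g \<in> chr ` carrier torus" using chr_torus_pt[of g] by (metis imageI)
  qed
  ultimately have "finite (UNIV - {0 :: 'a})" by (rule finite_subset[rotated])
  then show False using infinite_UNIV_char_0[where 'a = 'a] by simp
qed

abbreviation "torus_top \<equiv> subtopology (zariski UNIV 2) (carrier torus)"

lemma topspace_torus: "topspace torus_top = carrier torus"
  unfolding topspace_subtopology closedin_zariski(1)[OF UNIV_I UNIV_I]
  by (rule Int_absorb1) (simp add: subset_iff torus_simps(1))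

text \<open>
  This determines the topology, and with it connectedness, irreducibility and dimension.
\<close>

lemma closedin_torus: "closedin torus_top Z \<Longrightarrow> Z = carrier torus \<or> finite Z"
proof -
  assume Z: "closedin torus_top Z"
  obtain P where P: "P \<subseteq> poly_fun UNIV 2" "Z = carrier torus \<inter> zero_locus 2 P"
    using closedin_subtopology_zariski[OF sub_field_UNIV Z] by blast
  show ?thesis
  proof (cases "\<forall>f\<in>P. \<forall>v\<in>carrier torus. f v = 0")
    case True
    then show ?thesis unfolding P(2) by (auto simp: zero_locus_def torus_simps)
  next
    case False
    then obtain f v where fv: "f \<in> P" "v \<in> carrier torus" "f v \<noteq> 0" by blast
    have "Z \<subseteq> {w \<in> carrier torus. f w = 0}" unfolding P(2) zero_locus_def using fv(1) by blast
    moreover have "finite {w \<in> carrier torus. f w = 0}"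
      using finite_zeros_on_torus[where f = f and v = v] fv P(1) by blast
    ultimately show ?thesis using finite_subset by blast
  qed
qed

lemma closedin_torus_finite: "finite A \<Longrightarrow> A \<subseteq> carrier torus \<Longrightarrow> closedin torus_top A"
proof (induction A rule: finite_induct)
  case (insert v A)
  have "closedin torus_top {v}"
  proof -
    let ?P = "{\<lambda>x. x $ 0 + (- v $ 0), \<lambda>x. x $ 1 + (- v $ 1)}"
    have "?P \<subseteq> poly_fun UNIV 2" unfolding insert_subset
      by (intro conjI empty_subsetI poly_fun.add poly_fun.coord poly_fun.const) simp_all
    then have "closedin (zariski UNIV 2) (zero_locus 2 ?P)"
      unfolding closedin_zariski(2)[of UNIV 2, OF UNIV_I UNIV_I] by blast
    moreover have "{v} = zero_locus 2 ?P \<inter> carrier torus"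
      using insert(4) vec2_eqI[of _ v] by (auto simp: zero_locus_def torus_simps)
    ultimately show ?thesis unfolding closedin_subtopology by blast
  qed
  then have "closedin torus_top ({v} \<union> A)" using insert by (intro closedin_Un) auto
  then show ?case by simp
qed simp

lemma torus_connected: "connected_group 2 torus"
  unfolding connected_group_def connected_space_closedin
proof (intro notI, elim exE conjE)
  fix A B assume AB: "closedin torus_top A" "closedin torus_top B" "topspace torus_top \<subseteq> A \<union> B" "A \<inter> B = {}" "A \<noteq> {}" "B \<noteq> {}"
  have sub: "A \<subseteq> carrier torus" "B \<subseteq> carrier torus" using AB(1,2) closedin_subset topspace_torus by blast+
  then have "finite A" "finite B" using closedin_torus[OF AB(1)] closedin_torus[OF AB(2)] AB(4-6) by blast+
  then show False using infinite_torus AB(3) finite_subset[of "carrier torus" "A \<union> B"] unfolding topspace_torus by blast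
qed

lemma torus_irreducible: "irreducible_in torus_top (carrier torus)"
  unfolding irreducible_in_def topspace_torus
proof (intro conjI allI impI)
  show "carrier torus \<noteq> {}" using infinite_torus by auto
  fix A B assume AB: "closedin torus_top A \<and> closedin torus_top B \<and> carrier torus \<subseteq> A \<union> B"
  then show "carrier torus \<subseteq> A \<or> carrier torus \<subseteq> B"
  proof (cases "A = carrier torus \<or> B = carrier torus")
    case False
    then have "finite (A \<union> B)" using closedin_torus AB by blast
    then have "finite (carrier torus)" using AB by (blast intro: finite_subset)
    then show ?thesis using infinite_torus by blast
  qed auto
qed simp

lemma torus_dim: "group_dim 2 torus = 1"
  unfolding group_dim_def krull_dim_def
proof (rule antisym)
  let ?ch = "\<lambda>d. \<exists>Z :: nat \<Rightarrow> 'a Matrix.vec set. (\<forall>i\<le>d. closedin torus_top (Z i) \<and> irreducible_in torus_top (Z i)) \<and> (\<forall>i<d. Z i \<subset> Z (Suc i))"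
  show "Sup {enat d |d. ?ch d} \<le> 1"
  proof (rule Sup_least, clarify)
    fix n and Z :: "nat \<Rightarrow> 'a Matrix.vec set"
    assume Z: "\<forall>i\<le>n. closedin torus_top (Z i) \<and> irreducible_in torus_top (Z i)" "\<forall>i<n. Z i \<subset> Z (Suc i)"
    show "enat n \<le> 1"
    proof (rule ccontr)
      assume "\<not> enat n \<le> 1"
      then have n: "n \<ge> 2" by (auto simp: one_enat_def)
      then have lt: "Z 0 \<subset> Z 1" "Z 1 \<subset> Z 2" using Z(2) by (auto simp: eval_nat_numeral)
      have c: "closedin torus_top (Z 0)" "closedin torus_top (Z 1)" "irreducible_in torus_top (Z 0)" "irreducible_in torus_top (Z 1)"
        "closedin torus_top (Z 2)" using Z(1) n by auto
      have Z2: "Z 2 \<subseteq> carrier torus" using closedin_subset[OF c(5)] unfolding topspace_torus .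
      have "Z 1 \<noteq> carrier torus" using lt(2) Z2 by blast
      then have fin: "finite (Z 1)" using closedin_torus[OF c(2)] by blast
      have "closedin torus_top (Z 1 - Z 0)" using fin lt Z2 by (intro closedin_torus_finite) auto
      then have "Z 1 \<subseteq> Z 0 \<or> Z 1 \<subseteq> Z 1 - Z 0" using c(1,4) unfolding irreducible_in_def by blast
      moreover have "Z 0 \<noteq> {}" using c(3) unfolding irreducible_in_def by blast
      ultimately show False using lt by blast
    qed
  qed
  have "?ch 1"
  proof (intro exI conjI allI impI)
    let ?Z = "\<lambda>i::nat. if i = 0 then {torus_pt 1} else carrier torus"
    have 1: "torus_pt 1 \<in> carrier torus" by (rule torus_pt_in) simp
    have "closedin torus_top {torus_pt 1}" using 1 by (intro closedin_torus_finite) auto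
    moreover have "irreducible_in torus_top {torus_pt 1}" using 1 topspace_torus unfolding irreducible_in_def by auto
    ultimately show "closedin torus_top (?Z i)" "irreducible_in torus_top (?Z i)" for i
      using torus_irreducible closedin_topspace[of torus_top] unfolding topspace_torus by auto
    fix i :: nat assume "i < 1"
    have "carrier torus \<noteq> {torus_pt 1}" using infinite_torus by (metis finite.emptyI finite_insert)
    then show "?Z i \<subset> ?Z (Suc i)" using 1 \<open>i < 1\<close> by auto
  qed
  then have "enat 1 \<in> {enat d |d. ?ch d}" by blast
  then show "1 \<le> Sup {enat d |d. ?ch d}" unfolding one_enat_def by (rule Sup_upper)
qed

text \<open>
  The character is an eigenfunction of the right translation by \<open>u\<close> with eigenvalue \<open>chr u\<close>, so a
  unipotent \<open>u\<close> satisfies \<open>chr u = 1\<close> and is trivial.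
\<close>

lemma torus_reductive: "reductive_group 2 torus"
  unfolding reductive_group_def
proof (intro allI impI, elim conjE)
  interpret comm_group torus by (rule torus_comm_group)
  fix U assume U: "U \<lhd> torus" "\<forall>u\<in>U. unipotent_element 2 torus u"
  have sub: "subgroup U torus" using U(1) by (rule normal_imp_subgroup)
  have "u = \<one>\<^bsub>torus\<^esub>" if u: "u \<in> U" for u
  proof -
    have uc: "u \<in> carrier torus" using subgroup.mem_carrier[OF sub u] .
    have "(\<lambda>x. x $ 0 + s * x $ 1) \<in> poly_fun UNIV 2" by (intro poly_fun.intros) auto
    then have "chr \<in> poly_fun UNIV 2" unfolding chr_def .
    then obtain N where N: "\<And>x. x \<in> carrier torus \<Longrightarrow> ((\<lambda>h x. h (x \<otimes>\<^bsub>torus\<^esub> u) - h x) ^^ N) chr x = 0"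
      using U(2) u unfolding unipotent_element_def by blast
    have "((\<lambda>h x. h (x \<otimes>\<^bsub>torus\<^esub> u) - h x) ^^ m) chr x = (chr u - 1) ^ m * chr x" if "x \<in> carrier torus" for m x
      using that
    proof (induction m arbitrary: x)
      case (Suc m)
      then show ?case using m_closed[OF Suc(2) uc] torus_mult_chr[OF Suc(2) uc] by (simp add: algebra_simps)
    qed simp
    from this[OF uc, of N] have "(chr u - 1) ^ N * chr u = 0" using N[OF uc] by simp
    then have "chr u = 1" using chr_nonzero[OF uc] by auto
    then show ?thesis using torus_pt_chr[OF uc] torus_pt_one by simp
  qed
  then show "U = {\<one>\<^bsub>torus\<^esub>}" using subgroup.one_closed[OF sub] by blast
qed

end

section \<open>The action on affine four-space\<close>

lemma (in sub_field) poly_fun_diff: "f \<in> poly_fun F n \<Longrightarrow> g \<in> poly_fun F n \<Longrightarrow> (\<lambda>x. f x - g x) \<in> poly_fun F n"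
  using poly_fun.add[OF _ poly_fun.mult[OF poly_fun.const[OF uminus[OF one]]], of f n g] by simp

lemma less_4_cases: "i < 4 \<Longrightarrow> i = 0 \<or> i = 1 \<or> i = 2 \<or> i = (3::nat)" by auto
lemma less_6_cases: "i < 6 \<Longrightarrow> i = 0 \<or> i = 1 \<or> i = 2 \<or> i = 3 \<or> i = 4 \<or> i = (5::nat)" by auto

context quadratic
begin

text \<open>
  Solving the equations of the bundle.  Let \<open>r = u\<^sub>2 + w\<^sub>2\<close> and \<open>g = u\<^sub>1 + w\<^sub>1\<close>.  Over \<open>(p, q) = (z\<^sub>1, z\<^sub>2)\<close>
  the equations become \<open>w\<^sub>1 = p g - d q r\<close> and \<open>(1 + 2 p) w\<^sub>2 = (p - 2 d q\<^sup>2) r - (1 - 2 p) q g\<close>.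
  Modulo \<open>1 + 2 p\<close> the second one reads \<open>r + 4 q (g + d q r) = 0\<close>, so with \<open>h = g + d q r\<close> it
  becomes \<open>r = (1 + 2 p) n - 4 q h\<close> for a new variable \<open>n\<close>.  The free coordinates are \<open>p, q, h, n\<close>; the
  following four functions express \<open>r\<close>, \<open>g\<close>, \<open>w\<^sub>1\<close> and \<open>w\<^sub>2\<close> in terms of them.
\<close>

definition cr :: "'a Matrix.vec \<Rightarrow> 'a" where "cr v = v $ 3 + 2 * (v $ 0 * v $ 3) - 4 * (v $ 1 * v $ 2)"
definition cg :: "'a Matrix.vec \<Rightarrow> 'a" where "cg v = v $ 2 - d * (v $ 1 * cr v)"
definition cw1 :: "'a Matrix.vec \<Rightarrow> 'a" where "cw1 v = v $ 0 * cg v - d * (v $ 1 * cr v)"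
definition cw2 :: "'a Matrix.vec \<Rightarrow> 'a" where "cw2 v = v $ 0 * v $ 3 - v $ 1 * v $ 2 - d * (v $ 1 * (v $ 1 * cr v))"

text \<open>
  The components \<open>z\<^sub>1, z\<^sub>2, u\<^sub>1, u\<^sub>2, w\<^sub>1, w\<^sub>2\<close> of a point of the bundle.
\<close>

definition emb :: "nat \<Rightarrow> 'a Matrix.vec \<Rightarrow> 'a" where
  "emb i v = [v $ 0, v $ 1, cg v - cw1 v, cr v - cw2 v, cw1 v, cw2 v] ! i"

text \<open>
  The coordinates \<open>p, q, h, n\<close> of a point of the bundle.
\<close>

definition ret :: "nat \<Rightarrow> 'a Matrix.vec \<Rightarrow> 'a" where
  "ret i e = [e $ 0, e $ 1, e $ 2 + e $ 4 + d * (e $ 1 * (e $ 3 + e $ 5)),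
     e $ 3 + e $ 5 - 2 * (e $ 5 - e $ 1 * (e $ 2 + e $ 4))] ! i"

text \<open>
  Multiplication of the three pairs by the second, third and first power of \<open>a + s b\<close>.
\<close>

definition rot :: "nat \<Rightarrow> 'a \<Rightarrow> 'a \<Rightarrow> 'a Matrix.vec \<Rightarrow> 'a" where
  "rot i a b e = [(a\<^sup>2 + d * b\<^sup>2) * e $ 0 + d * (2 * a * b * e $ 1), (a\<^sup>2 + d * b\<^sup>2) * e $ 1 + 2 * a * b * e $ 0,
     (a ^ 3 + 3 * d * a * b\<^sup>2) * e $ 2 + d * ((3 * a\<^sup>2 * b + d * b ^ 3) * e $ 3),
     (a ^ 3 + 3 * d * a * b\<^sup>2) * e $ 3 + (3 * a\<^sup>2 * b + d * b ^ 3) * e $ 2,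
     a * e $ 4 + d * (b * e $ 5), a * e $ 5 + b * e $ 4] ! i"

definition embv :: "'a Matrix.vec \<Rightarrow> 'a Matrix.vec" where "embv v = Matrix.vec 6 (\<lambda>i. emb i v)"
definition retv :: "'a Matrix.vec \<Rightarrow> 'a Matrix.vec" where "retv e = Matrix.vec 4 (\<lambda>i. ret i e)"
definition rotv :: "'a Matrix.vec \<Rightarrow> 'a Matrix.vec \<Rightarrow> 'a Matrix.vec" where
  "rotv g e = Matrix.vec 6 (\<lambda>i. rot i (g $ 0) (g $ 1) e)"

definition act :: "'a Matrix.vec \<Rightarrow> 'a Matrix.vec \<Rightarrow> 'a Matrix.vec" where
  "act g = (\<lambda>v\<in>carrier_vec 4. retv (rotv g (embv v)))"

lemma carriers [simp]: "embv v \<in> carrier_vec 6" "retv e \<in> carrier_vec 4" "rotv g e \<in> carrier_vec 6"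
  by (simp_all add: embv_def retv_def rotv_def)

lemma emb_nth: "embv v $ 0 = v $ 0" "embv v $ 1 = v $ 1" "embv v $ 2 = cg v - cw1 v" "embv v $ 3 = cr v - cw2 v"
  "embv v $ 4 = cw1 v" "embv v $ 5 = cw2 v"
  by (simp_all add: embv_def emb_def)

lemma ret_nth: "retv e $ 0 = e $ 0" "retv e $ 1 = e $ 1" "retv e $ 2 = e $ 2 + e $ 4 + d * (e $ 1 * (e $ 3 + e $ 5))"
  "retv e $ 3 = e $ 3 + e $ 5 - 2 * (e $ 5 - e $ 1 * (e $ 2 + e $ 4))"
  by (simp_all add: retv_def ret_def)

lemma vec4_eqI: "v \<in> carrier_vec 4 \<Longrightarrow> w \<in> carrier_vec 4 \<Longrightarrow> v $ 0 = w $ 0 \<Longrightarrow> v $ 1 = w $ 1 \<Longrightarrow>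
    v $ 2 = w $ 2 \<Longrightarrow> v $ 3 = w $ 3 \<Longrightarrow> v = w"
  by (rule eq_vecI) (auto dest!: less_4_cases)

lemma vec6_eqI: "v \<in> carrier_vec 6 \<Longrightarrow> w \<in> carrier_vec 6 \<Longrightarrow> v $ 0 = w $ 0 \<Longrightarrow> v $ 1 = w $ 1 \<Longrightarrow>
    v $ 2 = w $ 2 \<Longrightarrow> v $ 3 = w $ 3 \<Longrightarrow> v $ 4 = w $ 4 \<Longrightarrow> v $ 5 = w $ 5 \<Longrightarrow> v = w"
  by (rule eq_vecI) (auto dest!: less_6_cases)

lemma ret_emb: "v \<in> carrier_vec 4 \<Longrightarrow> retv (embv v) = v"
  by (rule vec4_eqI) (simp_all only: carriers ret_nth emb_nth, simp_all add: cg_def cr_def cw1_def cw2_def algebra_simps)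

text \<open>
  The equations of the bundle over \<open>k\<close>, obtained by separating \<open>y u = w - x w'\<close> into the part without
  \<open>s\<close> and the coefficient of \<open>s\<close>.
\<close>

definition on_surface :: "'a Matrix.vec \<Rightarrow> bool" where
  "on_surface e \<longleftrightarrow> e $ 0 * e $ 2 - d * (e $ 1 * e $ 3) = e $ 4 - (e $ 0 * e $ 4 - d * (e $ 1 * e $ 5)) \<and>
     e $ 0 * e $ 3 - e $ 1 * e $ 2 = e $ 5 - (e $ 1 * e $ 4 - e $ 0 * e $ 5)"

lemma emb_on_surface: "on_surface (embv v)"
  unfolding on_surface_def emb_nth
  by (simp add: cg_def cr_def cw1_def cw2_def algebra_simps power2_eq_square)

lemma emb_ret:
  assumes "e \<in> carrier_vec 6" "on_surface e"
  shows "embv (retv e) = e"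
proof -
  define p q u1 u2 w1 w2 where pq: "p = e $ 0" "q = e $ 1" "u1 = e $ 2" "u2 = e $ 3" "w1 = e $ 4" "w2 = e $ 5"
  have E: "w1 = p * u1 - d * (q * u2) + (p * w1 - d * (q * w2))" "w2 = p * u2 - q * u1 + (q * w1 - p * w2)"
    using assms(2) unfolding on_surface_def pq by (simp_all add: algebra_simps)
  \<comment> \<open>both differences below are combinations of the two equations \<open>E\<close>\<close>
  have r: "cr (retv e) = u2 + w2"
  proof -
    have "cr (retv e) - (u2 + w2) = 2 * (p * (u2 + w2) - (1 + 2 * p) * w2 + (2 * p - 1) * (q * (u1 + w1)) - 2 * d * q * q * (u2 + w2))"
      unfolding cr_def ret_nth pq by (simp add: algebra_simps)
    also have "\<dots> = 2 * (p * u2 - q * u1 + (q * w1 - p * w2) - w2) + 4 * q * (p * u1 - d * (q * u2) + (p * w1 - d * (q * w2)) - w1)"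
      by (simp add: algebra_simps)
    also have "\<dots> = 0" using E by simp
    finally show ?thesis by simp
  qed
  have g: "cg (retv e) = u1 + w1" unfolding cg_def r ret_nth pq by (simp add: algebra_simps)
  have 1: "cw1 (retv e) = w1" unfolding cw1_def r g ret_nth using E(1) unfolding pq by (simp add: algebra_simps)
  have 2: "cw2 (retv e) = w2"
  proof -
    have "cw2 (retv e) - w2 = (p * u2 - q * u1 + (q * w1 - p * w2) - w2) + 2 * q * (p * u1 - d * (q * u2) + (p * w1 - d * (q * w2)) - w1)"
      unfolding cw2_def r ret_nth pq by (simp add: algebra_simps)
    also have "\<dots> = 0" using E by simp
    finally show ?thesis by simp
  qed
  show ?thesis
    by (rule vec6_eqI) (use assms(1) in \<open>simp_all only: carriers emb_nth r g 1 2 ret_nth pq add_diff_cancel_right'\<close>)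
qed

text \<open>
  The weight coordinates of a point of six-space.  In them the torus acts diagonally, which reduces
  the group laws and the invariance of the bundle to bookkeeping of exponents.
\<close>

definition pr :: "'a Matrix.vec \<Rightarrow> nat \<Rightarrow> bool \<Rightarrow> 'a" where
  "pr e j b = e $ (2 * j) + (if b then - s else s) * e $ (2 * j + 1)"

lemma pr_simps: "pr e 0 b = e $ 0 + (if b then - s else s) * e $ 1"
  "pr e 1 b = e $ 2 + (if b then - s else s) * e $ 3" "pr e (Suc 0) b = e $ 2 + (if b then - s else s) * e $ 3"
  "pr e 2 b = e $ 4 + (if b then - s else s) * e $ 5"
  unfolding pr_def by (simp_all add: eval_nat_numeral)

lemma pr_eqI:
  assumes "e \<in> carrier_vec 6" "e' \<in> carrier_vec 6" "\<And>j b. j < 3 \<Longrightarrow> pr e j b = pr e' j b"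
  shows "e = e'"
proof (rule eq_vecI)
  have *: "e $ (2 * j) = (pr e j False + pr e j True) / 2" "e $ (2 * j + 1) = (pr e j False - pr e j True) / (2 * s)" for e j
    using s_nonzero by (simp_all add: pr_def)
  have eq: "e $ (2 * j) = e' $ (2 * j)" "e $ (2 * j + 1) = e' $ (2 * j + 1)" if "j < 3" for j
    unfolding * assms(3)[OF that] by (rule refl)+
  fix i assume "i < dim_vec e'"
  then have i: "i div 2 < 3" using assms(2) by auto
  show "e $ i = e' $ i"
  proof (cases "even i")
    case True
    then have "2 * (i div 2) = i" by simp
    then show ?thesis using eq(1)[OF i] by metis
  next
    case False
    then have "2 * (i div 2) + 1 = i" by simp
    then show ?thesis using eq(2)[OF i] by metis
  qed
qed (use assms in auto)

lemma less_3_cases: "j < 3 \<Longrightarrow> j = 0 \<or> j = 1 \<or> j = (2::nat)" by auto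

lemma rot_nth: "i < 6 \<Longrightarrow> rotv g e $ i = rot i (g $ 0) (g $ 1) e"
  by (simp add: rotv_def)

lemma pr_rot_False: "j < 3 \<Longrightarrow> pr (rotv g e) j False = chr g ^ ([2, 3, 1] ! j) * pr e j False"
  by (drule less_3_cases, elim disjE)
    (simp_all add: pr_simps rot_nth rot_def chr_def algebra_simps power2_eq_square power3_eq_cube)

lemma pr_rot_True:
  assumes "g \<in> carrier torus" "j < 3"
  shows "pr (rotv g e) j True = pr e j True / chr g ^ ([2, 3, 1] ! j)"
proof -
  have "pr (rotv g e) j True = (g $ 0 - s * g $ 1) ^ ([2, 3, 1] ! j) * pr e j True"
    using less_3_cases[OF assms(2)]
    by (elim disjE) (simp_all add: pr_simps rot_nth rot_def algebra_simps power2_eq_square power3_eq_cube)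
  then show ?thesis unfolding chr_inverse[OF assms(1)] by (simp add: power_divide)
qed

lemma on_surface_pr: "on_surface e \<longleftrightarrow>
  pr e 0 True * pr e 1 False = pr e 2 False - pr e 0 False * pr e 2 True \<and>
  pr e 0 False * pr e 1 True = pr e 2 True - pr e 0 True * pr e 2 False"
proof -
  define x where "x = e $ 0 * e $ 2 - d * (e $ 1 * e $ 3) - (e $ 4 - (e $ 0 * e $ 4 - d * (e $ 1 * e $ 5)))"
  define y where "y = e $ 0 * e $ 3 - e $ 1 * e $ 2 - (e $ 5 - (e $ 1 * e $ 4 - e $ 0 * e $ 5))"
  have 1: "pr e 0 True * pr e 1 False - (pr e 2 False - pr e 0 False * pr e 2 True) = x + s * y"
    unfolding x_def y_def pr_simps by (simp add: algebra_simps power2_eq_square)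
  have 2: "pr e 0 False * pr e 1 True - (pr e 2 True - pr e 0 True * pr e 2 False) = x - s * y"
    unfolding x_def y_def pr_simps by (simp add: algebra_simps power2_eq_square)
  have "on_surface e \<longleftrightarrow> x = 0 \<and> y = 0" unfolding on_surface_def x_def y_def right_minus_eq ..
  also have "x = 0 \<and> y = 0 \<longleftrightarrow> x + s * y = 0 \<and> x - s * y = 0"
  proof
    assume *: "x + s * y = 0 \<and> x - s * y = 0"
    have "2 * x = (x + s * y) + (x - s * y)" by simp
    then have "x = 0" using * by simp
    then show "x = 0 \<and> y = 0" using * s_nonzero by auto
  qed auto
  finally show ?thesis unfolding 1[symmetric] 2[symmetric] right_minus_eq .
qed

lemma rot_on_surface:
  assumes "g \<in> carrier torus" "on_surface e"
  shows "on_surface (rotv g e)"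
proof -
  have c: "chr g \<noteq> 0" by (rule chr_nonzero[OF assms(1)])
  have E: "pr e 0 True * pr e 1 False = pr e 2 False - pr e 0 False * pr e 2 True"
    "pr e 0 False * pr e 1 True = pr e 2 True - pr e 0 True * pr e 2 False"
    using assms(2) unfolding on_surface_pr by auto
  have p: "pr (rotv g e) 0 False = chr g ^ 2 * pr e 0 False" "pr (rotv g e) 1 False = chr g ^ 3 * pr e 1 False"
    "pr (rotv g e) 2 False = chr g * pr e 2 False" "pr (rotv g e) 0 True = pr e 0 True / chr g ^ 2"
    "pr (rotv g e) 1 True = pr e 1 True / chr g ^ 3" "pr (rotv g e) 2 True = pr e 2 True / chr g"
    using pr_rot_False[of 0 g e] pr_rot_False[of 1 g e] pr_rot_False[of 2 g e]
      pr_rot_True[OF assms(1), of 0 e] pr_rot_True[OF assms(1), of 1 e] pr_rot_True[OF assms(1), of 2 e] by simp_all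
  have "pr (rotv g e) 0 True * pr (rotv g e) 1 False = chr g * (pr e 0 True * pr e 1 False)"
    "pr (rotv g e) 0 False * pr (rotv g e) 1 True = (pr e 0 False * pr e 1 True) / chr g"
    "pr (rotv g e) 0 False * pr (rotv g e) 2 True = chr g * (pr e 0 False * pr e 2 True)"
    "pr (rotv g e) 0 True * pr (rotv g e) 2 False = (pr e 0 True * pr e 2 False) / chr g"
    unfolding p using c by (simp_all add: field_simps power2_eq_square power3_eq_cube)
  then show ?thesis unfolding on_surface_pr E p(3,6) by (simp add: algebra_simps diff_divide_distrib)
qed

lemma emb_act: "g \<in> carrier torus \<Longrightarrow> v \<in> carrier_vec 4 \<Longrightarrow> embv (act g v) = rotv g (embv v)"
  unfolding act_def by (simp add: emb_ret rot_on_surface emb_on_surface)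

lemma act_carrier: "v \<in> carrier_vec 4 \<Longrightarrow> act g v \<in> carrier_vec 4"
  by (simp add: act_def)

lemma rot_rot:
  assumes "g \<in> carrier torus" "h \<in> carrier torus"
  shows "rotv g (rotv h e) = rotv (g \<otimes>\<^bsub>torus\<^esub> h) e"
proof (rule pr_eqI)
  interpret comm_group torus by (rule torus_comm_group)
  fix j b assume j: "j < (3::nat)"
  show "pr (rotv g (rotv h e)) j b = pr (rotv (g \<otimes>\<^bsub>torus\<^esub> h) e) j b"
    by (cases b) (simp_all add: pr_rot_False pr_rot_True j assms torus_mult_chr power_mult_distrib m_closed)
qed auto

lemma rot_one: "e \<in> carrier_vec 6 \<Longrightarrow> rotv \<one>\<^bsub>torus\<^esub> e = e"
proof (rule pr_eqI)
  interpret comm_group torus by (rule torus_comm_group)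
  have c: "chr \<one>\<^bsub>torus\<^esub> = 1" unfolding torus_pt_one by (rule chr_torus_pt)
  fix j b assume j: "j < (3::nat)"
  show "pr (rotv \<one>\<^bsub>torus\<^esub> e) j b = pr e j b"
    by (cases b) (simp_all add: pr_rot_False pr_rot_True[OF one_closed] j c)
qed auto

lemma act_mult:
  assumes "g \<in> carrier torus" "h \<in> carrier torus" "v \<in> carrier_vec 4"
  shows "act g (act h v) = act (g \<otimes>\<^bsub>torus\<^esub> h) v"
proof -
  have "act g (act h v) = retv (rotv g (embv (act h v)))" using act_carrier[OF assms(3)] by (simp add: act_def)
  also have "\<dots> = act (g \<otimes>\<^bsub>torus\<^esub> h) v" unfolding emb_act[OF assms(2,3)] rot_rot[OF assms(1,2)] using assms(3) by (simp add: act_def)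
  finally show ?thesis .
qed

lemma act_one: "v \<in> carrier_vec 4 \<Longrightarrow> act \<one>\<^bsub>torus\<^esub> v = v"
  by (simp add: act_def rot_one ret_emb)

lemma act_group_action: "group_action torus (carrier_vec 4) act"
proof -
  interpret comm_group torus by (rule torus_comm_group)
  have bij: "bij_betw (act g) (carrier_vec 4) (carrier_vec 4)" if g: "g \<in> carrier torus" for g
  proof (rule bij_betw_byWitness[where f' = "act (inv\<^bsub>torus\<^esub> g)"])
    show "\<forall>v\<in>carrier_vec 4. act (inv\<^bsub>torus\<^esub> g) (act g v) = v" "\<forall>v\<in>carrier_vec 4. act g (act (inv\<^bsub>torus\<^esub> g) v) = v"
      using g by (simp_all add: act_mult act_one)
  qed (auto simp: act_carrier)
  have Bij: "act g \<in> Bij (carrier_vec 4)" if "g \<in> carrier torus" for g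
    using bij[OF that] by (simp add: Bij_def act_def)
  have "act \<in> hom torus (BijGroup (carrier_vec 4))"
  proof (rule homI)
    fix g h assume gh: "g \<in> carrier torus" "h \<in> carrier torus"
    have "act (g \<otimes>\<^bsub>torus\<^esub> h) = compose (carrier_vec 4) (act g) (act h)"
    proof (rule extensionalityI)
      show "act (g \<otimes>\<^bsub>torus\<^esub> h) \<in> extensional (carrier_vec 4)" by (simp add: act_def)
      show "compose (carrier_vec 4) (act g) (act h) \<in> extensional (carrier_vec 4)" by (rule compose_extensional)
      fix v :: "'a Matrix.vec" assume v: "v \<in> carrier_vec 4"
      show "act (g \<otimes>\<^bsub>torus\<^esub> h) v = compose (carrier_vec 4) (act g) (act h) v"
        unfolding compose_eq[OF v] act_mult[OF gh v] ..
    qed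
    then show "act (g \<otimes>\<^bsub>torus\<^esub> h) = act g \<otimes>\<^bsub>BijGroup (carrier_vec 4)\<^esub> act h"
      using Bij gh by (simp add: BijGroup_def)
  qed (simp add: Bij BijGroup_def)
  then show ?thesis
    unfolding group_action_def group_hom_def group_hom_axioms_def using group_BijGroup is_group by blast
qed

lemma emb_poly_fun: "i < 6 \<Longrightarrow> emb i \<in> poly_fun k 4"
proof -
  note pf = poly_fun.add poly_fun.mult poly_fun_diff poly_fun.coord poly_fun.const
  have r: "cr \<in> poly_fun k 4" unfolding cr_def by (intro pf numeral) auto
  have g: "cg \<in> poly_fun k 4" unfolding cg_def using r s_square by (intro pf) auto
  have w: "cw1 \<in> poly_fun k 4" "cw2 \<in> poly_fun k 4" unfolding cw1_def cw2_def using r g s_square by (intro pf; auto)+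
  assume i: "i < 6"
  then have dis: "emb i = (\<lambda>v. v $ 0) \<or> emb i = (\<lambda>v. v $ 1) \<or> emb i = (\<lambda>v. cg v - cw1 v) \<or> emb i = (\<lambda>v. cr v - cw2 v) \<or> emb i = cw1 \<or> emb i = cw2"
    unfolding emb_def[abs_def] using less_6_cases[OF i] by auto
  have mem: "(\<lambda>v. v $ 0) \<in> poly_fun k 4" "(\<lambda>v. v $ 1) \<in> poly_fun k 4" "(\<lambda>v. cg v - cw1 v) \<in> poly_fun k 4"
    "(\<lambda>v. cr v - cw2 v) \<in> poly_fun k 4" using r g w by (intro pf; auto)+
  show ?thesis using dis by (elim disjE) (simp_all only: mem w)
qed

lemma ret_poly_fun: "i < 4 \<Longrightarrow> ret i \<in> poly_fun k 6"
proof -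
  note pf = poly_fun.add poly_fun.mult poly_fun_diff poly_fun.coord poly_fun.const
  assume i: "i < 4"
  define r2 r3 where r: "r2 = (\<lambda>e::'a Matrix.vec. e $ 2 + e $ 4 + d * (e $ 1 * (e $ 3 + e $ 5)))"
    "r3 = (\<lambda>e::'a Matrix.vec. e $ 3 + e $ 5 - 2 * (e $ 5 - e $ 1 * (e $ 2 + e $ 4)))"
  have dis: "ret i = (\<lambda>v. v $ 0) \<or> ret i = (\<lambda>v. v $ 1) \<or> ret i = r2 \<or> ret i = r3"
    unfolding ret_def[abs_def] r using less_4_cases[OF i] by auto
  have mem: "(\<lambda>v. v $ 0) \<in> poly_fun k 6" "(\<lambda>v. v $ 1) \<in> poly_fun k 6" "r2 \<in> poly_fun k 6" "r3 \<in> poly_fun k 6"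
    unfolding r using s_square by (intro pf numeral; auto)+
  show ?thesis using dis by (elim disjE) (simp_all only: mem)
qed

lemma poly_fun_power: "f \<in> poly_fun k n \<Longrightarrow> (\<lambda>x. f x ^ m) \<in> poly_fun k n"
  by (induction m) (auto intro: poly_fun.const poly_fun.mult one)

lemma rot_poly_fun:
  assumes "i < 6" "a \<in> poly_fun k n" "b \<in> poly_fun k n" "\<And>j. j < 6 \<Longrightarrow> e j \<in> poly_fun k n"
  shows "(\<lambda>z. rot i (a z) (b z) (Matrix.vec 6 (\<lambda>j. e j z))) \<in> poly_fun k n"
proof -
  note pf = poly_fun.add poly_fun.mult poly_fun_power poly_fun.const numeral s_square assms(2,3)
  define A2 B2 A3 B3 where AB: "A2 = (\<lambda>z. (a z)\<^sup>2 + d * (b z)\<^sup>2)" "B2 = (\<lambda>z. 2 * a z * b z)"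
    "A3 = (\<lambda>z. a z ^ 3 + 3 * d * a z * (b z)\<^sup>2)" "B3 = (\<lambda>z. 3 * (a z)\<^sup>2 * b z + d * b z ^ 3)"
  have m: "A2 \<in> poly_fun k n" "B2 \<in> poly_fun k n" "A3 \<in> poly_fun k n" "B3 \<in> poly_fun k n"
    unfolding AB by (intro pf)+
  have e: "e 0 \<in> poly_fun k n" "e 1 \<in> poly_fun k n" "e 2 \<in> poly_fun k n" "e 3 \<in> poly_fun k n"
    "e 4 \<in> poly_fun k n" "e 5 \<in> poly_fun k n" by (rule assms(4); simp)+
  have "(\<lambda>z. A2 z * e 0 z + d * (B2 z * e 1 z)) \<in> poly_fun k n" "(\<lambda>z. A2 z * e 1 z + B2 z * e 0 z) \<in> poly_fun k n"
    "(\<lambda>z. A3 z * e 2 z + d * (B3 z * e 3 z)) \<in> poly_fun k n" "(\<lambda>z. A3 z * e 3 z + B3 z * e 2 z) \<in> poly_fun k n"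
    "(\<lambda>z. a z * e 4 z + d * (b z * e 5 z)) \<in> poly_fun k n" "(\<lambda>z. a z * e 5 z + b z * e 4 z) \<in> poly_fun k n"
    by (intro poly_fun.add poly_fun.mult poly_fun.const s_square assms(2,3) m e)+
  then show ?thesis
    using less_6_cases[OF assms(1)] unfolding AB by (elim disjE) (simp_all add: rot_def)
qed

lemma act_algebraic: "algebraic_action k 2 torus 4 act"
  unfolding algebraic_action_def
proof (intro conjI act_group_action regular_mapI)
  let ?p = "\<lambda>i z. ret i (Matrix.vec 6 (\<lambda>j. rot j (z $ 0) (z $ 1) (Matrix.vec 6 (\<lambda>l. emb l (Matrix.vec 4 (\<lambda>m. z $ (m + 2)))))))"
  have "(\<lambda>z. emb l (Matrix.vec 4 (\<lambda>m. z $ (m + 2)))) \<in> poly_fun k (2 + 4)" if "l < 6" for l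
    by (rule poly_fun_compose[OF emb_poly_fun[OF that]]) (auto intro: poly_fun.coord)
  then have "(\<lambda>z. rot j (z $ 0) (z $ 1) (Matrix.vec 6 (\<lambda>l. emb l (Matrix.vec 4 (\<lambda>m. z $ (m + 2)))))) \<in> poly_fun k (2 + 4)" if "j < 6" for j
    using that by (intro rot_poly_fun poly_fun.coord) auto
  then show "?p i \<in> poly_fun k (2 + 4)" if "i < 4" for i
    by (intro poly_fun_compose[OF ret_poly_fun[OF that]]) auto
  fix z assume "z \<in> aff_prod (carrier torus) (carrier_vec 4)"
  then obtain g v where z: "z = g @\<^sub>v v" "g \<in> carrier torus" "v \<in> carrier_vec 4" unfolding aff_prod_def by blast
  then have c: "g \<in> carrier_vec 2" by (simp add: torus_simps)
  have gv: "vec_first z 2 = g" "vec_last z 4 = v" 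
    unfolding z(1) vec_first_def vec_last_def using c z(3) by (auto intro!: eq_vecI)
  show "act (vec_first z 2) (vec_last z 4) \<in> carrier_vec 4" unfolding gv by (rule act_carrier[OF z(3)])
  have "z $ 0 = g $ 0" "z $ 1 = g $ 1" "Matrix.vec 4 (\<lambda>m. z $ (m + 2)) = v"
    using c z(3) unfolding z(1) by (auto intro!: eq_vecI)
  then show "act (vec_first z 2) (vec_last z 4) = Matrix.vec 4 (\<lambda>i. ?p i z)"
    unfolding gv using z(3) by (simp add: act_def retv_def rotv_def embv_def)
qed

end

section \<open>From a linearization to an equivariant embedding\<close>

text \<open>
  \<open>f\<close> is polynomial, vanishes at \<open>0\<close> and has derivative \<open>L\<close> there.
\<close>

definition tangent :: "('a::field_char_0 \<Rightarrow> 'a) \<Rightarrow> 'a \<Rightarrow> bool" where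
  "tangent f L \<longleftrightarrow> (\<exists>R. \<forall>\<epsilon>. f \<epsilon> = \<epsilon> * L + \<epsilon>\<^sup>2 * poly R \<epsilon>)"

lemma tangent_linear: "tangent (\<lambda>\<epsilon>. \<epsilon> * L) L"
  unfolding tangent_def by (rule exI[of _ 0]) simp

lemma tangent_add: "tangent f L \<Longrightarrow> tangent g M \<Longrightarrow> tangent (\<lambda>\<epsilon>. f \<epsilon> + g \<epsilon>) (L + M)"
proof -
  assume "tangent f L" "tangent g M"
  then obtain R S where "\<And>\<epsilon>. f \<epsilon> = \<epsilon> * L + \<epsilon>\<^sup>2 * poly R \<epsilon>" "\<And>\<epsilon>. g \<epsilon> = \<epsilon> * M + \<epsilon>\<^sup>2 * poly S \<epsilon>"
    unfolding tangent_def by blast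
  then show ?thesis unfolding tangent_def by (intro exI[of _ "R + S"]) (simp add: algebra_simps)
qed

lemma tangent_diff: "tangent f L \<Longrightarrow> tangent g M \<Longrightarrow> tangent (\<lambda>\<epsilon>. f \<epsilon> - g \<epsilon>) (L - M)"
proof -
  assume "tangent f L" "tangent g M"
  then obtain R S where "\<And>\<epsilon>. f \<epsilon> = \<epsilon> * L + \<epsilon>\<^sup>2 * poly R \<epsilon>" "\<And>\<epsilon>. g \<epsilon> = \<epsilon> * M + \<epsilon>\<^sup>2 * poly S \<epsilon>"
    unfolding tangent_def by blast
  then show ?thesis unfolding tangent_def by (intro exI[of _ "R - S"]) (simp add: algebra_simps)
qed

lemma tangent_cmult: "tangent f L \<Longrightarrow> tangent (\<lambda>\<epsilon>. c * f \<epsilon>) (c * L)"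
proof -
  assume "tangent f L"
  then obtain R where "\<And>\<epsilon>. f \<epsilon> = \<epsilon> * L + \<epsilon>\<^sup>2 * poly R \<epsilon>" unfolding tangent_def by blast
  then show ?thesis unfolding tangent_def by (intro exI[of _ "Polynomial.smult c R"]) (simp add: algebra_simps)
qed

lemma tangent_mult: "tangent f L \<Longrightarrow> tangent g M \<Longrightarrow> tangent (\<lambda>\<epsilon>. f \<epsilon> * g \<epsilon>) 0"
proof -
  assume "tangent f L" "tangent g M"
  then obtain R S where "\<And>\<epsilon>. f \<epsilon> = \<epsilon> * L + \<epsilon>\<^sup>2 * poly R \<epsilon>" "\<And>\<epsilon>. g \<epsilon> = \<epsilon> * M + \<epsilon>\<^sup>2 * poly S \<epsilon>"
    unfolding tangent_def by blast
  then show ?thesis unfolding tangent_def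
    by (intro exI[of _ "[:L * M:] + [:0, 1:] * (Polynomial.smult L S + Polynomial.smult M R) + [:0, 0, 1:] * (R * S)"])
      (simp add: algebra_simps power2_eq_square)
qed

lemma tangent_eq: "tangent f L \<Longrightarrow> f = g \<Longrightarrow> L = M \<Longrightarrow> tangent g M" by simp

lemma tangent_poly:
  assumes "tangent f L"
  obtains P where "\<And>\<epsilon>. f \<epsilon> = poly P \<epsilon>" "poly P 0 = 0" "poly.coeff P 1 = L"
proof -
  obtain R where "\<And>\<epsilon>. f \<epsilon> = \<epsilon> * L + \<epsilon>\<^sup>2 * poly R \<epsilon>" using assms unfolding tangent_def by blast
  then show ?thesis by (intro that[of "[:0, L:] + [:0, 0, 1:] * R"]) (simp_all add: power2_eq_square algebra_simps)
qed

context quadratic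
begin

text \<open>
  The derivative of the action at the origin: \<open>w\<close> vanishes to second order, so \<open>z\<close> and \<open>u\<close> remain.
\<close>

definition tangent_act :: "'a Matrix.vec \<Rightarrow> 'a Matrix.vec \<Rightarrow> 'a Matrix.vec" where
  "tangent_act g v = Matrix.vec 4 (\<lambda>i. rot i (g $ 0) (g $ 1) (Matrix.vec 6 (\<lambda>j. if j < 4 then v $ j else 0)))"

lemma tangent_act_nth: "tangent_act g v $ 0 = ((g $ 0)\<^sup>2 + d * (g $ 1)\<^sup>2) * v $ 0 + d * (2 * g $ 0 * g $ 1 * v $ 1)"
  "tangent_act g v $ 1 = ((g $ 0)\<^sup>2 + d * (g $ 1)\<^sup>2) * v $ 1 + 2 * g $ 0 * g $ 1 * v $ 0"
  "tangent_act g v $ 2 = (g $ 0 ^ 3 + 3 * d * g $ 0 * (g $ 1)\<^sup>2) * v $ 2 + d * ((3 * (g $ 0)\<^sup>2 * g $ 1 + d * g $ 1 ^ 3) * v $ 3)"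
  "tangent_act g v $ 3 = (g $ 0 ^ 3 + 3 * d * g $ 0 * (g $ 1)\<^sup>2) * v $ 3 + (3 * (g $ 0)\<^sup>2 * g $ 1 + d * g $ 1 ^ 3) * v $ 2"
  by (simp_all add: tangent_act_def rot_def)

lemma tangent_act_carrier [simp]: "tangent_act g v \<in> carrier_vec 4"
  by (simp add: tangent_act_def)

lemma tangent_act_pt:
  assumes g: "g \<in> carrier torus"
  shows "tangent_act g (pt x y U V) = pt ((chr g)\<^sup>2 * x) (y / (chr g)\<^sup>2) (chr g ^ 3 * U) (V / chr g ^ 3)"
proof -
  have inv: "y / (chr g)\<^sup>2 = (g $ 0 - s * g $ 1)\<^sup>2 * y" "V / chr g ^ 3 = (g $ 0 - s * g $ 1) ^ 3 * V"
    unfolding chr_inverse[OF g] by (simp_all add: power_divide)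
  let ?v = "pt x y U V" and ?a = "g $ 0" and ?b = "g $ 1"
  have "tangent_act g ?v = pt (tangent_act g ?v $ 0 + s * tangent_act g ?v $ 1) (tangent_act g ?v $ 0 - s * tangent_act g ?v $ 1)
      (tangent_act g ?v $ 2 + s * tangent_act g ?v $ 3) (tangent_act g ?v $ 2 - s * tangent_act g ?v $ 3)"
    by (rule pt_eq) simp
  also have "tangent_act g ?v $ 0 + s * tangent_act g ?v $ 1 = (?a + s * ?b)\<^sup>2 * (?v $ 0 + s * ?v $ 1)"
    unfolding tangent_act_nth by (simp add: algebra_simps power2_eq_square)
  also have "tangent_act g ?v $ 0 - s * tangent_act g ?v $ 1 = (?a - s * ?b)\<^sup>2 * (?v $ 0 - s * ?v $ 1)"
    unfolding tangent_act_nth by (simp add: algebra_simps power2_eq_square)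
  also have "tangent_act g ?v $ 2 + s * tangent_act g ?v $ 3 = (?a + s * ?b) ^ 3 * (?v $ 2 + s * ?v $ 3)"
    unfolding tangent_act_nth by (simp add: algebra_simps power2_eq_square power3_eq_cube)
  also have "tangent_act g ?v $ 2 - s * tangent_act g ?v $ 3 = (?a - s * ?b) ^ 3 * (?v $ 2 - s * ?v $ 3)"
    unfolding tangent_act_nth by (simp add: algebra_simps power2_eq_square power3_eq_cube)
  finally show ?thesis unfolding pt_pairs inv unfolding chr_def .
qed

lemma tangent_of_act:
  assumes "j < 4"
  shows "tangent (\<lambda>\<epsilon>. act g (Matrix.vec 4 (\<lambda>i. \<epsilon> * a i)) $ j) (tangent_act g (Matrix.vec 4 a) $ j)"
proof -
  define c where "c = (\<lambda>\<epsilon>. Matrix.vec 4 (\<lambda>i. \<epsilon> * a i))"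
  have tc: "tangent (\<lambda>\<epsilon>. c \<epsilon> $ i) (a i)" if "i < 4" for i
    unfolding c_def using that tangent_linear by simp
  have tr: "tangent (\<lambda>\<epsilon>. cr (c \<epsilon>)) (a 3)"
    unfolding cr_def
    by (rule tangent_eq[OF tangent_diff[OF tangent_add[OF tc[of 3] tangent_cmult[OF tangent_mult[OF tc[of 0] tc[of 3]]]] tangent_cmult[OF tangent_mult[OF tc[of 1] tc[of 2]]]] refl]) simp_all
  have tg: "tangent (\<lambda>\<epsilon>. cg (c \<epsilon>)) (a 2)"
    unfolding cg_def
    by (rule tangent_eq[OF tangent_diff[OF tc[of 2] tangent_cmult[OF tangent_mult[OF tc[of 1] tr]]] refl]) simp_all
  have t1: "tangent (\<lambda>\<epsilon>. cw1 (c \<epsilon>)) 0"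
    unfolding cw1_def
    by (rule tangent_eq[OF tangent_diff[OF tangent_mult[OF tc[of 0] tg] tangent_cmult[OF tangent_mult[OF tc[of 1] tr]]] refl]) simp_all
  have t2: "tangent (\<lambda>\<epsilon>. cw2 (c \<epsilon>)) 0"
    unfolding cw2_def
    by (rule tangent_eq[OF tangent_diff[OF tangent_diff[OF tangent_mult[OF tc[of 0] tc[of 3]] tangent_mult[OF tc[of 1] tc[of 2]]]
      tangent_cmult[OF tangent_mult[OF tc[of 1] tangent_mult[OF tc[of 1] tr]]]] refl]) simp_all
  define e where "e = (\<lambda>i. if i < 4 then a i else 0)"
  have te: "tangent (\<lambda>\<epsilon>. embv (c \<epsilon>) $ i) (e i)" if "i < 6" for i
  proof -
    have u: "tangent (\<lambda>\<epsilon>. cg (c \<epsilon>) - cw1 (c \<epsilon>)) (a 2)" "tangent (\<lambda>\<epsilon>. cr (c \<epsilon>) - cw2 (c \<epsilon>)) (a 3)"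
      using tangent_diff[OF tg t1] tangent_diff[OF tr t2] by simp_all
    show ?thesis using less_6_cases[OF that]
      by (elim disjE) (simp_all only: emb_nth e_def, simp_all add: tc t1 t2 u tc[of 1, simplified])
  qed
  have tlin: "tangent (\<lambda>\<epsilon>. A * embv (c \<epsilon>) $ i + B * embv (c \<epsilon>) $ l) (A * e i + B * e l)"
    "tangent (\<lambda>\<epsilon>. A * embv (c \<epsilon>) $ i + d * (B * embv (c \<epsilon>) $ l)) (A * e i + d * (B * e l))" if "i < 6" "l < 6" for A B i l
    by (intro tangent_add tangent_cmult te that)+
  define f where "f = (\<lambda>i. rot i (g $ 0) (g $ 1) (Matrix.vec 6 e))"
  have tf: "tangent (\<lambda>\<epsilon>. rotv g (embv (c \<epsilon>)) $ i) (f i)" if "i < 6" for i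
    using less_6_cases[OF that] unfolding f_def
    by (elim disjE) (simp_all add: rot_nth rot_def tlin tlin[of 1, simplified] tlin[of _ 1, simplified])
  have f45: "f 4 = 0" "f 5 = 0" by (simp_all add: f_def rot_def e_def)
  have fj: "f i = tangent_act g (Matrix.vec 4 a) $ i" if "i < 4" for i
  proof -
    have "Matrix.vec 6 e = Matrix.vec 6 (\<lambda>j. if j < 4 then Matrix.vec 4 a $ j else 0)"
      by (intro eq_vecI) (auto simp: e_def)
    then show ?thesis using that by (simp add: f_def tangent_act_def)
  qed
  let ?E = "\<lambda>\<epsilon>. rotv g (embv (c \<epsilon>))"
  have t24: "tangent (\<lambda>\<epsilon>. ?E \<epsilon> $ 2 + ?E \<epsilon> $ 4) (f 2)" "tangent (\<lambda>\<epsilon>. ?E \<epsilon> $ 3 + ?E \<epsilon> $ 5) (f 3)"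
    using tangent_add[OF tf[of 2] tf[of 4]] tangent_add[OF tf[of 3] tf[of 5]] f45 by simp_all
  have "tangent (\<lambda>\<epsilon>. ?E \<epsilon> $ 2 + ?E \<epsilon> $ 4 + d * (?E \<epsilon> $ 1 * (?E \<epsilon> $ 3 + ?E \<epsilon> $ 5))) (f 2 + d * 0)"
    by (intro tangent_add[OF t24(1)] tangent_cmult tangent_mult[OF tf t24(2)]) simp
  moreover have "tangent (\<lambda>\<epsilon>. ?E \<epsilon> $ 3 + ?E \<epsilon> $ 5 - 2 * (?E \<epsilon> $ 5 - ?E \<epsilon> $ 1 * (?E \<epsilon> $ 2 + ?E \<epsilon> $ 4))) (f 3 - 2 * (f 5 - 0))"
    by (intro tangent_diff t24(2) tangent_cmult tf tangent_mult[OF tf t24(1)]) simp_all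
  ultimately have "tangent (\<lambda>\<epsilon>. retv (?E \<epsilon>) $ j) (f j)"
    using less_4_cases[OF assms] by (elim disjE) (simp_all only: ret_nth, simp_all add: tf tf[of 1, simplified] f45)
  then show ?thesis unfolding fj[OF assms] by (simp add: act_def c_def)
qed

lemma sum_mult_vec_index:
  assumes "A \<in> carrier_mat m n" "v \<in> carrier_vec n" "i < m"
  shows "(A *\<^sub>v v) $ i = (\<Sum>j<n. A $$ (i, j) * v $ j)"
  using assms by (simp add: scalar_prod_def atLeast0LessThan)

text \<open>
  With \<open>\<phi>\<close> a linearization, \<open>\<Phi>\<close> its inverse and \<open>M\<close> the derivative of \<open>\<phi>\<close> at the origin, the map
  \<open>\<Psi> = \<Phi> \<circ> M\<close> intertwines the tangent representation with the action: differentiating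
  \<open>\<phi> (g v) = \<rho> g (\<phi> v)\<close> at the origin gives \<open>M (g v) = \<rho> g (M v)\<close> for the linearized action on the
  left.  A left inverse of \<open>\<Psi>\<close> is \<open>N \<circ> \<phi>\<close> with \<open>N\<close> the derivative of \<open>\<Phi>\<close>.
\<close>

theorem act_not_linearizable: "\<not> linearizable k torus 4 act"
proof
  let ?C = "carrier_vec 4 :: 'a Matrix.vec set"
  assume "linearizable k torus 4 act"
  then obtain \<phi> where aut: "affine_space_automorphism k 4 \<phi>"
    and lin: "\<And>g. g \<in> carrier torus \<Longrightarrow> linear_endo 4 (\<lambda>v. \<phi> (act g (inv_into ?C \<phi> v)))"
    unfolding linearizable_def by blast
  define \<Phi> where "\<Phi> = inv_into ?C \<phi>"
  have bij: "bij_betw \<phi> ?C ?C" using aut unfolding affine_space_automorphism_def by blast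
  have \<phi>C: "\<phi> v \<in> ?C" and \<Phi>C: "\<Phi> v \<in> ?C" and \<Phi>\<phi>: "\<Phi> (\<phi> v) = v" and \<phi>\<Phi>: "\<phi> (\<Phi> v) = v" if "v \<in> ?C" for v
    unfolding \<Phi>_def
    using bij_betw_apply[OF bij that] bij_betw_apply[OF bij_betw_inv_into[OF bij] that]
      bij_betw_inv_into_left[OF bij that] bij_betw_inv_into_right[OF bij that] .
  have reg: "regular_map k 4 ?C 4 ?C \<phi>" "regular_map k 4 ?C 4 ?C \<Phi>"
    using aut unfolding affine_space_automorphism_def \<Phi>_def by simp_all
  note ex = reg[unfolded regular_map_def, THEN conjunct2]
  from ex(1) obtain p where "\<forall>i<4. p i \<in> poly_fun k 4" "\<forall>v\<in>?C. \<phi> v = Matrix.vec 4 (\<lambda>i. p i v)"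
    by (elim exE conjE)
  note p = this[rule_format]
  from ex(2) obtain P where "\<forall>i<4. P i \<in> poly_fun k 4" "\<forall>v\<in>?C. \<Phi> v = Matrix.vec 4 (\<lambda>i. P i v)"
    by (elim exE conjE)
  note P = this[rule_format]
  have "\<forall>g\<in>carrier torus. \<exists>A\<in>carrier_mat 4 4. \<forall>v\<in>?C. \<phi> (act g (\<Phi> v)) = A *\<^sub>v v"
    using lin unfolding linear_endo_def \<Phi>_def by blast
  from bchoice[OF this[unfolded Bex_def]]
  obtain \<rho> where "\<forall>g\<in>carrier torus. \<rho> g \<in> carrier_mat 4 4 \<and> (\<forall>v\<in>?C. \<phi> (act g (\<Phi> v)) = \<rho> g *\<^sub>v v)"
    by (elim exE)
  then have \<rho>: "\<And>g. g \<in> carrier torus \<Longrightarrow> \<rho> g \<in> carrier_mat 4 4"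
    "\<And>g v. g \<in> carrier torus \<Longrightarrow> v \<in> ?C \<Longrightarrow> \<phi> (act g (\<Phi> v)) = \<rho> g *\<^sub>v v" by simp_all
  have \<rho>\<phi>: "\<phi> (act g v) = \<rho> g *\<^sub>v \<phi> v" if "g \<in> carrier torus" "v \<in> ?C" for g v
    using \<rho>(2)[OF that(1) \<phi>C[OF that(2)]] \<Phi>\<phi>[OF that(2)] by simp
  have \<rho>\<Phi>: "\<Phi> (\<rho> g *\<^sub>v v) = act g (\<Phi> v)" if "g \<in> carrier torus" "v \<in> ?C" for g v
    using \<rho>(2)[OF that] \<Phi>\<phi>[OF act_carrier[OF \<Phi>C[OF that(2)]]] by metis
  let ?o = "0\<^sub>v 4 :: 'a Matrix.vec"
  have \<Phi>0: "\<Phi> ?o = ?o"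
  proof -
    \<comment> \<open>the parameter \<open>2\<close> has no nontrivial power equal to \<open>1\<close>, so it fixes only the origin\<close>
    let ?g = "torus_pt 2" and ?e = "embv (\<Phi> ?o)"
    have g: "?g \<in> carrier torus" by (rule torus_pt_in) simp
    have "\<rho> ?g *\<^sub>v ?o = ?o" using \<rho>(1)[OF g] by (intro eq_vecI) auto
    then have "act ?g (\<Phi> ?o) = \<Phi> ?o" using \<rho>\<Phi>[OF g, of ?o] by simp
    then have invar: "rotv ?g ?e = ?e" using emb_act[OF g \<Phi>C[of ?o]] by simp
    have "?e = 0\<^sub>v 6"
    proof (rule pr_eqI)
      fix j b assume j: "j < (3::nat)"
      have two: "(2 :: 'a) ^ ([2, 3, 1] ! j) \<noteq> 1" using less_3_cases[OF j] by (elim disjE) simp_all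
      have "pr ?e j b = 0"
      proof (cases b)
        case True
        have "pr ?e j True = pr ?e j True / 2 ^ ([2, 3, 1] ! j)"
          using pr_rot_True[OF g j, of ?e] unfolding invar chr_torus_pt .
        then show ?thesis using two True by (simp add: field_simps)
      next
        case False
        have "pr ?e j False = 2 ^ ([2, 3, 1] ! j) * pr ?e j False"
          using pr_rot_False[OF j, of ?g ?e] unfolding invar chr_torus_pt .
        then show ?thesis using two False by simp
      qed
      moreover have "pr (0\<^sub>v 6) j b = 0" using j by (simp add: pr_def)
      ultimately show "pr ?e j b = pr (0\<^sub>v 6) j b" by simp
    qed auto
    then have "retv ?e = ?o" by (intro vec4_eqI) (simp_all only: ret_nth, simp_all)
    then show ?thesis using ret_emb[OF \<Phi>C[of ?o]] by simp
  qed
  then have \<phi>0: "\<phi> ?o = ?o" using \<phi>\<Phi>[of ?o] by simp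
  have "\<forall>i<4. \<exists>G. (\<forall>j<4. G j \<in> poly_fun k 4) \<and> gradient_of 4 (p i) G"
    using poly_fun_gradient[OF sub_field_axioms p(1)] by blast
  then obtain Gp where Gp: "\<And>i j. i < 4 \<Longrightarrow> j < 4 \<Longrightarrow> Gp i j \<in> poly_fun k 4" "\<And>i. i < 4 \<Longrightarrow> gradient_of 4 (p i) (Gp i)" by metis
  have "\<forall>i<4. \<exists>G. (\<forall>j<4. G j \<in> poly_fun k 4) \<and> gradient_of 4 (P i) G"
    using poly_fun_gradient[OF sub_field_axioms P(1)] by blast
  then obtain GP where GP: "\<And>i. i < 4 \<Longrightarrow> gradient_of 4 (P i) (GP i)" by metis
  define M where "M i j = Gp i j ?o" for i j
  define N where "N i j = GP i j ?o" for i j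
  have Mk: "M i j \<in> k" if "i < 4" "j < 4" for i j
    unfolding M_def by (rule poly_fun_closed[OF sub_field_axioms Gp(1)[OF that]]) (simp add: zero)
  \<comment> \<open>derivative of phi along a polynomial curve through 0\<close>
  have dphi: "\<exists>Q. (\<forall>\<epsilon>. \<phi> (Matrix.vec 4 (\<lambda>j. poly (c j) \<epsilon>)) = Matrix.vec 4 (\<lambda>i. poly (Q i) \<epsilon>)) \<and>
      (\<forall>i<4. poly (Q i) 0 = 0 \<and> poly.coeff (Q i) 1 = (\<Sum>j<4. M i j * poly.coeff (c j) 1))"
    if c0: "\<And>j. j < 4 \<Longrightarrow> poly (c j) 0 = 0" for c :: "nat \<Rightarrow> 'a poly"
  proof -
    have c00: "Matrix.vec 4 (\<lambda>j. poly (c j) 0) = ?o" by (rule eq_vecI) (simp_all add: c0)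
    have "\<forall>i<4. \<exists>Q. \<forall>\<epsilon>. p i (Matrix.vec 4 (\<lambda>j. poly (c j) \<epsilon>)) = poly Q \<epsilon>"
      using poly_fun_along_curve[OF p(1)] by blast
    then obtain Q where Q: "\<And>i \<epsilon>. i < 4 \<Longrightarrow> p i (Matrix.vec 4 (\<lambda>j. poly (c j) \<epsilon>)) = poly (Q i) \<epsilon>" by metis
    have 1: "\<phi> (Matrix.vec 4 (\<lambda>j. poly (c j) \<epsilon>)) = Matrix.vec 4 (\<lambda>i. poly (Q i) \<epsilon>)" for \<epsilon>
      by (subst p(2)) (auto intro!: eq_vecI simp: Q)
    have "poly (Q i) 0 = 0" if "i < 4" for i
    proof -
      have "Matrix.vec 4 (\<lambda>i. poly (Q i) 0) = ?o" using 1[of 0] unfolding c00 \<phi>0 by simp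
      then have "Matrix.vec 4 (\<lambda>i. poly (Q i) 0) $ i = ?o $ i" by (rule arg_cong)
      then show ?thesis using that by simp
    qed
    moreover have "poly.coeff (Q i) 1 = (\<Sum>j<4. M i j * poly.coeff (c j) 1)" if "i < 4" for i
      using gradient_ofD[OF Gp(2)[OF that] Q[OF that]] unfolding c00 M_def .
    ultimately show ?thesis using 1 by blast
  qed
  have line: "Matrix.vec 4 (\<lambda>j. poly [:0, a j:] \<epsilon>) = Matrix.vec 4 (\<lambda>j. \<epsilon> * a j)" for a \<epsilon>
    by (rule eq_vecI) simp_all
  have NM: "(\<Sum>j<4. N i j * (\<Sum>l<4. M j l * a l)) = a i" if i: "i < 4" for a i
  proof -
    obtain Q where Q: "\<And>\<epsilon>. \<phi> (Matrix.vec 4 (\<lambda>j. \<epsilon> * a j)) = Matrix.vec 4 (\<lambda>i. poly (Q i) \<epsilon>)"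
      "\<And>i. i < 4 \<Longrightarrow> poly (Q i) 0 = 0" "\<And>i. i < 4 \<Longrightarrow> poly.coeff (Q i) 1 = (\<Sum>j<4. M i j * a j)"
      using dphi[of "\<lambda>j. [:0, a j:]"] unfolding line by auto
    have Q0: "Matrix.vec 4 (\<lambda>j. poly (Q j) 0) = ?o" by (rule eq_vecI) (simp_all add: Q)
    have "P i (Matrix.vec 4 (\<lambda>j. poly (Q j) \<epsilon>)) = poly [:0, a i:] \<epsilon>" for \<epsilon>
    proof -
      have "\<Phi> (Matrix.vec 4 (\<lambda>j. poly (Q j) \<epsilon>)) = Matrix.vec 4 (\<lambda>j. \<epsilon> * a j)"
        unfolding Q(1)[symmetric] by (rule \<Phi>\<phi>) simp
      then have "\<Phi> (Matrix.vec 4 (\<lambda>j. poly (Q j) \<epsilon>)) $ i = \<epsilon> * a i" using i by simp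
      then show ?thesis using i by (simp add: P(2))
    qed
    from gradient_ofD[OF GP[OF i] this] have "a i = (\<Sum>j<4. N i j * poly.coeff (Q j) 1)"
      unfolding Q0 N_def[symmetric] by simp
    also have "\<dots> = (\<Sum>j<4. N i j * (\<Sum>l<4. M j l * a l))"
      by (intro sum.cong refl) (simp only: Q(3) lessThan_iff)
    finally show ?thesis by simp
  qed
  define Mv where "Mv v = Matrix.vec 4 (\<lambda>i. \<Sum>l<4. M i l * v $ l)" for v :: "'a Matrix.vec"
  have MvC [simp]: "Mv v \<in> ?C" for v by (simp add: Mv_def)
  have M_equiv: "Mv (tangent_act g v) = \<rho> g *\<^sub>v Mv v" if g: "g \<in> carrier torus" and v: "v \<in> ?C" for g v
  proof (rule eq_vecI)
    define a where "a = (\<lambda>i. v $ i)"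
    have va: "Matrix.vec 4 a = v" using v by (auto simp: a_def intro!: eq_vecI)
    obtain Q where Q: "\<And>\<epsilon>. \<phi> (Matrix.vec 4 (\<lambda>j. \<epsilon> * a j)) = Matrix.vec 4 (\<lambda>i. poly (Q i) \<epsilon>)"
      "\<And>i. i < 4 \<Longrightarrow> poly.coeff (Q i) 1 = (\<Sum>j<4. M i j * a j)"
      using dphi[of "\<lambda>j. [:0, a j:]"] unfolding line by auto
    have "\<forall>j<4. \<exists>m. (\<forall>\<epsilon>. act g (Matrix.vec 4 (\<lambda>i. \<epsilon> * a i)) $ j = poly m \<epsilon>) \<and> poly m 0 = 0 \<and> poly.coeff m 1 = tangent_act g v $ j"
      using tangent_poly[OF tangent_of_act[of _ g a, unfolded va]] by metis
    then obtain m where m: "\<And>j \<epsilon>. j < 4 \<Longrightarrow> act g (Matrix.vec 4 (\<lambda>i. \<epsilon> * a i)) $ j = poly (m j) \<epsilon>"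
      "\<And>j. j < 4 \<Longrightarrow> poly (m j) 0 = 0" "\<And>j. j < 4 \<Longrightarrow> poly.coeff (m j) 1 = tangent_act g v $ j" by metis
    have mv: "Matrix.vec 4 (\<lambda>j. poly (m j) \<epsilon>) = act g (Matrix.vec 4 (\<lambda>i. \<epsilon> * a i))" for \<epsilon>
      using act_carrier[of "Matrix.vec 4 (\<lambda>i. \<epsilon> * a i)" g] by (intro eq_vecI) (simp_all add: m)
    obtain R where R: "\<And>\<epsilon>. \<phi> (Matrix.vec 4 (\<lambda>j. poly (m j) \<epsilon>)) = Matrix.vec 4 (\<lambda>i. poly (R i) \<epsilon>)"
      "\<And>i. i < 4 \<Longrightarrow> poly.coeff (R i) 1 = (\<Sum>j<4. M i j * tangent_act g v $ j)"
      using dphi[of m] m(2,3) by auto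
    fix i assume "i < dim_vec (\<rho> g *\<^sub>v Mv v)"
    then have i: "i < 4" using \<rho>(1)[OF g] by simp
    have "poly (R i) \<epsilon> = poly (\<Sum>j<4. Polynomial.smult (\<rho> g $$ (i, j)) (Q j)) \<epsilon>" for \<epsilon>
    proof -
      have "Matrix.vec 4 (\<lambda>i. poly (R i) \<epsilon>) = \<rho> g *\<^sub>v Matrix.vec 4 (\<lambda>i. poly (Q i) \<epsilon>)"
        unfolding R(1)[symmetric] Q(1)[symmetric] mv by (rule \<rho>\<phi>[OF g]) simp
      then have "Matrix.vec 4 (\<lambda>i. poly (R i) \<epsilon>) $ i = (\<rho> g *\<^sub>v Matrix.vec 4 (\<lambda>i. poly (Q i) \<epsilon>)) $ i" by simp
      then show ?thesis using i sum_mult_vec_index[OF \<rho>(1)[OF g], of "Matrix.vec 4 (\<lambda>i. poly (Q i) \<epsilon>)" i]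
        by (simp add: poly_sum)
    qed
    then have "R i = (\<Sum>j<4. Polynomial.smult (\<rho> g $$ (i, j)) (Q j))" by (intro poly_eqI_char_0) blast
    then have "poly.coeff (R i) 1 = (\<Sum>j<4. \<rho> g $$ (i, j) * poly.coeff (Q j) 1)"
      by (simp add: coeff_sum)
    also have "\<dots> = (\<Sum>j<4. \<rho> g $$ (i, j) * (\<Sum>l<4. M j l * a l))"
      by (intro sum.cong refl) (simp only: Q(2) lessThan_iff)
    finally have "poly.coeff (R i) 1 = (\<Sum>j<4. \<rho> g $$ (i, j) * (\<Sum>l<4. M j l * a l))" .
    then show "Mv (tangent_act g v) $ i = (\<rho> g *\<^sub>v Mv v) $ i"
      using i sum_mult_vec_index[OF \<rho>(1)[OF g] MvC i] R(2)[OF i] by (simp add: Mv_def a_def)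
  qed (use \<rho>(1)[OF that(1)] in \<open>simp add: Mv_def\<close>)
  define \<Psi> where "\<Psi> v = \<Phi> (Mv v)" for v
  have \<Psi>C [simp]: "\<Psi> v \<in> ?C" for v unfolding \<Psi>_def by (rule \<Phi>C[OF MvC])
  have \<Psi>equiv: "\<Psi> (tangent_act g v) = act g (\<Psi> v)" if "g \<in> carrier torus" "v \<in> ?C" for g v
    unfolding \<Psi>_def M_equiv[OF that] by (rule \<rho>\<Phi>[OF that(1) MvC])
  define F where "F j v = emb j (Matrix.vec 4 (\<lambda>i. P i (Matrix.vec 4 (\<lambda>i. \<Sum>l<4. M i l * v $ l))))" for j v
  define H where "H i e = (\<Sum>j<4. N i j * p j (Matrix.vec 4 (\<lambda>l. ret l e)))" for i e
  have FE: "F j v = embv (\<Psi> v) $ j" if "j < 6" for j v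
    using that P(2)[OF MvC] unfolding F_def embv_def \<Psi>_def Mv_def by simp
  have pairF: "pair F j b v = pr (embv (\<Psi> v)) j b" if "j < 3" for j b v
    using that by (simp add: pair_def pr_def FE)
  have tor: "torus_pt g \<in> carrier torus" "chr (torus_pt g) = g" if "g \<noteq> 0" for g
    using torus_pt_in[OF that] chr_torus_pt by auto
  have emb_tangent: "embv (\<Psi> (pt (g\<^sup>2 * x) (y / g\<^sup>2) (g ^ 3 * U) (V / g ^ 3))) = rotv (torus_pt g) (embv (\<Psi> (pt x y U V)))"
    if "g \<noteq> 0" for g x y U V
    using tangent_act_pt[OF tor(1)[OF that], of x y U V] \<Psi>equiv[OF tor(1)[OF that], of "pt x y U V"]
      emb_act[OF tor(1)[OF that] \<Psi>C, of "pt x y U V"] unfolding tor(2)[OF that] by simp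
  have "equivariant_embedding k s F H"
  proof (intro equivariant_embedding.intro quadratic_axioms equivariant_embedding_axioms.intro)
    have Mpf: "(\<lambda>v. \<Sum>l<4. M i l * v $ l) \<in> poly_fun k 4" if "i < 4" for i
      unfolding sum_lessThan_4 by (intro poly_fun.add poly_fun.mult poly_fun.const poly_fun.coord Mk that) simp_all
    then have "(\<lambda>v. P i (Matrix.vec 4 (\<lambda>i. \<Sum>l<4. M i l * v $ l))) \<in> poly_fun k 4" if "i < 4" for i
      by (intro poly_fun_compose[OF P(1)[OF that]])
    then show "F j \<in> poly_fun k 4" if "j < 6" for j
      unfolding F_def[abs_def] by (intro poly_fun_compose[OF emb_poly_fun[OF that]])
    have pU: "(\<lambda>e. p j (Matrix.vec 4 (\<lambda>l. ret l e))) \<in> poly_fun UNIV 6" if "j < 4" for j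
      by (intro poly_fun_compose[OF poly_fun_mono[OF p(1)[OF that]]] poly_fun_mono[OF ret_poly_fun]) auto
    show "H i \<in> poly_fun UNIV 6" if "i < 4" for i
      unfolding H_def[abs_def] sum_lessThan_4 by (intro poly_fun.add poly_fun.mult poly_fun.const pU) simp_all
    fix v :: "'a Matrix.vec" assume v: "v \<in> ?C"
    show "H i (Matrix.vec 6 (\<lambda>j. F j v)) = v $ i" if i: "i < 4" for i
    proof -
      have "Matrix.vec 6 (\<lambda>j. F j v) = embv (\<Psi> v)" by (rule eq_vecI) (simp_all add: FE embv_def)
      then have r: "Matrix.vec 4 (\<lambda>l. ret l (Matrix.vec 6 (\<lambda>j. F j v))) = \<Psi> v"
        using ret_emb[OF \<Psi>C[of v]] by (simp add: retv_def)
      have pj: "p j (\<Psi> v) = (\<Sum>l<4. M j l * v $ l)" if "j < 4" for j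
      proof -
        have "\<phi> (\<Psi> v) = Mv v" unfolding \<Psi>_def by (rule \<phi>\<Phi>[OF MvC])
        then have "\<phi> (\<Psi> v) $ j = Mv v $ j" by simp
        then show ?thesis using that by (simp add: p(2) Mv_def)
      qed
      have "(\<Sum>j<4. N i j * p j (\<Psi> v)) = (\<Sum>j<4. N i j * (\<Sum>l<4. M j l * v $ l))"
        by (intro sum.cong refl) (simp only: pj lessThan_iff)
      then show ?thesis unfolding H_def r using NM[OF i, of "\<lambda>l. v $ l"] by simp
    qed
    show "pair F 0 True v * pair F 1 False v = pair F 2 False v - pair F 0 False v * pair F 2 True v"
      "pair F 0 False v * pair F 1 True v = pair F 2 True v - pair F 0 True v * pair F 2 False v"
      using emb_on_surface[of "\<Psi> v"] unfolding on_surface_pr by (simp_all add: pairF)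
  next
    fix g x y U V :: 'a and j :: nat assume g: "g \<noteq> 0" and j: "j < 3"
    show "pair F j False (pt (g\<^sup>2 * x) (y / g\<^sup>2) (g ^ 3 * U) (V / g ^ 3)) = g ^ ([2, 3, 1] ! j) * pair F j False (pt x y U V)"
      unfolding pairF[OF j] emb_tangent[OF g] pr_rot_False[OF j] tor(2)[OF g] ..
    show "pair F j True (pt (g\<^sup>2 * x) (y / g\<^sup>2) (g ^ 3 * U) (V / g ^ 3)) = pair F j True (pt x y U V) / g ^ ([2, 3, 1] ! j)"
      unfolding pairF[OF j] emb_tangent[OF g] pr_rot_True[OF tor(1)[OF g] j] tor(2)[OF g] ..
  qed
  then show False by (rule equivariant_embedding.no_equivariant_embedding)
qed

end

theorem nonlinearizable_of_nonsquare:
  fixes k :: "'a::{alg_closed_field, field_char_0} set"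
  assumes "sub_field k" "t \<in> k" "\<not> square_in k t"
  shows "\<exists>n G \<mu>. k_group k n G \<and> group_dim n G = 1 \<and> comm_group G \<and> connected_group n G
           \<and> reductive_group n G \<and> algebraic_action k n G 4 \<mu> \<and> \<not> linearizable k G 4 \<mu>"
proof -
  obtain s where s: "s\<^sup>2 = t" using nth_root_exists[of 2 t] by auto
  interpret quadratic k s
    using assms s by (auto simp: quadratic_def quadratic_axioms_def square_in_def)
  show ?thesis
    using torus_k_group torus_dim torus_comm_group torus_connected torus_reductive act_algebraic
      act_not_linearizable by blast
qed

section \<open>The theorem\<close>

theorem corollary2:
  fixes k :: "'a::{alg_closed_field, field_char_0} set"
    and M :: "'m topology"
    and \<A> :: "('m set \<times> ('m \<Rightarrow> complex ^ 'n)) set"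
  assumes "algebraic_closure ring_of_type_algebra k"
    and "field_of k \<simeq> (ring_of_type_algebra :: real ring)
      \<or> (\<exists>p. Factorial_Ring.prime p \<and> field_of k \<simeq> padic_field p)
      \<or> number_field k
      \<or> finitely_generated_field k
      \<or> variety_function_field k
      \<or> (complex_manifold M \<A> \<and> connected_space M \<and> admits_nonconstant_meromorphic M \<A>
          \<and> field_of k \<simeq> meromorphic_field M \<A>)
      \<or> maximal_abelian_extension_of_Q k"
  shows "\<exists>n G \<mu>. k_group k n G \<and> group_dim n G = 1 \<and> comm_group G \<and> connected_group n G
           \<and> reductive_group n G \<and> algebraic_action k n G 4 \<mu> \<and> \<not> linearizable k G 4 \<mu>"
proof -
  have k: "sub_field k"
    using assms(1) unfolding algebraic_closure_def by (intro sub_field_of_subfield) simp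
  have "\<exists>t\<in>k. \<not> square_in k t"
    using assms(2)
  proof (elim disjE exE conjE)
    assume "field_of k \<simeq> (ring_of_type_algebra :: real ring)"
    then show ?thesis by (rule real_nonsquare)
  next
    fix p assume "Factorial_Ring.prime p" "field_of k \<simeq> padic_field p"
    then show ?thesis by (rule padic_nonsquare)
  next
    assume "number_field k"
    then show ?thesis by (intro finitely_generated_field_nonsquare number_field_finitely_generated)
  next
    assume "finitely_generated_field k"
    then show ?thesis by (rule finitely_generated_field_nonsquare)
  next
    assume "variety_function_field k"
    then show ?thesis by (rule variety_function_field_nonsquare[OF k])
  next
    assume "complex_manifold M \<A>" "connected_space M" "admits_nonconstant_meromorphic M \<A>"
      "field_of k \<simeq> meromorphic_field M \<A>"
    then show ?thesis by (rule meromorphic_nonsquare)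
  next
    assume "maximal_abelian_extension_of_Q k"
    then show ?thesis
      unfolding maximal_abelian_extension_of_Q_def by (intro abelian_extension_nonsquare) simp
  qed
  then show ?thesis using nonlinearizable_of_nonsquare[OF k] by blast
qed

end
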